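(* Let $\mu>-1$. Assume that $f\in L^\infty((0,\infty)\times(0,\infty))$ with compact support and $g\in L^\infty((0,\infty))$ with compact support. Define $$u(t,x)=\int_0^t\int_0^\infty W_\tau^\mu(x,y)f(t-\tau,y)\,dy\,d\tau+\int_0^\infty W_t^\mu(x,y)g(y)\,dy,\qquad t,x\in(0,\infty).$$ Then these integrals are absolutely convergent for every $t,x\in(0,\infty)$. Moreover, if $f$ is also in $C^2((0,\infty)\times(0,\infty))$, then $u$ is a classical solution of the Cauchy problem $$\partial_tu(t,x)=\Delta_\mu u(t,x)+f(t,x),\quad (t,x)\in(0,\infty)\times(0,\infty),\qquad u(0,x)=g(x),\quad x\in(0,\infty),$$ and, for $t,x\in(0,\infty)$, $$\frac{\partial u(t,x)}{\partial t}=\lim_{\epsilon\to0^+}\int_0^{t-\epsilon}\int_0^\infty\frac{\partial}{\partial\tau}W_\tau^\mu(x,y)f(t-\tau,y)\,dy\,d\tau+\int_0^\infty\frac{\partial}{\partial t}W_t^\mu(x,y)g(y)\,dy,$$ and $$\frac{\partial^2u(t,x)}{\partial x^2}=\lim_{\epsilon\to0^+}\int_0^{t-\epsilon}\int_0^\infty\frac{\partial^2}{\partial x^2}W_\tau^\mu(x,y)f(t-\tau,y)\,dy\,d\tau+\int_0^\infty\frac{\partial^2}{\partial x^2}W_t^\mu(x,y)g(y)\,dy.$$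
   Context: For $\mu>-1$ the Bessel operator is $\Delta_\mu=\partial_x^2+\left(\frac14-\mu^2\right)x^{-2}$ on $(0,\infty)$ (acting in the variable $x$), and $$W_t^\mu(x,y)=\frac{(xy)^{1/2}}{2t}I_\mu\left(\frac{xy}{2t}\right)e^{-\frac{x^2+y^2}{4t}},\qquad x,y,t\in(0,\infty),$$ where $I_\mu$ is the modified Bessel function of the first kind and order $\mu$.
   Formalization: The formula for ∂u/∂t gets the extra term f(t,x), since as printed it contradicts the equation together with the formula for ∂²u/∂x²; u(0,x)=g(x) is read as the limit of u(t,x) as t→0+, for almost every x and at every continuity point of g. *)

theory Defs
  imports "HOL-Analysis.Analysis"
begin

definition quadrant :: "(real \<times> real) set" where
  "quadrant = {0<..} \<times> {0<..}"

text \<open>The modified Bessel function of the first kind, by its power series. The reciprocal Gamma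
  function keeps the formula valid at the poles of Gamma. Since it uses \<open>powr\<close>, it is meant
  for arguments \<^term>\<open>z > 0\<close>.\<close>
definition bessel_I :: "real \<Rightarrow> real \<Rightarrow> real" where
  "bessel_I \<mu> z = (\<Sum>k. rGamma (real k + \<mu> + 1) / fact k * (z / 2) powr (2 * real k + \<mu>))"

definition bessel_kernel :: "real \<Rightarrow> real \<Rightarrow> real \<Rightarrow> real \<Rightarrow> real" where
  "bessel_kernel \<mu> t x y =
     sqrt (x * y) / (2 * t) * bessel_I \<mu> (x * y / (2 * t)) * exp (- (x\<^sup>2 + y\<^sup>2) / (4 * t))"

definition bessel_operator :: "real \<Rightarrow> (real \<Rightarrow> real) \<Rightarrow> real \<Rightarrow> real" where
  "bessel_operator \<mu> \<phi> x = deriv (deriv \<phi>) x + (1 / 4 - \<mu>\<^sup>2) / x\<^sup>2 * \<phi> x"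

definition Linfty_on :: "'a::euclidean_space set \<Rightarrow> ('a \<Rightarrow> real) \<Rightarrow> bool" where
  "Linfty_on S f \<longleftrightarrow>
     f \<in> borel_measurable (lebesgue_on S) \<and> (\<exists>C. AE z in lebesgue_on S. \<bar>f z\<bar> \<le> C)"

text \<open>Elements of \<open>L\<^sup>\<infinity>\<close> are classes modulo null sets, so the support is the essential one; it is
  a compact subset of \<^term>\<open>S\<close> itself, hence at positive distance from the boundary of an open
  \<^term>\<open>S\<close>.\<close>
definition compactly_supported_in :: "'a::euclidean_space set \<Rightarrow> ('a \<Rightarrow> real) \<Rightarrow> bool" where
  "compactly_supported_in S f \<longleftrightarrow>
     (\<exists>K. compact K \<and> K \<subseteq> S \<and> (AE z in lebesgue_on S. z \<notin> K \<longrightarrow> f z = 0))"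

definition C2_on :: "'a::real_normed_vector set \<Rightarrow> ('a \<Rightarrow> real) \<Rightarrow> bool" where
  "C2_on S f \<longleftrightarrow>
     (\<exists>(f' :: 'a \<Rightarrow> 'a \<Rightarrow>\<^sub>L real) (f'' :: 'a \<Rightarrow> 'a \<Rightarrow>\<^sub>L 'a \<Rightarrow>\<^sub>L real).
        (\<forall>z\<in>S. (f has_derivative blinfun_apply (f' z)) (at z)) \<and>
        (\<forall>z\<in>S. (f' has_derivative blinfun_apply (f'' z)) (at z)) \<and>
        continuous_on S f'')"

definition cauchy_solution ::
  "real \<Rightarrow> (real \<times> real \<Rightarrow> real) \<Rightarrow> (real \<Rightarrow> real) \<Rightarrow> real \<Rightarrow> real \<Rightarrow> real" where
  "cauchy_solution \<mu> f g t x =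
     (LINT \<tau>:{0<..<t}|lebesgue. LINT y:{0<..}|lebesgue. bessel_kernel \<mu> \<tau> x y * f (t - \<tau>, y))
     + (LINT y:{0<..}|lebesgue. bessel_kernel \<mu> t x y * g y)"

text \<open>Regularity \<open>C\<^sup>1\<^sup>,\<^sup>2\<close>: first order in \<open>t\<close>, second order in \<open>x\<close>.\<close>
definition C12_on_quadrant :: "(real \<Rightarrow> real \<Rightarrow> real) \<Rightarrow> bool" where
  "C12_on_quadrant u \<longleftrightarrow>
     (\<forall>t>0. \<forall>x>0. (\<lambda>s. u s x) field_differentiable at t \<and>
        u t field_differentiable at x \<and> deriv (u t) field_differentiable at x) \<and>
     continuous_on quadrant (\<lambda>(t, x). u t x) \<and>
     continuous_on quadrant (\<lambda>(t, x). deriv (\<lambda>s. u s x) t) \<and>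
     continuous_on quadrant (\<lambda>(t, x). deriv (u t) x) \<and>
     continuous_on quadrant (\<lambda>(t, x). deriv (deriv (u t)) x)"

text \<open>The initial value is attained as a limit for \<open>t \<rightarrow> 0\<^sup>+\<close>. As \<open>g\<close> is only
  essentially bounded, this can be required almost everywhere and at the points of continuity of
  \<open>g\<close>, but not at every point.\<close>
definition attains_initial_value :: "(real \<Rightarrow> real \<Rightarrow> real) \<Rightarrow> (real \<Rightarrow> real) \<Rightarrow> bool" where
  "attains_initial_value u g \<longleftrightarrow>
     (AE x in lebesgue_on {0<..}. ((\<lambda>t. u t x) \<longlongrightarrow> g x) (at_right 0)) \<and>
     (\<forall>x>0. isCont g x \<longrightarrow> ((\<lambda>t. u t x) \<longlongrightarrow> g x) (at_right 0))"

definition classical_solution ::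
  "real \<Rightarrow> (real \<times> real \<Rightarrow> real) \<Rightarrow> (real \<Rightarrow> real) \<Rightarrow> (real \<Rightarrow> real \<Rightarrow> real) \<Rightarrow> bool" where
  "classical_solution \<mu> f g u \<longleftrightarrow>
     C12_on_quadrant u \<and>
     (\<forall>t>0. \<forall>x>0. deriv (\<lambda>s. u s x) t = bessel_operator \<mu> (u t) x + f (t, x)) \<and>
     attains_initial_value u g"

text \<open>Existence of the iterated integral, inner variable first. Joint integrability on
  \<^term>\<open>A \<times> B\<close> would be too much for the differentiated kernels, whose singularity at
  \<open>\<tau> = 0\<close> is of order \<open>1/\<tau>\<close> in the \<open>L\<^sup>1\<close> norm.\<close>
definition iterated_integrable_on ::
  "real set \<Rightarrow> real set \<Rightarrow> (real \<Rightarrow> real \<Rightarrow> real) \<Rightarrow> bool" where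
  "iterated_integrable_on A B h \<longleftrightarrow>
     (\<forall>s\<in>A. set_integrable lebesgue B (h s)) \<and>
     set_integrable lebesgue A (\<lambda>s. LINT y:B|lebesgue. h s y)"

end

theory Submission
  imports Defs
begin

text \<open>Writing \<open>W\<close> through the entire series \<open>h\<^sub>\<mu>(q) = \<Sum> q\<^sup>k / (k! \<Gamma>(k + \<mu> + 1))\<close>, which satisfies
  \<open>h\<^sub>\<mu>' = h\<^sub>\<mu>\<^sub>+\<^sub>1\<close> and \<open>q h\<^sub>\<mu>\<^sub>+\<^sub>2 + (\<mu> + 1) h\<^sub>\<mu>\<^sub>+\<^sub>1 = h\<^sub>\<mu>\<close>, gives \<open>\<partial>\<^sub>t W = \<Delta>\<^sub>\<mu> W\<close> in each space variable.
  Integrating the series term by term against Gaussians gives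
  \<open>\<integral> W\<^sub>t(x, y) y\<^sup>\<mu>\<^sup>+\<^sup>1\<^sup>/\<^sup>2 exp(\<eta> y\<^sup>2) dy\<close> in closed form; with \<open>\<eta> = 0\<close> this is the conservation of mass,
  and with \<open>\<eta> = \<plusminus>1\<close> the concentration at \<open>y = x\<close> as \<open>t \<rightarrow> 0\<close>. Together with the bound
  \<open>I\<^sub>\<mu>(z) \<le> C z\<^sup>-\<^sup>1\<^sup>/\<^sup>2 e\<^sup>z\<close> this yields convergence to \<open>g\<close> at Lebesgue points.

  The derivatives of \<open>W\<^sub>\<tau>\<close> are not integrable near \<open>\<tau> = 0\<close>, but by Green's formula
  \<open>\<integral> \<partial>\<^sub>\<tau> W\<^sub>\<tau> f dy = \<integral> W\<^sub>\<tau> \<Delta>\<^sub>\<mu> f dy\<close> is bounded in \<open>\<tau>\<close>; hence so is \<open>\<integral> \<partial>\<^sub>x\<^sup>2 W\<^sub>\<tau> f dy\<close>, and by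
  interpolation \<open>\<integral> \<partial>\<^sub>x W\<^sub>\<tau> f dy\<close>, which justifies differentiating the Duhamel integral.\<close>

section \<open>Power series and derivatives of the Bessel kernel\<close>

text \<open>Two choices keep the singularity at \<tau> = 0 away from every differentiation. The
  source is extended by zero to all times, so the Duhamel integral runs over the whole half-line of
  \<tau>, no limit of integration moves with t, and the t-derivative falls on the source. Only
  afterwards does the fundamental theorem of calculus in \<tau> trade that derivative for one of the
  kernel; its boundary value at \<tau> = 0 is the source term of the equation. In x the kernel has
  to be differentiated, and then y is always integrated first: the bounds concern the inner integral
  and are uniform in \<tau>. For the initial value two kinds of smallness are needed. Away from x,
  the exponents \<eta> = 1, 0, -1 combine to the moment of 2 cosh(y^2 - x^2) - 2, which vanishes at
  y = x, so its expectation tends to 0 and Markov's inequality applies. Near x, total mass 1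
  suffices where g is continuous; at a mere Lebesgue point only averages of g over intervals are
  controlled, and the kernel needs a Gaussian majorant that decreases away from x.\<close>

definition bessel_coeff :: "real \<Rightarrow> nat \<Rightarrow> real" where
  "bessel_coeff \<mu> k = rGamma (real k + \<mu> + 1) / fact k"

text \<open>The regularised hypergeometric function 0F1(; \<mu> + 1; q) / Gamma(\<mu> + 1), the
  entire factor of the Bessel function: I_\<mu>(z) is (z/2)^\<mu> times its value at q = z^2 /
  4.\<close>

definition bessel_series :: "real \<Rightarrow> real \<Rightarrow> real" where
  "bessel_series \<mu> q = (\<Sum>k. bessel_coeff \<mu> k * q ^ k)"

lemma bessel_coeff_Suc:
  "(real k + \<mu> + 1) * (real k + 1) * bessel_coeff \<mu> (Suc k) = bessel_coeff \<mu> k"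
proof -
  have "rGamma (real k + \<mu> + 1) = (real k + \<mu> + 1) * rGamma (real (Suc k) + \<mu> + 1)"
    using rGamma_plus1[of "real k + \<mu> + 1"] by (simp add: add_ac)
  then show ?thesis
    by (simp add: bessel_coeff_def divide_simps del: of_nat_Suc)
qed

lemma bessel_coeff_pos: "\<mu> > -1 \<Longrightarrow> bessel_coeff \<mu> k > 0"
  using Gamma_real_pos[of "real k + \<mu> + 1"]
  by (simp add: bessel_coeff_def rGamma_inverse_Gamma)

lemma summable_bessel_series: "summable (\<lambda>k. bessel_coeff \<mu> k * q ^ k)"
\<comment> \<open>Consecutive terms have the ratio q / ((k + \<mu> + 1)(k + 1)). Beyond 2 |q| +
  |\<mu>| the first factor of the denominator is at least 1 and the second at least 2 |q|.\<close>
proof (rule summable_ratio_test[of "1/2" "nat \<lceil>2 * \<bar>q\<bar> + \<bar>\<mu>\<bar>\<rceil>"])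
  fix k assume k: "nat \<lceil>2 * \<bar>q\<bar> + \<bar>\<mu>\<bar>\<rceil> \<le> k"
  then have k': "2 * \<bar>q\<bar> + \<bar>\<mu>\<bar> \<le> real k" by linarith
  define a where "a = bessel_coeff \<mu> (Suc k)"
  have "1 \<le> (real k + \<mu> + 1)" using k' by linarith
  moreover have "2 * \<bar>q\<bar> \<le> real k + 1" using k' by linarith
  ultimately have "1 * (2 * \<bar>q\<bar>) \<le> (real k + \<mu> + 1) * (real k + 1)"
    by (intro mult_mono) auto
  then have "\<bar>q\<bar> * 2 * (\<bar>a\<bar> * \<bar>q\<bar> ^ k) \<le> ((real k + \<mu> + 1) * (real k + 1)) * (\<bar>a\<bar> * \<bar>q\<bar> ^ k)"
    by (intro mult_right_mono) auto
  also have "\<dots> = \<bar>(real k + \<mu> + 1) * (real k + 1) * a\<bar> * \<bar>q\<bar> ^ k"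
    using \<open>1 \<le> real k + \<mu> + 1\<close> by (simp add: abs_mult)
  also have "\<dots> = \<bar>bessel_coeff \<mu> k\<bar> * \<bar>q\<bar> ^ k"
    unfolding a_def bessel_coeff_Suc ..
  finally show "norm (bessel_coeff \<mu> (Suc k) * q ^ Suc k) \<le> 1 / 2 * norm (bessel_coeff \<mu> k * q ^ k)"
    by (simp add: a_def abs_mult power_abs mult_ac)
qed simp

lemma diffs_bessel_coeff: "diffs (bessel_coeff \<mu>) = bessel_coeff (\<mu> + 1)"
  by (rule ext) (simp add: diffs_def bessel_coeff_def divide_simps add_ac)

lemma bessel_series_has_derivative:
  "(bessel_series \<mu> has_real_derivative bessel_series (\<mu> + 1) q) (at q)"
  using termdiffs_strong_converges_everywhere[OF summable_bessel_series]
  unfolding bessel_series_def diffs_bessel_coeff by simp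

lemma continuous_on_bessel_series [continuous_intros]:
  "continuous_on A F \<Longrightarrow> continuous_on A (\<lambda>x. bessel_series \<mu> (F x))"
  using continuous_on_compose2[of UNIV "bessel_series \<mu>" A F]
    continuous_at_imp_continuous_on[of UNIV "bessel_series \<mu>"]
    DERIV_isCont[OF bessel_series_has_derivative]
  by blast

text \<open>Compare coefficients: multiplying the k-th coefficient for \<mu> + 1 by k shifts it to
  the series for \<mu> + 2, and multiplying it by k + \<mu> + 1 gives the one for \<mu>. Since
  differentiation raises the index, this is the Bessel equation q h'' + (\<mu> + 1) h' = h.\<close>

lemma bessel_series_ode:
  "q * bessel_series (\<mu> + 2) q + (\<mu> + 1) * bessel_series (\<mu> + 1) q = bessel_series \<mu> q"
proof -
  define c where "c = bessel_coeff (\<mu> + 2)"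
  define b where "b = bessel_coeff (\<mu> + 1)"
  have b: "summable (\<lambda>k. b k * q ^ k)" unfolding b_def by (rule summable_bessel_series)
  have c: "summable (\<lambda>k. c k * q ^ k)" unfolding c_def by (rule summable_bessel_series)
  have q: "(\<lambda>k. real (Suc k) * b (Suc k) * q ^ Suc k) = (\<lambda>k. q * (c k * q ^ k))"
    by (rule ext) (simp add: b_def c_def bessel_coeff_def divide_simps add_ac)
  have 1: "q * bessel_series (\<mu> + 2) q = (\<Sum>k. real k * b k * q ^ k)"
  proof -
    have "(\<lambda>k. real (Suc k) * b (Suc k) * q ^ Suc k) = (\<lambda>k. q * (c k * q ^ k))"
      by (rule q)
    moreover have "(\<lambda>k. q * (c k * q ^ k)) sums (q * bessel_series (\<mu> + 2) q)"
      unfolding bessel_series_def c_def by (intro sums_mult summable_sums summable_bessel_series)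
    ultimately have "(\<lambda>k. real (Suc k) * b (Suc k) * q ^ Suc k) sums (q * bessel_series (\<mu> + 2) q)"
      by simp
    \<comment> \<open>The term with k = 0 carries the factor 0, so the shifted series and the full
      one have the same sum.\<close>
    from sums_Suc[OF this] show ?thesis by (simp add: sums_iff)
  qed
  have s: "summable (\<lambda>k. real k * b k * q ^ k)"
  proof -
    have "summable (\<lambda>k. real (Suc k) * b (Suc k) * q ^ Suc k)"
    proof -
      have "(\<lambda>k. real (Suc k) * b (Suc k) * q ^ Suc k) = (\<lambda>k. q * (c k * q ^ k))"
        by (rule q)
      then show ?thesis using c by (simp add: summable_mult)
    qed
    then show ?thesis by (subst (asm) summable_Suc_iff)
  qed
  have "bessel_series \<mu> q = (\<Sum>k. real k * b k * q ^ k + (\<mu> + 1) * (b k * q ^ k))"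
  proof -
    have "bessel_coeff \<mu> k = (real k + (\<mu> + 1)) * b k" for k
      using rGamma_plus1[of "real k + \<mu> + 1"]
      by (simp add: b_def bessel_coeff_def field_simps)
    then show ?thesis unfolding bessel_series_def by (simp add: algebra_simps)
  qed
  also have "\<dots> = (\<Sum>k. real k * b k * q ^ k) + (\<Sum>k. (\<mu> + 1) * (b k * q ^ k))"
    by (rule suminf_add[symmetric, OF s summable_mult[OF b]])
  also have "(\<Sum>k. (\<mu> + 1) * (b k * q ^ k)) = (\<mu> + 1) * bessel_series (\<mu> + 1) q"
    unfolding bessel_series_def b_def[symmetric] by (rule suminf_mult[OF b])
  finally show ?thesis using 1 by simp
qed

lemma bessel_series_pos:
  assumes "\<mu> > -1" "q \<ge> 0"
  shows "bessel_series \<mu> q > 0"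
proof -
  have "0 \<le> bessel_coeff \<mu> k * q ^ k" for k
    using bessel_coeff_pos[OF assms(1), of k] assms(2) by simp
  moreover have "0 < bessel_coeff \<mu> 0 * q ^ 0"
    using bessel_coeff_pos[OF assms(1), of 0] by simp
  ultimately have "0 < (\<Sum>k. bessel_coeff \<mu> k * q ^ k)"
    by (rule suminf_pos2[OF summable_bessel_series])
  then show ?thesis by (simp add: bessel_series_def)
qed

section \<open>The kernel in terms of the entire series, and its derivatives in closed form\<close>

lemma bessel_I_eq:
  assumes "z > 0"
  shows "bessel_I \<mu> z = (z / 2) powr \<mu> * bessel_series \<mu> (z\<^sup>2 / 4)"
proof -
  have "rGamma (real k + \<mu> + 1) / fact k * (z / 2) powr (2 * real k + \<mu>)
      = (z / 2) powr \<mu> * (bessel_coeff \<mu> k * (z\<^sup>2 / 4) ^ k)" for k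
  proof -
    have "(z / 2) powr (2 * real k + \<mu>) = (z / 2) powr \<mu> * (z / 2) powr (real (2 * k))"
      by (simp add: powr_add)
    also have "(z / 2) powr (real (2 * k)) = (z\<^sup>2 / 4) ^ k"
      using assms by (subst powr_realpow) (auto simp: power_mult power_divide)
    finally show ?thesis by (simp add: bessel_coeff_def)
  qed
  then show ?thesis
    unfolding bessel_I_def bessel_series_def
    by (simp add: suminf_mult summable_bessel_series)
qed

text \<open>Collects the factors whose logarithmic derivatives in t and x are rational. The power of
  2 comes from 1 / (2 t) and from (xy / (4 t))^\<mu>.\<close>

definition bessel_prefactor :: "real \<Rightarrow> real \<Rightarrow> real \<Rightarrow> real \<Rightarrow> real" where
  "bessel_prefactor \<mu> t x y =
     2 powr (- 1 - 2 * \<mu>) * (x * y) powr (\<mu> + 1 / 2) * t powr (- \<mu> - 1) * exp (- (x\<^sup>2 + y\<^sup>2) / (4 * t))"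

text \<open>This is z^2 / 4 for the Bessel argument z = xy / (2 t).\<close>

definition bessel_arg :: "real \<Rightarrow> real \<Rightarrow> real \<Rightarrow> real" where
  "bessel_arg t x y = x\<^sup>2 * y\<^sup>2 / (16 * t\<^sup>2)"

text \<open>Here and for the x-derivatives a closed form is used instead of \<open>deriv\<close>,
  because joint continuity in all three variables can be read off from it.\<close>

definition kernel_t :: "real \<Rightarrow> real \<Rightarrow> real \<Rightarrow> real \<Rightarrow> real" where
  "kernel_t \<mu> t x y = bessel_prefactor \<mu> t x y *
     (((x\<^sup>2 + y\<^sup>2) / (4 * t\<^sup>2) - (\<mu> + 1) / t) * bessel_series \<mu> (bessel_arg t x y)
      - x\<^sup>2 * y\<^sup>2 / (8 * t ^ 3) * bessel_series (\<mu> + 1) (bessel_arg t x y))"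

definition kernel_x :: "real \<Rightarrow> real \<Rightarrow> real \<Rightarrow> real \<Rightarrow> real" where
  "kernel_x \<mu> t x y = bessel_prefactor \<mu> t x y *
     (((\<mu> + 1 / 2) / x - x / (2 * t)) * bessel_series \<mu> (bessel_arg t x y)
      + x * y\<^sup>2 / (8 * t\<^sup>2) * bessel_series (\<mu> + 1) (bessel_arg t x y))"

text \<open>Defined through the heat equation, which thereby holds by definition; the content is
  moved into \<open>kernel_x_has_derivative_x\<close>.\<close>

definition kernel_xx :: "real \<Rightarrow> real \<Rightarrow> real \<Rightarrow> real \<Rightarrow> real" where
  "kernel_xx \<mu> t x y = kernel_t \<mu> t x y - (1 / 4 - \<mu>\<^sup>2) / x\<^sup>2 * bessel_kernel \<mu> t x y"

lemma bessel_kernel_eq: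
  assumes "t > 0" "x > 0" "y > 0"
  shows "bessel_kernel \<mu> t x y = bessel_prefactor \<mu> t x y * bessel_series \<mu> (bessel_arg t x y)"
proof -
  have 1: "bessel_I \<mu> (x * y / (2 * t)) = (x * y / (4 * t)) powr \<mu> * bessel_series \<mu> (bessel_arg t x y)"
    using assms by (subst bessel_I_eq) (auto simp: bessel_arg_def power_divide power_mult_distrib)
  have p: "4 powr \<mu> = (2 powr (2 * \<mu>) :: real)"
    using powr_powr[of "2::real" 2 \<mu>] by simp
  have r: "(x * y) powr (\<mu> + 1 / 2) = (x * y) powr \<mu> * sqrt (x * y)"
    using assms by (simp add: powr_add powr_half_sqrt)
  have "sqrt (x * y) / (2 * t) * (x * y / (4 * t)) powr \<mu>
     = 2 powr (- 1 - 2 * \<mu>) * (x * y) powr (\<mu> + 1 / 2) * t powr (- \<mu> - 1)"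
    unfolding r using assms
    by (simp add: powr_divide powr_mult powr_diff powr_minus p field_simps)
  with 1 show ?thesis
    by (simp add: bessel_kernel_def bessel_prefactor_def del: minus_add_distrib times_divide_eq_left)
qed

lemma bessel_kernel_pos:
  assumes "\<mu> > -1" "t > 0" "x > 0" "y > 0"
  shows "bessel_kernel \<mu> t x y > 0"
  using assms bessel_series_pos[OF assms(1), of "bessel_arg t x y"]
  by (auto simp: bessel_kernel_eq bessel_prefactor_def bessel_arg_def)

lemma bessel_kernel_sym: "bessel_kernel \<mu> t x y = bessel_kernel \<mu> t y x"
  by (simp add: bessel_kernel_def mult.commute add.commute)

lemma bessel_prefactor_has_derivative_t:
  assumes "t > 0" "x > 0" "y > 0"
  shows "((\<lambda>s. bessel_prefactor \<mu> s x y) has_real_derivative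
      bessel_prefactor \<mu> t x y * ((x\<^sup>2 + y\<^sup>2) / (4 * t\<^sup>2) - (\<mu> + 1) / t)) (at t)"
proof -
  define E where "E s = exp (- (x\<^sup>2 + y\<^sup>2) / (4 * s))" for s
  define P where "P s = s powr (- \<mu> - 1)" for s
  have E: "(E has_real_derivative E t * ((x\<^sup>2 + y\<^sup>2) / (4 * t\<^sup>2))) (at t)"
    unfolding E_def
    using assms by (auto intro!: derivative_eq_intros simp: field_simps power2_eq_square)
  have P: "(P has_real_derivative P t * (- (\<mu> + 1) / t)) (at t)"
  proof -
    have "t powr (- \<mu> - 1 - 1) = P t / t"
      unfolding P_def using assms by (subst powr_diff) simp
    then show ?thesis
      unfolding P_def by (intro DERIV_cong[OF has_real_derivative_powr[OF assms(1)]]) (simp add: P_def)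
  qed
  show ?thesis
    unfolding bessel_prefactor_def E_def[symmetric] P_def[symmetric]
    by (rule derivative_eq_intros E P refl)+
      (simp_all add: algebra_simps add_divide_distrib diff_divide_distrib)
qed

lemma bessel_prefactor_has_derivative_x:
  assumes "t > 0" "x > 0" "y > 0"
  shows "((\<lambda>z. bessel_prefactor \<mu> t z y) has_real_derivative
      bessel_prefactor \<mu> t x y * ((\<mu> + 1 / 2) / x - x / (2 * t))) (at x)"
proof -
  define E where "E z = exp (- (z\<^sup>2 + y\<^sup>2) / (4 * t))" for z
  define P where "P z = (z * y) powr (\<mu> + 1 / 2)" for z
  have E: "(E has_real_derivative E x * (- x / (2 * t))) (at x)"
    unfolding E_def
    using assms by (auto intro!: derivative_eq_intros simp: field_simps power2_eq_square)
  have "((\<lambda>z. z powr (\<mu> + 1 / 2) * y powr (\<mu> + 1 / 2)) has_real_derivative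
      (\<mu> + 1 / 2) * x powr (\<mu> + 1 / 2 - 1) * y powr (\<mu> + 1 / 2)) (at x)"
    by (intro DERIV_cmult_right has_real_derivative_powr assms)
  then have P: "(P has_real_derivative P x * ((\<mu> + 1 / 2) / x)) (at x)"
    unfolding P_def using assms powr_diff[of x "\<mu> + 1 / 2" 1] by (simp add: powr_mult mult_ac)
  show ?thesis
    unfolding bessel_prefactor_def E_def[symmetric] P_def[symmetric]
    by (rule derivative_eq_intros E P refl)+
      (simp_all add: algebra_simps add_divide_distrib diff_divide_distrib)
qed

lemma bessel_series_arg_has_derivative_x:
  assumes "t > 0"
  shows "((\<lambda>z. bessel_series \<nu> (bessel_arg t z y)) has_real_derivative
      bessel_series (\<nu> + 1) (bessel_arg t x y) * (x * y\<^sup>2 / (8 * t\<^sup>2))) (at x)"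
proof (rule DERIV_chain2[OF bessel_series_has_derivative])
  show "((\<lambda>z. bessel_arg t z y) has_real_derivative x * y\<^sup>2 / (8 * t\<^sup>2)) (at x)"
    unfolding bessel_arg_def
    using assms by (auto intro!: derivative_eq_intros simp: field_simps power2_eq_square)
qed

lemma bessel_series_arg_has_derivative_t:
  assumes "t > 0"
  shows "((\<lambda>s. bessel_series \<nu> (bessel_arg s x y)) has_real_derivative
      bessel_series (\<nu> + 1) (bessel_arg t x y) * (- (x\<^sup>2 * y\<^sup>2 / (8 * t ^ 3)))) (at t)"
proof (rule DERIV_chain2[OF bessel_series_has_derivative])
  show "((\<lambda>s. bessel_arg s x y) has_real_derivative - (x\<^sup>2 * y\<^sup>2 / (8 * t ^ 3))) (at t)"
    unfolding bessel_arg_def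
    by (rule derivative_eq_intros refl | use assms in force)+
      (use assms in \<open>simp add: field_simps power2_eq_square power3_eq_cube\<close>)
qed

lemma bessel_kernel_has_derivative_t:
  assumes "t > 0" "x > 0" "y > 0"
  shows "((\<lambda>s. bessel_kernel \<mu> s x y) has_real_derivative kernel_t \<mu> t x y) (at t)"
proof -
  have "((\<lambda>s. bessel_prefactor \<mu> s x y * bessel_series \<mu> (bessel_arg s x y))
      has_real_derivative kernel_t \<mu> t x y) (at t)"
    unfolding kernel_t_def
    by (rule derivative_eq_intros refl bessel_prefactor_has_derivative_t[OF assms]
        bessel_series_arg_has_derivative_t[OF assms(1)])+ (simp add: algebra_simps)
  then show ?thesis
    by (rule has_field_derivative_transform_within_open[where S="{0<..}"])
      (use assms in \<open>auto simp: bessel_kernel_eq\<close>)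
qed

lemma bessel_kernel_has_derivative_x:
  assumes "t > 0" "x > 0" "y > 0"
  shows "((\<lambda>z. bessel_kernel \<mu> t z y) has_real_derivative kernel_x \<mu> t x y) (at x)"
proof -
  have "((\<lambda>z. bessel_prefactor \<mu> t z y * bessel_series \<mu> (bessel_arg t z y))
      has_real_derivative kernel_x \<mu> t x y) (at x)"
    unfolding kernel_x_def
    by (rule derivative_eq_intros refl bessel_prefactor_has_derivative_x[OF assms]
        bessel_series_arg_has_derivative_x[OF assms(1)])+ (simp add: algebra_simps)
  then show ?thesis
    by (rule has_field_derivative_transform_within_open[where S="{0<..}"])
      (use assms in \<open>auto simp: bessel_kernel_eq\<close>)
qed

text \<open>This is the heat equation for the kernel. Differentiating \<open>kernel_x\<close> brings
  in the series of index \<mu> + 2, which \<open>bessel_series_ode\<close> expresses through the two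
  lower ones; what remains is an identity between rational functions.\<close>

lemma kernel_x_has_derivative_x:
  assumes "t > 0" "x > 0" "y > 0"
  shows "((\<lambda>z. kernel_x \<mu> t z y) has_real_derivative kernel_xx \<mu> t x y) (at x)"
proof -
  define a where "a = \<mu> + 1 / 2"
  define q where "q = bessel_arg t x y"
  note p = bessel_prefactor_has_derivative_x[OF assms, of \<mu>, folded a_def]
  have h: "((\<lambda>z. bessel_series \<nu> (bessel_arg t z y)) has_real_derivative
      bessel_series (\<nu> + 1) q * (x * y\<^sup>2 / (8 * t\<^sup>2))) (at x)" for \<nu>
    unfolding q_def by (rule bessel_series_arg_has_derivative_x[OF assms(1)])
  have r: "((\<lambda>z. a / z - z / (2 * t)) has_real_derivative - a / x\<^sup>2 - 1 / (2 * t)) (at x)"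
    using assms by (auto intro!: derivative_eq_intros simp: field_simps power2_eq_square)
  have r': "((\<lambda>z. z * y\<^sup>2 / (8 * t\<^sup>2)) has_real_derivative y\<^sup>2 / (8 * t\<^sup>2)) (at x)"
    by (rule DERIV_cong[OF DERIV_cdivide[OF DERIV_cmult_right[OF DERIV_ident]]]) simp
  define h0 h1 h2 where "h0 = bessel_series \<mu> q" and "h1 = bessel_series (\<mu> + 1) q"
    and "h2 = bessel_series (\<mu> + 2) q"
  have h0: "h0 = q * h2 + (\<mu> + 1) * h1" using bessel_series_ode[of q \<mu>] by (simp add: h0_def h1_def h2_def)
  have "((\<lambda>z. kernel_x \<mu> t z y) has_real_derivative
     bessel_prefactor \<mu> t x y * (a / x - x / (2 * t)) * ((a / x - x / (2 * t)) * h0 + x * y\<^sup>2 / (8 * t\<^sup>2) * h1)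
     + ((- a / x\<^sup>2 - 1 / (2 * t)) * h0 + (a / x - x / (2 * t)) * (h1 * (x * y\<^sup>2 / (8 * t\<^sup>2)))
      + y\<^sup>2 / (8 * t\<^sup>2) * h1 + x * y\<^sup>2 / (8 * t\<^sup>2) * (h2 * (x * y\<^sup>2 / (8 * t\<^sup>2)))) * bessel_prefactor \<mu> t x y) (at x)"
    unfolding kernel_x_def a_def[symmetric] h0_def h1_def h2_def
    by (rule DERIV_cong, rule DERIV_mult[OF p DERIV_add[OF DERIV_mult[OF r h] DERIV_mult[OF r' h]]])
      (simp add: q_def add.assoc mult_ac add_ac)
  moreover have "kernel_xx \<mu> t x y = bessel_prefactor \<mu> t x y *
     (((x\<^sup>2 + y\<^sup>2) / (4 * t\<^sup>2) - (\<mu> + 1) / t) * h0 - x\<^sup>2 * y\<^sup>2 / (8 * t ^ 3) * h1 - (1 / 4 - \<mu>\<^sup>2) / x\<^sup>2 * h0)"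
    unfolding kernel_xx_def kernel_t_def bessel_kernel_eq[OF assms] h0_def h1_def q_def
    by (simp add: algebra_simps)
  moreover have "(a / x - x / (2 * t)) * ((a / x - x / (2 * t)) * h0 + x * y\<^sup>2 / (8 * t\<^sup>2) * h1)
     + ((- a / x\<^sup>2 - 1 / (2 * t)) * h0 + (a / x - x / (2 * t)) * (h1 * (x * y\<^sup>2 / (8 * t\<^sup>2)))
      + y\<^sup>2 / (8 * t\<^sup>2) * h1 + x * y\<^sup>2 / (8 * t\<^sup>2) * (h2 * (x * y\<^sup>2 / (8 * t\<^sup>2))))
    = ((x\<^sup>2 + y\<^sup>2) / (4 * t\<^sup>2) - (\<mu> + 1) / t) * h0 - x\<^sup>2 * y\<^sup>2 / (8 * t ^ 3) * h1 - (1 / 4 - \<mu>\<^sup>2) / x\<^sup>2 * h0"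
  proof -
    \<comment> \<open>With the reciprocals as variables the claim becomes polynomial, modulo x * i =
      1 and the recurrence for \<open>h2\<close>.\<close>
    define i j where "i = 1 / x" and "j = 1 / t"
    have ij: "x * i = 1" using assms by (simp add: i_def)
    have \<mu>: "\<mu> = a - 1 / 2" by (simp add: a_def)
    have q: "q = x\<^sup>2 * y\<^sup>2 * j\<^sup>2 / 16" by (simp add: q_def bessel_arg_def j_def power_divide)
    have *: "a / x = a * i" "x / (2 * t) = x * j / 2" "x * y\<^sup>2 / (8 * t\<^sup>2) = x * y\<^sup>2 * j\<^sup>2 / 8"
      "- a / x\<^sup>2 = - a * i\<^sup>2" "1 / (2 * t) = j / 2" "y\<^sup>2 / (8 * t\<^sup>2) = y\<^sup>2 * j\<^sup>2 / 8"
      "(x\<^sup>2 + y\<^sup>2) / (4 * t\<^sup>2) = (x\<^sup>2 + y\<^sup>2) * j\<^sup>2 / 4" "(\<mu> + 1) / t = (a + 1 / 2) * j"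
      "x\<^sup>2 * y\<^sup>2 / (8 * t ^ 3) = x\<^sup>2 * y\<^sup>2 * j ^ 3 / 8" "(1 / 4 - \<mu>\<^sup>2) / x\<^sup>2 = (a - a\<^sup>2) * i\<^sup>2"
      by (simp_all add: i_def j_def \<mu> power_divide power2_eq_square algebra_simps add_divide_distrib)
    have h0': "h0 = x\<^sup>2 * y\<^sup>2 * j\<^sup>2 / 16 * h2 + (a + 1 / 2) * h1" using h0 by (simp add: q \<mu>)
    have sq: "(a * i - x * j / 2) * (a * i - x * j / 2) = a\<^sup>2 * i\<^sup>2 - a * j + x\<^sup>2 * j\<^sup>2 / 4"
    proof -
      have "(a * i - x * j / 2) * (a * i - x * j / 2)
          = a\<^sup>2 * i\<^sup>2 - a * j * (x * i) + x\<^sup>2 * j\<^sup>2 / 4"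
        by (simp add: power2_eq_square algebra_simps)
      then show ?thesis by (simp add: ij)
    qed
    have cr: "(a * i - x * j / 2) * (x * y\<^sup>2 * j\<^sup>2 / 8) = a * y\<^sup>2 * j\<^sup>2 / 8 - x\<^sup>2 * y\<^sup>2 * j ^ 3 / 16"
    proof -
      have "(a * i - x * j / 2) * (x * y\<^sup>2 * j\<^sup>2 / 8)
          = a * y\<^sup>2 * j\<^sup>2 / 8 * (x * i) - x\<^sup>2 * y\<^sup>2 * j ^ 3 / 16"
        by (simp add: power2_eq_square power3_eq_cube algebra_simps add_divide_distrib diff_divide_distrib)
      then show ?thesis by (simp add: ij)
    qed
    \<comment> \<open>The square of the chain-rule factor is q times y^2 j^2 / 4, so
      \<open>h2\<close> occurs only as q * h2 and the recurrence removes it.\<close>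
    have bb: "x * y\<^sup>2 * j\<^sup>2 / 8 * (h2 * (x * y\<^sup>2 * j\<^sup>2 / 8)) = y\<^sup>2 * j\<^sup>2 / 4 * (h0 - (a + 1 / 2) * h1)"
      unfolding h0' by (simp add: power2_eq_square algebra_simps)
    have expand: "A * (A * h0 + B * h1) + ((- a * i\<^sup>2 - j / 2) * h0 + A * (h1 * B) + C * h1 + B * (h2 * B))
        = (A * A) * h0 + 2 * (A * B) * h1 + (- a * i\<^sup>2 - j / 2) * h0 + C * h1 + B * (h2 * B)" for A B C
      by (simp add: algebra_simps)
    show ?thesis
      unfolding * expand[of "a * i - x * j / 2" "x * y\<^sup>2 * j\<^sup>2 / 8" "y\<^sup>2 * j\<^sup>2 / 8"]
      unfolding sq cr bb
      by (simp add: power2_eq_square power3_eq_cube algebra_simps add_divide_distrib diff_divide_distrib)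
  qed
  moreover have "P * r * s + u * P = P * w" if "r * s + u = w" for P r s u w :: real
    using that by (auto simp: algebra_simps)
  ultimately show ?thesis
    by (simp add: mult.assoc)
qed

lemma continuous_on_kernels:
  "continuous_on ({0<..} \<times> {0<..} \<times> {0<..}) (\<lambda>(t, x, y). bessel_kernel \<mu> t x y)" (is ?W)
  "continuous_on ({0<..} \<times> {0<..} \<times> {0<..}) (\<lambda>(t, x, y). kernel_t \<mu> t x y)" (is ?T)
  "continuous_on ({0<..} \<times> {0<..} \<times> {0<..}) (\<lambda>(t, x, y). kernel_x \<mu> t x y)" (is ?X)
  "continuous_on ({0<..} \<times> {0<..} \<times> {0<..}) (\<lambda>(t, x, y). kernel_xx \<mu> t x y)" (is ?XX)
proof -
  have p: "continuous_on ({0<..} \<times> {0<..} \<times> {0<..}) (\<lambda>z. bessel_prefactor \<mu> (fst z) (fst (snd z)) (snd (snd z)))"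
    unfolding bessel_prefactor_def by (intro continuous_intros) auto
  have h: "continuous_on ({0<..} \<times> {0<..} \<times> {0<..}) (\<lambda>z. bessel_series \<nu> (bessel_arg (fst z) (fst (snd z)) (snd (snd z))))" for \<nu>
    unfolding bessel_arg_def by (intro continuous_intros) auto
  have "continuous_on ({0<..} \<times> {0<..} \<times> {0<..}) (\<lambda>z. bessel_prefactor \<mu> (fst z) (fst (snd z)) (snd (snd z)) *
      bessel_series \<mu> (bessel_arg (fst z) (fst (snd z)) (snd (snd z))))"
    by (intro continuous_intros p h)
  then show w: ?W
    by (rule continuous_on_eq) (auto simp: bessel_kernel_eq)
  show t: ?T unfolding kernel_t_def case_prod_unfold
    by (intro continuous_intros p h) auto
  show ?X unfolding kernel_x_def case_prod_unfold
    by (intro continuous_intros p h) auto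
  show ?XX unfolding kernel_xx_def case_prod_unfold
    by (intro continuous_intros w[unfolded case_prod_unfold] t[unfolded case_prod_unfold]) auto
qed

section \<open>Parameter integrals and Lebesgue points\<close>

text \<open>The mean value theorem bounds the difference quotients by B, so dominated convergence
  along sequences gives the limit. Measurability of \<open>K' p0\<close> is inherited from the
  quotients rather than assumed.\<close>

lemma has_real_derivative_integral:
  fixes K K' :: "real \<Rightarrow> 'a \<Rightarrow> real"
  assumes "e > 0"
    and int: "\<And>p. \<bar>p - p0\<bar> < e \<Longrightarrow> integrable M (K p)"
    and der: "\<And>p y. \<bar>p - p0\<bar> < e \<Longrightarrow> y \<in> space M \<Longrightarrow>
      ((\<lambda>p. K p y) has_real_derivative K' p y) (at p)"
    and bound: "\<And>p y. \<bar>p - p0\<bar> < e \<Longrightarrow> y \<in> space M \<Longrightarrow> \<bar>K' p y\<bar> \<le> B y"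
    and B: "integrable M B"
  shows "((\<lambda>p. \<integral>y. K p y \<partial>M) has_real_derivative (\<integral>y. K' p0 y \<partial>M)) (at p0)"
    and "integrable M (K' p0)"
proof -
  define S where "S = {p0 - e <..< p0 + e}"
  have S: "p \<in> S \<longleftrightarrow> \<bar>p - p0\<bar> < e" for p by (auto simp: S_def)
  define D where "D p y = (K p y - K p0 y) / (p - p0)" for p y
  have Dint: "integrable M (D p)" if "p \<in> S" for p
    unfolding D_def using that \<open>e > 0\<close> S by (intro integrable_divide Bochner_Integration.integrable_diff int) auto
  have Dbound: "\<bar>D p y\<bar> \<le> B y" if "p \<in> S - {p0}" "y \<in> space M" for p y
  proof -
    have "\<exists>z. \<bar>z - p0\<bar> < e \<and> K p y - K p0 y = (p - p0) * K' z y"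
    proof (cases "p < p0")
      case True
      have "\<exists>z>p. z < p0 \<and> K p0 y - K p y = (p0 - p) * K' z y"
        by (rule MVT2) (use True that S der \<open>e > 0\<close> in auto)
      then obtain z where "p < z" "z < p0" "K p0 y - K p y = (p0 - p) * K' z y" by blast
      then show ?thesis using that S[of p] by (intro exI[of _ z]) (auto simp: algebra_simps)
    next
      case False
      then have "p0 < p" using that by auto
      have "\<exists>z>p0. z < p \<and> K p y - K p0 y = (p - p0) * K' z y"
        by (rule MVT2) (use \<open>p0 < p\<close> that S der \<open>e > 0\<close> in auto)
      then obtain z where "p0 < z" "z < p" "K p y - K p0 y = (p - p0) * K' z y" by blast
      then show ?thesis using that S[of p] by (intro exI[of _ z]) auto
    qed
    then obtain z where "\<bar>z - p0\<bar> < e" "K p y - K p0 y = (p - p0) * K' z y" by blast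
    then show ?thesis using bound[of z y] that by (simp add: D_def)
  qed
  have lim: "((\<lambda>p. D p y) \<longlongrightarrow> K' p0 y) (at p0 within S)" if "y \<in> space M" for y
    using der[of p0 y] that \<open>e > 0\<close> unfolding D_def has_field_derivative_iff
    by (auto intro: tendsto_within_subset)
  have seq: "integrable M (K' p0) \<and> (\<lambda>i. \<integral>y. D (X i) y \<partial>M) \<longlonglongrightarrow> (\<integral>y. K' p0 y \<partial>M)"
    if X: "\<And>i. X i \<in> S - {p0}" "X \<longlonglongrightarrow> p0" for X
  proof -
    have l: "(\<lambda>i. D (X i) y) \<longlonglongrightarrow> K' p0 y" if "y \<in> space M" for y
      using lim[OF that] X unfolding tendsto_at_iff_sequentially comp_def by blast
    have Dm: "D (X i) \<in> borel_measurable M" for i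
      using Dint[of "X i"] X(1)[of i] by auto
    have m: "K' p0 \<in> borel_measurable M"
      by (rule borel_measurable_LIMSEQ_real[OF l Dm])
    have "AE y in M. (\<lambda>i. D (X i) y) \<longlonglongrightarrow> K' p0 y" "AE y in M. norm (D (X i) y) \<le> B y" for i
      using l Dbound[OF X(1)] by auto
    note dct = m Dm B this
    show ?thesis
      using integrable_dominated_convergence[OF dct] integral_dominated_convergence[OF dct] by blast
  qed
  \<comment> \<open>Integrability of the limit function follows from any one sequence, so one has to
    exist.\<close>
  have "\<exists>X. (\<forall>i. X i \<in> S - {p0}) \<and> X \<longlonglongrightarrow> p0"
  proof -
    have "p0 islimpt S" unfolding S_def using \<open>e > 0\<close>
      by (simp add: islimpt_greaterThanLessThan1 open_contains_ball interior_limit_point)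
    then show ?thesis unfolding islimpt_sequential by blast
  qed
  then show "integrable M (K' p0)" using seq by blast
  have "((\<lambda>p. \<integral>y. D p y \<partial>M) \<longlongrightarrow> (\<integral>y. K' p0 y \<partial>M)) (at p0 within S)"
    unfolding tendsto_at_iff_sequentially comp_def using seq by blast
  then have "((\<lambda>p. \<integral>y. D p y \<partial>M) \<longlongrightarrow> (\<integral>y. K' p0 y \<partial>M)) (at p0)"
    using \<open>e > 0\<close> at_within_open[of p0 S] by (simp add: S_def)
  moreover have "eventually (\<lambda>p. (\<integral>y. D p y \<partial>M) = ((\<integral>y. K p y \<partial>M) - (\<integral>y. K p0 y \<partial>M)) / (p - p0)) (at p0)"
  proof -
    have "eventually (\<lambda>p. p \<in> S) (at p0)"
      using \<open>e > 0\<close> by (intro eventually_at_in_open') (auto simp: S_def)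
    then show ?thesis
    proof eventually_elim
      case (elim p)
      then show ?case using S int[of p] int[of p0] \<open>e > 0\<close> by (simp add: D_def)
    qed
  qed
  ultimately show "((\<lambda>p. \<integral>y. K p y \<partial>M) has_real_derivative (\<integral>y. K' p0 y \<partial>M)) (at p0)"
    unfolding has_field_derivative_iff by (rule Lim_transform_eventually)
qed

lemma continuous_within_integral:
  fixes K :: "'p::metric_space \<Rightarrow> 'a \<Rightarrow> real"
  assumes "open U" "p0 \<in> U" "p0 \<in> S"
    and meas: "\<And>p. p \<in> S \<inter> U \<Longrightarrow> K p \<in> borel_measurable M"
    and cont: "\<And>y. y \<in> space M \<Longrightarrow> continuous (at p0 within S) (\<lambda>p. K p y)"
    and bound: "\<And>p y. p \<in> S \<inter> U \<Longrightarrow> y \<in> space M \<Longrightarrow> \<bar>K p y\<bar> \<le> B y"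
    and B: "integrable M B"
  shows "continuous (at p0 within S) (\<lambda>p. \<integral>y. K p y \<partial>M)"
  unfolding continuous_within_sequentially comp_def
proof (intro allI impI)
  fix X assume X: "(\<forall>n. X n \<in> S) \<and> X \<longlonglongrightarrow> p0"
  then obtain N where N: "\<And>n. n \<ge> N \<Longrightarrow> X n \<in> U"
    using topological_tendstoD[of X p0 sequentially U] assms(1,2) by (auto simp: eventually_sequentially)
  have l: "(\<lambda>n. K (X (n + N)) y) \<longlonglongrightarrow> K p0 y" if "y \<in> space M" for y
  proof (rule LIMSEQ_ignore_initial_segment)
    show "(\<lambda>n. K (X n) y) \<longlonglongrightarrow> K p0 y"
      using cont[OF that] X unfolding continuous_within_sequentially comp_def by blast
  qed
  have XU: "X (n + N) \<in> S \<inter> U" for n using N[of "n + N"] X by auto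
  have "(\<lambda>n. \<integral>y. K (X (n + N)) y \<partial>M) \<longlonglongrightarrow> (\<integral>y. K p0 y \<partial>M)"
    by (rule integral_dominated_convergence[OF _ _ B])
      (use l meas[OF XU] meas[of p0] assms(2,3) bound[OF XU] in auto)
  then show "(\<lambda>n. \<integral>y. K (X n) y \<partial>M) \<longlonglongrightarrow> (\<integral>y. K p0 y \<partial>M)"
    by (rule LIMSEQ_offset)
qed

text \<open>A Landau-type inequality: at some point of the interval the derivative is a difference
  quotient, hence at most 2 M / d in absolute value, and on the way back to x it changes by at most
  N d.\<close>

lemma derivative_interpolation:
  fixes \<phi> :: "real \<Rightarrow> real"
  assumes "d > 0"
    and 1: "\<And>z. z \<in> {x..x + d} \<Longrightarrow> (\<phi> has_real_derivative \<phi>' z) (at z)"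
    and 2: "\<And>z. z \<in> {x..x + d} \<Longrightarrow> (\<phi>' has_real_derivative \<phi>'' z) (at z)"
    and b0: "\<And>z. z \<in> {x..x + d} \<Longrightarrow> \<bar>\<phi> z\<bar> \<le> M"
    and b2: "\<And>z. z \<in> {x..x + d} \<Longrightarrow> \<bar>\<phi>'' z\<bar> \<le> N"
  shows "\<bar>\<phi>' x\<bar> \<le> 2 * M / d + N * d"
proof -
  have "\<exists>z>x. z < x + d \<and> \<phi> (x + d) - \<phi> x = (x + d - x) * \<phi>' z"
    by (rule MVT2) (use \<open>d > 0\<close> 1 in auto)
  then obtain z where z: "x < z" "z < x + d" "\<phi> (x + d) - \<phi> x = d * \<phi>' z" by auto
  have "\<exists>w>x. w < z \<and> \<phi>' z - \<phi>' x = (z - x) * \<phi>'' w"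
    by (rule MVT2) (use z 2 in auto)
  then obtain w where w: "x < w" "w < z" "\<phi>' z - \<phi>' x = (z - x) * \<phi>'' w" by auto
  have "d * \<bar>\<phi>' z\<bar> = \<bar>\<phi> (x + d) - \<phi> x\<bar>" using z \<open>d > 0\<close> by (simp add: abs_mult)
  also have "\<dots> \<le> 2 * M" using b0[of x] b0[of "x + d"] \<open>d > 0\<close> by auto
  finally have A: "\<bar>\<phi>' z\<bar> \<le> 2 * M / d" using \<open>d > 0\<close> by (simp add: field_simps)
  have "\<bar>(z - x) * \<phi>'' w\<bar> \<le> d * N"
    unfolding abs_mult using z w b2[of w] by (intro mult_mono) auto
  then show ?thesis using A w(3) by (simp add: mult.commute)
qed

section \<open>Lebesgue points of an integrable function on the line\<close>

lemma integrable_on_abs_diff_const: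
  fixes g :: "real \<Rightarrow> real"
  assumes g: "integrable lebesgue g"
  shows "(\<lambda>y. \<bar>g y - q\<bar>) integrable_on {a..b}"
proof -
  have "set_integrable lebesgue {a..b} g"
    by (rule set_integrable_subset[of _ UNIV]) (use g in \<open>auto simp: set_integrable_def\<close>)
  then have "set_integrable lebesgue {a..b} (\<lambda>y. g y - q)"
    by (rule set_integral_diff) (simp add: absolutely_integrable_on_const)
  then show ?thesis
    by (intro set_lebesgue_integral_eq_integral(1) set_integrable_abs)
qed

text \<open>For each fixed q the averages of |g - q| converge to |g x - q| off a null set.
  Discarding these null sets for all rational q leaves almost every x, and there a rational q within
  \<epsilon> / 4 of \<open>g x\<close> can replace it.\<close>

lemma lebesgue_points_right:
  fixes g :: "real \<Rightarrow> real"
  assumes g: "integrable lebesgue g"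
  shows "AE x in lebesgue. \<forall>\<epsilon>>0. \<exists>\<delta>>0. \<forall>r. 0 < r \<and> r < \<delta> \<longrightarrow>
    integral {x..x + r} (\<lambda>y. \<bar>g y - g x\<bar>) \<le> \<epsilon> * r"
proof -
  note gi = integrable_on_abs_diff_const[OF g]
  have "\<exists>N. negligible N \<and> (\<forall>x e. x \<notin> N \<longrightarrow> 0 < e \<longrightarrow> (\<exists>d>0. \<forall>h. 0 < h \<and> h < d \<longrightarrow>
      \<bar>integral {x..x + h} (\<lambda>y. \<bar>g y - q\<bar>) / h - \<bar>g x - q\<bar>\<bar> < e))" for q
  proof -
    obtain N where "negligible N"
      and N: "\<And>x e. \<lbrakk>x \<notin> N; 0 < e\<rbrakk> \<Longrightarrow> \<exists>d>0. \<forall>h. 0 < h \<and> h < d \<longrightarrow>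
         norm (integral (cbox x (x + h *\<^sub>R One)) (\<lambda>y. \<bar>g y - q\<bar>) /\<^sub>R h ^ DIM(real) - \<bar>g x - q\<bar>) < e"
      using integrable_ccontinuous_explicit[of "\<lambda>y. \<bar>g y - q\<bar>"] gi by (metis box_real(2))
    then show ?thesis by (intro exI[of _ N]) (simp add: divide_inverse mult.commute)
  qed
  then obtain N where N: "\<And>q. negligible (N q)"
    "\<And>q x e. x \<notin> N q \<Longrightarrow> 0 < e \<Longrightarrow> (\<exists>d>0. \<forall>h. 0 < h \<and> h < d \<longrightarrow>
      \<bar>integral {x..x + h} (\<lambda>y. \<bar>g y - q\<bar>) / h - \<bar>g x - q\<bar>\<bar> < e)" by metis
  have "negligible (\<Union>q\<in>\<rat>. N q)"
    using N(1) countable_rat by (intro negligible_countable_Union) auto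
  then have "AE x in lebesgue. x \<notin> (\<Union>q\<in>\<rat>. N q)"
    using negligible_iff_null_sets AE_not_in by blast
  then show ?thesis
  proof (rule AE_mp, intro AE_I2 impI allI)
    fix x \<epsilon> :: real assume x: "x \<notin> (\<Union>q\<in>\<rat>. N q)" and \<epsilon>: "0 < \<epsilon>"
    obtain q where q: "q \<in> \<rat>" "g x - \<epsilon> / 4 < q" "q < g x"
      using Rats_dense_in_real[of "g x - \<epsilon> / 4" "g x"] \<epsilon> by auto
    obtain d where d: "d > 0" "\<And>h. 0 < h \<and> h < d \<Longrightarrow>
      \<bar>integral {x..x + h} (\<lambda>y. \<bar>g y - q\<bar>) / h - \<bar>g x - q\<bar>\<bar> < \<epsilon> / 4"
      using N(2)[of x q "\<epsilon> / 4"] x q \<epsilon> by auto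
    have "integral {x..x + r} (\<lambda>y. \<bar>g y - g x\<bar>) \<le> \<epsilon> * r" if r: "0 < r \<and> r < d" for r
    proof -
      have "integral {x..x + r} (\<lambda>y. \<bar>g y - g x\<bar>) \<le> integral {x..x + r} (\<lambda>y. \<bar>g y - q\<bar> + \<epsilon> / 4)"
        by (intro integral_le gi integrable_add integrable_const_ivl) (use q in auto)
      also have "\<dots> = integral {x..x + r} (\<lambda>y. \<bar>g y - q\<bar>) + r * \<epsilon> / 4"
        using r by (subst integral_add) (auto intro!: gi integrable_const_ivl)
      also have "integral {x..x + r} (\<lambda>y. \<bar>g y - q\<bar>) \<le> (\<epsilon> / 2) * r"
      proof -
        have "integral {x..x + r} (\<lambda>y. \<bar>g y - q\<bar>) / r < \<epsilon> / 2" using d(2)[OF r] q by linarith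
        then show ?thesis using r by (simp add: field_simps)
      qed
      finally have "integral {x..x + r} (\<lambda>y. \<bar>g y - g x\<bar>) \<le> \<epsilon> / 2 * r + \<epsilon> / 4 * r"
        by (simp add: mult.commute)
      moreover have "0 \<le> \<epsilon> / 4 * r" "\<epsilon> * r = \<epsilon> / 2 * r + \<epsilon> / 4 * r + \<epsilon> / 4 * r" using r \<epsilon> by auto
      ultimately show ?thesis by linarith
    qed
    then show "\<exists>\<delta>>0. \<forall>r. 0 < r \<and> r < \<delta> \<longrightarrow> integral {x..x + r} (\<lambda>y. \<bar>g y - g x\<bar>) \<le> \<epsilon> * r"
      using d(1) by blast
  qed
qed

text \<open>Differentiable maps send null sets to null sets, and for an involution the preimage of
  the exceptional set is its image. Used for reflections and for the time reversal \<tau> to t -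
  \<tau>.\<close>

lemma AE_lebesgue_involution:
  fixes T :: "'a::euclidean_space \<Rightarrow> 'a"
  assumes P: "AE z in lebesgue. P z"
    and T: "T differentiable_on UNIV" "\<And>z. T (T z) = z"
  shows "AE z in lebesgue. P (T z)"
proof -
  have "negligible {z. \<not> P z}"
    using P by (auto simp: eventually_ae_filter_negligible elim: negligible_subset)
  then have "negligible (T ` {z. \<not> P z})"
    using T(1) by (intro negligible_differentiable_image_negligible) (auto intro: differentiable_on_subset)
  then have "AE z in lebesgue. z \<notin> T ` {z. \<not> P z}"
    using negligible_iff_null_sets AE_not_in by blast
  then show ?thesis
  proof (rule AE_mp, intro AE_I2 impI)
    fix z assume z: "z \<notin> T ` {z. \<not> P z}"
    show "P (T z)"
    proof (rule ccontr)
      assume "\<not> P (T z)"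
      then have "T (T z) \<in> T ` {z. \<not> P z}" by blast
      then show False using z T(2)[of z] by simp
    qed
  qed
qed

text \<open>The left half of the interval is the right half for the reflected function.\<close>

lemma lebesgue_points:
  fixes g :: "real \<Rightarrow> real"
  assumes g: "integrable lebesgue g"
  shows "AE x in lebesgue. \<forall>\<epsilon>>0. \<exists>\<delta>>0. \<forall>r. 0 < r \<and> r < \<delta> \<longrightarrow>
    integral {x - r..x + r} (\<lambda>y. \<bar>g y - g x\<bar>) \<le> \<epsilon> * r"
proof -
  have g': "integrable lebesgue (\<lambda>y. g (- y))"
    using lebesgue_integrable_real_affine[OF g, of "-1" 0] by simp
  have refl: "AE x in lebesgue. P (- x)" if "AE x in lebesgue. P x" for P :: "real \<Rightarrow> bool"
    by (rule AE_lebesgue_involution[OF that])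
      (auto intro!: differentiable_on_minus differentiable_on_ident)
  have "AE x in lebesgue. \<forall>\<epsilon>>0. \<exists>\<delta>>0. \<forall>r. 0 < r \<and> r < \<delta> \<longrightarrow>
    integral {x - r..x} (\<lambda>y. \<bar>g y - g x\<bar>) \<le> \<epsilon> * r"
  proof -
    have "integral {- x..- x + r} (\<lambda>y. \<bar>g (- y) - g (- (- x))\<bar>) = integral {x - r..x} (\<lambda>y. \<bar>g y - g x\<bar>)"
      for x r
      using Henstock_Kurzweil_Integration.integral_reflect_real[of x "x - r" "\<lambda>y. \<bar>g y - g x\<bar>"]
      by (simp add: add.commute)
    then show ?thesis using refl[OF lebesgue_points_right[OF g']] by simp
  qed
  with lebesgue_points_right[OF g] show ?thesis
  proof (rule AE_mp[OF AE_conjI], intro AE_I2 impI allI)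
    fix x \<epsilon> :: real
    assume *: "(\<forall>\<epsilon>>0. \<exists>\<delta>>0. \<forall>r. 0 < r \<and> r < \<delta> \<longrightarrow>
            integral {x..x + r} (\<lambda>y. \<bar>g y - g x\<bar>) \<le> \<epsilon> * r) \<and>
       (\<forall>\<epsilon>>0. \<exists>\<delta>>0. \<forall>r. 0 < r \<and> r < \<delta> \<longrightarrow> integral {x - r..x} (\<lambda>y. \<bar>g y - g x\<bar>) \<le> \<epsilon> * r)"
      and \<epsilon>: "0 < \<epsilon>"
    obtain d1 where d1: "d1 > 0" "\<And>r. 0 < r \<and> r < d1 \<Longrightarrow> integral {x..x + r} (\<lambda>y. \<bar>g y - g x\<bar>) \<le> \<epsilon> / 2 * r"
      using conjunct1[OF *, rule_format, of "\<epsilon> / 2"] \<epsilon> by auto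
    obtain d2 where d2: "d2 > 0" "\<And>r. 0 < r \<and> r < d2 \<Longrightarrow> integral {x - r..x} (\<lambda>y. \<bar>g y - g x\<bar>) \<le> \<epsilon> / 2 * r"
      using conjunct2[OF *, rule_format, of "\<epsilon> / 2"] \<epsilon> by auto
    have "integral {x - r..x + r} (\<lambda>y. \<bar>g y - g x\<bar>) \<le> \<epsilon> * r" if r: "0 < r" "r < min d1 d2" for r
    proof -
      have "(\<lambda>y. \<bar>g y - g x\<bar>) integrable_on {x - r..x + r}"
        by (rule integrable_on_abs_diff_const[OF g])
      then have "integral {x - r..x + r} (\<lambda>y. \<bar>g y - g x\<bar>)
          = integral {x - r..x} (\<lambda>y. \<bar>g y - g x\<bar>) + integral {x..x + r} (\<lambda>y. \<bar>g y - g x\<bar>)"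
        using r by (intro Henstock_Kurzweil_Integration.integral_combine[symmetric]) auto
      then show ?thesis using d1(2)[of r] d2(2)[of r] r by (auto simp: field_simps)
    qed
    then show "\<exists>\<delta>>0. \<forall>r. 0 < r \<and> r < \<delta> \<longrightarrow> integral {x - r..x + r} (\<lambda>y. \<bar>g y - g x\<bar>) \<le> \<epsilon> * r"
      using d1(1) d2(1) by (intro exI[of _ "min d1 d2"]) auto
  qed
qed

section \<open>The kernel as an approximate identity\<close>

text \<open>The substitution t = lam * y^2 in Euler's integral for Gamma(m + 1).\<close>

lemma nn_integral_powr_gaussian:
  assumes m: "m > -1" and l: "lam > 0"
  shows "(\<integral>\<^sup>+y. ennreal (y powr (2 * m + 1) * exp (- lam * y\<^sup>2)) * indicator {0<..} y \<partial>lborel)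
    = ennreal (Gamma (m + 1) / (2 * lam powr (m + 1)))"
proof -
  define f where "f t = t powr m / exp t" for t :: real
  have "(f has_integral Gamma (m + 1)) {0..}"
    unfolding f_def using Gamma_integral_real[of "m + 1"] m by simp
  then have f: "(f has_integral Gamma (m + 1)) {0<..}"
    by (rule has_integral_spike_set_eq[THEN iffD1, rotated 2])
      (auto intro: negligible_subset[of "{0}"])
  have im: "(\<lambda>y. lam * y\<^sup>2) ` {0<..} = {0<..}"
  proof (intro equalityI subsetI)
    fix t :: real assume "t \<in> {0<..}"
    then show "t \<in> (\<lambda>y. lam * y\<^sup>2) ` {0<..}"
      using l by (intro image_eqI[of _ _ "sqrt (t / lam)"]) auto
  qed (use l in auto)
  have "f absolutely_integrable_on {0<..}"
    by (rule nonnegative_absolutely_integrable_1) (use f in \<open>auto simp: f_def\<close>)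
  moreover have "integral {0<..} f = Gamma (m + 1)" using f by (rule integral_unique)
  ultimately have "(\<lambda>y. \<bar>2 * lam * y\<bar> * f (lam * y\<^sup>2)) absolutely_integrable_on {0<..} \<and>
      integral {0<..} (\<lambda>y. \<bar>2 * lam * y\<bar> * f (lam * y\<^sup>2)) = Gamma (m + 1)"
    using l by (subst has_absolute_integral_change_of_variables_1'[where g="\<lambda>y. lam * y\<^sup>2"])
      (auto simp: im inj_on_def intro!: derivative_eq_intros)
  then have "((\<lambda>y. \<bar>2 * lam * y\<bar> * f (lam * y\<^sup>2)) has_integral Gamma (m + 1)) {0<..}"
    using set_lebesgue_integral_eq_integral(1) by (metis has_integral_integral)
  then have "((\<lambda>y. \<bar>2 * lam * y\<bar> * f (lam * y\<^sup>2) / (2 * lam powr (m + 1)))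
      has_integral Gamma (m + 1) / (2 * lam powr (m + 1))) {0<..}"
    by (rule has_integral_divide)
  moreover have "\<bar>2 * lam * y\<bar> * f (lam * y\<^sup>2) / (2 * lam powr (m + 1)) = y powr (2 * m + 1) * exp (- lam * y\<^sup>2)"
    if "y \<in> {0<..}" for y
  proof -
    have "(y\<^sup>2) powr m = y powr (2 * m)"
      using that powr_powr[of y 2 m] by simp
    then show ?thesis using that l
      by (simp add: f_def powr_mult powr_add exp_minus divide_simps)
  qed
  ultimately have "((\<lambda>y. y powr (2 * m + 1) * exp (- lam * y\<^sup>2))
      has_integral Gamma (m + 1) / (2 * lam powr (m + 1))) {0<..}"
    by (rule has_integral_eq[rotated])
  then show ?thesis
    by (intro nn_integral_has_integral_lebesgue') auto
qed

text \<open>All terms are nonnegative, so sum and integral may be exchanged. In the k-th term the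
  Gamma value of the moment cancels the reciprocal Gamma of the coefficient, and the exponential
  series of s / lam remains.\<close>

lemma nn_integral_bessel_series_gaussian:
  assumes \<mu>: "\<mu> > -1" and l: "lam > 0" and s: "s \<ge> 0"
  shows "(\<integral>\<^sup>+y. ennreal (y powr (2 * \<mu> + 1) * bessel_series \<mu> (s * y\<^sup>2) * exp (- lam * y\<^sup>2))
      * indicator {0<..} y \<partial>lborel) = ennreal (exp (s / lam) / (2 * lam powr (\<mu> + 1)))"
proof -
  define T where "T k y = y powr (2 * (\<mu> + real k) + 1) * exp (- lam * y\<^sup>2)" for k y
  define c where "c k = bessel_coeff \<mu> k * s ^ k" for k
  have c: "c k \<ge> 0" for k using bessel_coeff_pos[OF \<mu>, of k] s by (simp add: c_def)
  have *: "ennreal (y powr (2 * \<mu> + 1) * bessel_series \<mu> (s * y\<^sup>2) * exp (- lam * y\<^sup>2)) * indicator {0<..} y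
      = (\<Sum>k. ennreal (c k) * (ennreal (T k y) * indicator {0<..} y))" for y
  proof (cases "y > 0")
    case True
    have e: "c k * T k y = y powr (2 * \<mu> + 1) * exp (- lam * y\<^sup>2) * (bessel_coeff \<mu> k * (s * y\<^sup>2) ^ k)" for k
    proof -
      have "y powr (2 * (\<mu> + real k) + 1) = y powr (2 * \<mu> + 1) * y powr (real (2 * k))"
        by (simp add: powr_add[symmetric] algebra_simps)
      also have "y powr (real (2 * k)) = (y\<^sup>2) ^ k"
        using True by (subst powr_realpow) (auto simp: power_mult)
      finally show ?thesis by (simp add: c_def T_def power_mult_distrib)
    qed
    have "(\<Sum>k. ennreal (c k * T k y)) = ennreal (\<Sum>k. c k * T k y)"
    proof (rule suminf_ennreal2)
      show "summable (\<lambda>k. c k * T k y)" unfolding e by (intro summable_mult summable_bessel_series)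
    qed (use c in \<open>simp add: T_def\<close>)
    also have "(\<Sum>k. c k * T k y) = y powr (2 * \<mu> + 1) * exp (- lam * y\<^sup>2) * bessel_series \<mu> (s * y\<^sup>2)"
      unfolding e bessel_series_def by (intro suminf_mult summable_bessel_series)
    finally show ?thesis using True c by (simp add: ennreal_mult'[symmetric] T_def mult_ac)
  qed simp
  have "(\<integral>\<^sup>+y. ennreal (y powr (2 * \<mu> + 1) * bessel_series \<mu> (s * y\<^sup>2) * exp (- lam * y\<^sup>2))
      * indicator {0<..} y \<partial>lborel) = (\<Sum>k. \<integral>\<^sup>+y. ennreal (c k) * (ennreal (T k y) * indicator {0<..} y) \<partial>lborel)"
    unfolding * by (intro nn_integral_suminf) (simp add: T_def)
  also have "\<dots> = (\<Sum>k. ennreal (1 / (2 * lam powr (\<mu> + 1)) * ((s / lam) ^ k /\<^sub>R fact k)))"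
  proof (intro suminf_cong)
    fix k
    have k: "\<mu> + real k > -1" using \<mu> by simp
    have G: "Gamma (\<mu> + real k + 1) > 0" using k by (intro Gamma_real_pos) simp
    have "(\<integral>\<^sup>+y. ennreal (c k) * (ennreal (T k y) * indicator {0<..} y) \<partial>lborel)
        = ennreal (c k) * ennreal (Gamma (\<mu> + real k + 1) / (2 * lam powr (\<mu> + real k + 1)))"
      unfolding T_def by (subst nn_integral_cmult) (simp_all only: nn_integral_powr_gaussian[OF k l], simp)
    also have "\<dots> = ennreal (c k * (Gamma (\<mu> + real k + 1) / (2 * lam powr (\<mu> + real k + 1))))"
      using c by (intro ennreal_mult'[symmetric])
    also have "c k * (Gamma (\<mu> + real k + 1) / (2 * lam powr (\<mu> + real k + 1)))
       = 1 / (2 * lam powr (\<mu> + 1)) * ((s / lam) ^ k /\<^sub>R fact k)"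
    proof -
      have P: "lam powr (\<mu> + real k + 1) = lam powr (\<mu> + 1) * lam ^ k"
        using l by (simp add: powr_add powr_realpow)
      have B: "bessel_coeff \<mu> k * Gamma (\<mu> + real k + 1) = 1 / fact k"
        using G by (simp add: bessel_coeff_def rGamma_inverse_Gamma add_ac)
      have "c k * (g / (2 * p)) = (bessel_coeff \<mu> k * g) * s ^ k / (2 * p)" for g p
        by (simp add: c_def)
      then have "c k * (Gamma (\<mu> + real k + 1) / (2 * lam powr (\<mu> + real k + 1)))
          = 1 / fact k * s ^ k / (2 * (lam powr (\<mu> + 1) * lam ^ k))"
        unfolding P B[symmetric] .
      also have "\<dots> = 1 / (2 * lam powr (\<mu> + 1)) * ((s / lam) ^ k /\<^sub>R fact k)"
        unfolding power_divide by (simp add: divide_simps)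
      finally show ?thesis .
    qed
    finally show "(\<integral>\<^sup>+y. ennreal (c k) * (ennreal (T k y) * indicator {0<..} y) \<partial>lborel)
      = ennreal (1 / (2 * lam powr (\<mu> + 1)) * ((s / lam) ^ k /\<^sub>R fact k))" .
  qed
  also have "\<dots> = ennreal (\<Sum>k. 1 / (2 * lam powr (\<mu> + 1)) * ((s / lam) ^ k /\<^sub>R fact k))"
    using s l by (intro suminf_ennreal2 summable_mult summable_exp_generic) auto
  also have "(\<Sum>k. 1 / (2 * lam powr (\<mu> + 1)) * ((s / lam) ^ k /\<^sub>R fact k)) = 1 / (2 * lam powr (\<mu> + 1)) * exp (s / lam)"
    unfolding exp_def by (intro suminf_mult summable_exp_generic)
  finally show ?thesis by simp
qed

section \<open>The normalised density: exponential moments, concentration, approximate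
  identity\<close>

text \<open>The weight \<open>y\<^sup>\<mu>\<^sup>+\<^sup>1\<^sup>/\<^sup>2\<close> is harmonic for the Bessel operator, so the semigroup preserves it;
  normalising by it turns the kernel into a probability density.\<close>
definition bessel_density :: "real \<Rightarrow> real \<Rightarrow> real \<Rightarrow> real \<Rightarrow> real" where
  "bessel_density \<mu> t x y = bessel_kernel \<mu> t x y * (y powr (\<mu> + 1 / 2) / x powr (\<mu> + 1 / 2))"

lemma continuous_on_bessel_kernel_y:
  assumes "t > 0" "x > 0"
  shows "continuous_on {0<..} (\<lambda>y. bessel_kernel \<mu> t x y)"
proof -
  have "continuous_on {0<..} (\<lambda>y. (t, x, y))" by (intro continuous_intros)
  moreover have "(\<lambda>y. (t, x, y)) ` {0<..} \<subseteq> {0<..} \<times> {0<..} \<times> {0<..}" using assms by auto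
  ultimately show ?thesis
    using continuous_on_compose2[OF continuous_on_kernels(1), of "{0<..}" "\<lambda>y. (t, x, y)"] by simp
qed

lemma bessel_density_measurable:
  assumes "t > 0" "x > 0"
  shows "bessel_density \<mu> t x \<in> borel_measurable (lebesgue_on {0<..})"
  unfolding bessel_density_def[abs_def]
  using assms by (intro continuous_imp_measurable_on_sets_lebesgue continuous_intros
      continuous_on_bessel_kernel_y) auto

lemma bessel_density_nonneg:
  "\<mu> > -1 \<Longrightarrow> t > 0 \<Longrightarrow> x > 0 \<Longrightarrow> y > 0 \<Longrightarrow> bessel_density \<mu> t x y \<ge> 0"
  using bessel_kernel_pos[of \<mu> t x y] by (simp add: bessel_density_def)

text \<open>The moment generating function of a squared Bessel process of dimension 2 \<mu> + 2
  started at x^2, at time 2 t. The condition on \<eta> says exactly that the total Gaussian exponent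
  (1 - 4 t \<eta>) / (4 t) is positive.\<close>

lemma has_bochner_integral_bessel_density_exp:
  assumes \<mu>: "\<mu> > -1" and t: "t > 0" and x: "x > 0" and \<eta>: "4 * t * \<eta> < 1"
  shows "has_bochner_integral (lebesgue_on {0<..}) (\<lambda>y. bessel_density \<mu> t x y * exp (\<eta> * y\<^sup>2))
    ((1 - 4 * t * \<eta>) powr (- \<mu> - 1) * exp (\<eta> * x\<^sup>2 / (1 - 4 * t * \<eta>)))"
proof -
  define w where "w = 1 - 4 * t * \<eta>"
  define lam where "lam = w / (4 * t)"
  define s where "s = x\<^sup>2 / (16 * t\<^sup>2)"
  define c where "c = 2 powr (- 1 - 2 * \<mu>) * t powr (- \<mu> - 1) * exp (- x\<^sup>2 / (4 * t))"
  have w: "w > 0" and l: "lam > 0" and s: "s \<ge> 0" and c: "c \<ge> 0"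
    using \<eta> t by (auto simp: w_def lam_def s_def c_def)
  have eq: "bessel_density \<mu> t x y * exp (\<eta> * y\<^sup>2) =
      c * (y powr (2 * \<mu> + 1) * bessel_series \<mu> (s * y\<^sup>2) * exp (- lam * y\<^sup>2))" if y: "y > 0" for y
  proof -
    have 1: "exp (- (x\<^sup>2 + y\<^sup>2) / (4 * t)) * exp (\<eta> * y\<^sup>2) = exp (- x\<^sup>2 / (4 * t)) * exp (- lam * y\<^sup>2)"
      unfolding exp_add[symmetric] using t by (simp add: lam_def w_def field_simps)
    have 2: "(x * y) powr (\<mu> + 1 / 2) * (y powr (\<mu> + 1 / 2) / x powr (\<mu> + 1 / 2)) = y powr (2 * \<mu> + 1)"
      using x y by (simp add: powr_mult powr_add[symmetric])
    have "bessel_density \<mu> t x y * exp (\<eta> * y\<^sup>2) = 2 powr (- 1 - 2 * \<mu>) * t powr (- \<mu> - 1) *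
        ((x * y) powr (\<mu> + 1 / 2) * (y powr (\<mu> + 1 / 2) / x powr (\<mu> + 1 / 2))) *
        (exp (- (x\<^sup>2 + y\<^sup>2) / (4 * t)) * exp (\<eta> * y\<^sup>2)) * bessel_series \<mu> (s * y\<^sup>2)"
      unfolding bessel_density_def bessel_kernel_eq[OF t x y] bessel_prefactor_def bessel_arg_def s_def
      by (simp only: mult_ac times_divide_eq_left times_divide_eq_right)
    then show ?thesis unfolding 1 2 c_def by (simp only: mult_ac)
  qed
  have "(\<integral>\<^sup>+y. ennreal (bessel_density \<mu> t x y * exp (\<eta> * y\<^sup>2)) \<partial>lebesgue_on {0<..})
      = (\<integral>\<^sup>+y. ennreal (bessel_density \<mu> t x y * exp (\<eta> * y\<^sup>2)) * indicator {0<..} y \<partial>lborel)"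
    by (simp add: nn_integral_restrict_space nn_integral_completion)
  also have "\<dots> = (\<integral>\<^sup>+y. ennreal c * (ennreal (y powr (2 * \<mu> + 1) * bessel_series \<mu> (s * y\<^sup>2) * exp (- lam * y\<^sup>2))
      * indicator {0<..} y) \<partial>lborel)"
    using c by (intro nn_integral_cong) (auto simp: eq ennreal_mult' indicator_def)
  also have "\<dots> = ennreal c * ennreal (exp (s / lam) / (2 * lam powr (\<mu> + 1)))"
  proof -
    have "(\<lambda>y. bessel_series \<mu> (s * y\<^sup>2)) \<in> borel_measurable borel"
      by (intro borel_measurable_continuous_onI continuous_intros)
    then show ?thesis
      by (subst nn_integral_cmult) (simp, simp only: nn_integral_bessel_series_gaussian[OF \<mu> l s])
  qed
  also have "\<dots> = ennreal (c * (exp (s / lam) / (2 * lam powr (\<mu> + 1))))"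
    using c by (intro ennreal_mult'[symmetric])
  also have "c * (exp (s / lam) / (2 * lam powr (\<mu> + 1))) = w powr (- \<mu> - 1) * exp (\<eta> * x\<^sup>2 / w)"
  proof -
    have 1: "exp (- x\<^sup>2 / (4 * t)) * exp (s / lam) = exp (\<eta> * x\<^sup>2 / w)"
    proof -
      have "- x\<^sup>2 / (4 * t) + s / lam = (x\<^sup>2 / (4 * t)) * (1 / w - 1)"
        using t w by (simp add: s_def lam_def field_simps power2_eq_square)
      also have "1 / w - 1 = 4 * t * \<eta> / w" using w by (simp add: field_simps) (simp add: w_def)
      finally show ?thesis using t by (simp add: exp_add[symmetric] mult.commute)
    qed
    have 2: "lam powr (\<mu> + 1) = w powr (\<mu> + 1) / (4 powr (\<mu> + 1) * t powr (\<mu> + 1))"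
      using w t by (simp add: lam_def powr_divide powr_mult)
    have 3: "4 powr (\<mu> + 1) = (2 powr (2 * \<mu> + 2) :: real)"
      using powr_powr[of "2::real" 2 "\<mu> + 1"] by (simp add: algebra_simps)
    have 4: "2 powr (- 1 - 2 * \<mu>) * 2 powr (2 * \<mu> + 2) = (2::real)"
      by (simp add: powr_add[symmetric])
    have 5: "t powr (- \<mu> - 1) * t powr (\<mu> + 1) = 1" using t by (simp add: powr_add[symmetric])
    have 6: "w powr (- \<mu> - 1) = 1 / w powr (\<mu> + 1)"
    proof -
      have "- \<mu> - 1 = - (\<mu> + 1)" by simp
      then show ?thesis by (simp only: powr_minus_divide)
    qed
    have "c * (exp (s / lam) / (2 * lam powr (\<mu> + 1))) =
       (exp (- x\<^sup>2 / (4 * t)) * exp (s / lam)) * (2 powr (- 1 - 2 * \<mu>) * 2 powr (2 * \<mu> + 2)) / 2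
       * (t powr (- \<mu> - 1) * t powr (\<mu> + 1)) / w powr (\<mu> + 1)"
      unfolding c_def 2 3 by (simp add: field_simps)
    also have "\<dots> = w powr (- \<mu> - 1) * exp (\<eta> * x\<^sup>2 / w)"
      unfolding 1 4 5 6 by simp
    finally show ?thesis .
  qed
  finally have nn: "(\<integral>\<^sup>+y. ennreal (bessel_density \<mu> t x y * exp (\<eta> * y\<^sup>2)) \<partial>lebesgue_on {0<..})
      = ennreal (w powr (- \<mu> - 1) * exp (\<eta> * x\<^sup>2 / w))" .
  show ?thesis
  proof (rule has_bochner_integral_nn_integral)
    show "(\<lambda>y. bessel_density \<mu> t x y * exp (\<eta> * y\<^sup>2)) \<in> borel_measurable (lebesgue_on {0<..})"
      by (intro borel_measurable_times bessel_density_measurable t x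
          continuous_imp_measurable_on_sets_lebesgue continuous_intros) auto
    show "AE y in lebesgue_on {0<..}. 0 \<le> bessel_density \<mu> t x y * exp (\<eta> * y\<^sup>2)"
      using bessel_density_nonneg[OF \<mu> t x] by (intro AE_I2) auto
  qed (use nn in \<open>simp_all add: w_def\<close>)
qed

lemma integrable_bessel_density:
  assumes "\<mu> > -1" "t > 0" "x > 0"
  shows "integrable (lebesgue_on {0<..}) (bessel_density \<mu> t x)"
    and integral_bessel_density: "(\<integral>y. bessel_density \<mu> t x y \<partial>lebesgue_on {0<..}) = 1"
  using has_bochner_integral_bessel_density_exp[of \<mu> t x 0] assms by (auto simp: has_bochner_integral_iff)

text \<open>Markov's inequality for K(y^2 - x^2) with K v = 2 cosh v - 2. This function is a
  combination of exponentials of y^2 whose moments are known in closed form, it is even and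
  increasing in |v|, and |y - x| at least \<delta> forces |y^2 - x^2| to be at least x \<delta>. As
  t tends to 0, the moment tends to K 0 = 0.\<close>

lemma bessel_density_concentrates:
  assumes \<mu>: "\<mu> > -1" and x: "x > 0" and d: "\<delta> > 0"
  shows "((\<lambda>t. \<integral>y. indicator {y. \<delta> \<le> \<bar>y - x\<bar>} y * bessel_density \<mu> t x y \<partial>lebesgue_on {0<..}) \<longlongrightarrow> 0) (at_right 0)"
proof -
  define K where "K v = exp v + exp (- v) - 2" for v :: real
  have K_eq: "K v = (exp (v / 2) - exp (- (v / 2)))\<^sup>2" for v
  proof -
    have "exp (v / 2) * exp (v / 2) = exp v" "exp (- (v / 2)) * exp (- (v / 2)) = exp (- v)"
      "exp (v / 2) * exp (- (v / 2)) = 1"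
      unfolding exp_add[symmetric] by simp_all
    note p = this
    have "(exp (v / 2) - exp (- (v / 2)))\<^sup>2 = exp (v / 2) * exp (v / 2)
        + exp (- (v / 2)) * exp (- (v / 2)) - 2 * (exp (v / 2) * exp (- (v / 2)))"
      by (simp only: power2_eq_square algebra_simps)
    then show ?thesis unfolding p by (simp add: K_def)
  qed
  have K0: "K v \<ge> 0" for v by (simp add: K_eq)
  have mono: "K r \<le> K v" if "0 \<le> r" "r \<le> \<bar>v\<bar>" for r v
  proof -
    have "0 \<le> (exp (\<bar>v\<bar> - r) - 1) * (exp r - exp (- \<bar>v\<bar>))"
      using that by (intro mult_nonneg_nonneg) auto
    also have "\<dots> = K \<bar>v\<bar> - K r"
    proof -
      have "exp (\<bar>v\<bar> - r) * exp r = exp \<bar>v\<bar>" "exp (\<bar>v\<bar> - r) * exp (- \<bar>v\<bar>) = exp (- r)"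
        unfolding exp_add[symmetric] by simp_all
      then show ?thesis by (simp add: K_def left_diff_distrib right_diff_distrib)
    qed
    also have "K \<bar>v\<bar> = K v" by (simp add: K_def abs_if)
    finally show ?thesis by simp
  qed
  define r where "r = x * \<delta>"
  have r: "r > 0" using x d by (simp add: r_def)
  have Kr: "K r > 0" using r by (simp add: K_eq)
  define E where "E \<eta> t = (1 - 4 * t * \<eta>) powr (- \<mu> - 1) * exp (\<eta> * x\<^sup>2 / (1 - 4 * t * \<eta>))" for \<eta> t :: real
  define G where "G t = exp (- x\<^sup>2) * E 1 t + exp (x\<^sup>2) * E (-1) t - 2" for t
  have "((\<lambda>t. E \<eta> t) \<longlongrightarrow> exp (\<eta> * x\<^sup>2)) (at_right 0)" for \<eta>
    unfolding E_def by (auto intro!: tendsto_eq_intros)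
  then have "(G \<longlongrightarrow> 0) (at_right 0)"
    unfolding G_def by (auto intro!: tendsto_eq_intros simp: exp_minus)
  then have lim: "((\<lambda>t. G t / K r) \<longlongrightarrow> 0) (at_right 0)"
    by (auto intro: tendsto_divide_zero)
  \<comment> \<open>The bound 1/8 keeps 4 t \<eta> below 1 for all exponents in [-1, 1].\<close>
  have ev: "eventually (\<lambda>t. 0 < t \<and> t < 1 / 8) (at_right (0::real))"
    using eventually_at_right_real[of 0 "1 / 8 :: real"] by simp
  have bound: "0 \<le> (\<integral>y. indicator {y. \<delta> \<le> \<bar>y - x\<bar>} y * bessel_density \<mu> t x y \<partial>lebesgue_on {0<..})"
      "(\<integral>y. indicator {y. \<delta> \<le> \<bar>y - x\<bar>} y * bessel_density \<mu> t x y \<partial>lebesgue_on {0<..}) \<le> G t / K r"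
    if t: "0 < t" "t < 1 / 8" for t
  proof -
    let ?p = "bessel_density \<mu> t x" and ?M = "lebesgue_on {0::real<..}"
    note p0 = bessel_density_nonneg[OF \<mu> t(1) x]
    have h: "has_bochner_integral ?M (\<lambda>y. ?p y * exp (\<eta> * y\<^sup>2)) (E \<eta> t)" if "\<bar>\<eta>\<bar> \<le> 1" for \<eta>
      unfolding E_def
    proof (rule has_bochner_integral_bessel_density_exp[OF \<mu> t(1) x])
      have "4 * t * \<eta> \<le> 4 * t * 1" using that t by (intro mult_left_mono) auto
      then show "4 * t * \<eta> < 1" using t by linarith
    qed
    have "has_bochner_integral ?M (\<lambda>y. exp (- x\<^sup>2) * (?p y * exp (1 * y\<^sup>2)) + exp (x\<^sup>2) * (?p y * exp (- 1 * y\<^sup>2)) - 2 * (?p y * exp (0 * y\<^sup>2)))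
       (exp (- x\<^sup>2) * E 1 t + exp (x\<^sup>2) * E (-1) t - 2 * E 0 t)"
      by (intro has_bochner_integral_diff has_bochner_integral_add has_bochner_integral_mult_right h) auto
    also have "(\<lambda>y. exp (- x\<^sup>2) * (?p y * exp (1 * y\<^sup>2)) + exp (x\<^sup>2) * (?p y * exp (- 1 * y\<^sup>2)) - 2 * (?p y * exp (0 * y\<^sup>2)))
        = (\<lambda>y. ?p y * K (y\<^sup>2 - x\<^sup>2))"
      by (rule ext) (simp add: K_def algebra_simps exp_diff exp_minus divide_inverse)
    also have "exp (- x\<^sup>2) * E 1 t + exp (x\<^sup>2) * E (-1) t - 2 * E 0 t = G t"
      by (simp add: G_def E_def)
    finally have H: "has_bochner_integral ?M (\<lambda>y. ?p y * K (y\<^sup>2 - x\<^sup>2)) (G t)" .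
    show "0 \<le> (\<integral>y. indicator {y. \<delta> \<le> \<bar>y - x\<bar>} y * ?p y \<partial>?M)"
      using p0 by (intro integral_nonneg_AE AE_I2) auto
    have "(\<integral>y. indicator {y. \<delta> \<le> \<bar>y - x\<bar>} y * ?p y \<partial>?M) \<le> (\<integral>y. ?p y * K (y\<^sup>2 - x\<^sup>2) / K r \<partial>?M)"
    proof (rule integral_mono')
      show "integrable ?M (\<lambda>y. ?p y * K (y\<^sup>2 - x\<^sup>2) / K r)"
        using H by (intro integrable_divide) (auto simp: has_bochner_integral_iff)
      fix y assume "y \<in> space ?M"
      then have y: "y > 0" by simp
      show "0 \<le> ?p y * K (y\<^sup>2 - x\<^sup>2) / K r" using p0[OF y] K0 Kr by simp
      show "indicator {y. \<delta> \<le> \<bar>y - x\<bar>} y * ?p y \<le> ?p y * K (y\<^sup>2 - x\<^sup>2) / K r"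
      proof (cases "\<delta> \<le> \<bar>y - x\<bar>")
        case True
        have "\<bar>y\<^sup>2 - x\<^sup>2\<bar> = (y + x) * \<bar>y - x\<bar>"
        proof -
          have "y\<^sup>2 - x\<^sup>2 = (y + x) * (y - x)" by (simp add: power2_eq_square algebra_simps)
          then show ?thesis using x y by (simp add: abs_mult)
        qed
        moreover have "x * \<delta> \<le> (y + x) * \<bar>y - x\<bar>" using True x y d by (intro mult_mono) auto
        ultimately have "K r \<le> K (y\<^sup>2 - x\<^sup>2)" using r by (intro mono) (auto simp: r_def)
        then have "?p y * K r \<le> ?p y * K (y\<^sup>2 - x\<^sup>2)" using p0[OF y] by (intro mult_left_mono) auto
        then show ?thesis using True Kr by (simp add: field_simps)
      qed (use p0[OF y] K0 Kr in simp)
    qed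
    also have "\<dots> = G t / K r"
      using H by (simp add: has_bochner_integral_iff)
    finally show "(\<integral>y. indicator {y. \<delta> \<le> \<bar>y - x\<bar>} y * ?p y \<partial>?M) \<le> G t / K r" .
  qed
  show ?thesis
    by (rule tendsto_sandwich[OF _ _ tendsto_const lim]; rule eventually_mono[OF ev]) (use bound in auto)
qed

text \<open>Far from x the boundedness of \<psi> and the concentration of mass suffice. The
  condition near x is an integrated one, so that both continuity points and Lebesgue points satisfy
  it; \<psi> may vary with t because the source enters at the shifted time.\<close>

lemma bessel_density_approximate_identity:
  fixes \<psi> :: "real \<Rightarrow> real \<Rightarrow> real"
  assumes \<mu>: "\<mu> > -1" and x: "x > 0"
    and meas: "\<And>t. t > 0 \<Longrightarrow> \<psi> t \<in> borel_measurable (lebesgue_on {0<..})"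
    and bound: "\<And>t. t > 0 \<Longrightarrow> AE y in lebesgue_on {0<..}. \<bar>\<psi> t y\<bar> \<le> C"
    and near: "\<And>\<epsilon>. \<epsilon> > 0 \<Longrightarrow> \<exists>\<delta>>0. eventually (\<lambda>t. (\<integral>y. indicator {y. \<bar>y - x\<bar> < \<delta>} y *
        (bessel_density \<mu> t x y * \<bar>\<psi> t y - L\<bar>) \<partial>lebesgue_on {0<..}) \<le> \<epsilon>) (at_right 0)"
  shows "((\<lambda>t. \<integral>y. bessel_density \<mu> t x y * \<psi> t y \<partial>lebesgue_on {0<..}) \<longlongrightarrow> L) (at_right 0)"
proof (rule tendstoI)
  fix e :: real assume e: "e > 0"
  let ?M = "lebesgue_on {0::real<..}"
  obtain \<delta> where d: "\<delta> > 0" and ev1: "eventually (\<lambda>t. (\<integral>y. indicator {y. \<bar>y - x\<bar> < \<delta>} y *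
        (bessel_density \<mu> t x y * \<bar>\<psi> t y - L\<bar>) \<partial>?M) \<le> e / 2) (at_right 0)"
    using near[of "e / 2"] e by auto
  define D where "D = \<bar>C\<bar> + \<bar>L\<bar>"
  have "((\<lambda>t. D * (\<integral>y. indicator {y. \<delta> \<le> \<bar>y - x\<bar>} y * bessel_density \<mu> t x y \<partial>?M)) \<longlongrightarrow> D * 0) (at_right 0)"
    by (intro tendsto_mult tendsto_const bessel_density_concentrates \<mu> x d)
  then have ev2: "eventually (\<lambda>t. D * (\<integral>y. indicator {y. \<delta> \<le> \<bar>y - x\<bar>} y * bessel_density \<mu> t x y \<partial>?M) < e / 2) (at_right 0)"
    using e by (intro order_tendstoD(2)[of _ "D * 0"]) auto
  have ev3: "eventually (\<lambda>t. t > 0) (at_right (0::real))" by (simp add: eventually_at_right_less)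
  show "eventually (\<lambda>t. dist (\<integral>y. bessel_density \<mu> t x y * \<psi> t y \<partial>?M) L < e) (at_right 0)"
    using ev1 ev2 ev3
  proof eventually_elim
    case (elim t)
    then have t: "t > 0" by simp
    let ?p = "bessel_density \<mu> t x"
    note p0 = bessel_density_nonneg[OF \<mu> t x]
    have id [measurable]: "(\<lambda>y. y) \<in> borel_measurable ?M"
      by (intro continuous_imp_measurable_on_sets_lebesgue continuous_intros) auto
    note [measurable] = bessel_density_measurable[OF t x, of \<mu>] meas[OF t]
    have pi: "integrable ?M ?p" using integrable_bessel_density[OF \<mu> t x] by simp
    have dom: "integrable ?M (\<lambda>y. ?p y * h y)"
      if "h \<in> borel_measurable ?M" "AE y in ?M. \<bar>h y\<bar> \<le> B" for h B
    proof (rule Bochner_Integration.integrable_bound[of _ "\<lambda>y. B * ?p y"])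
      show "AE y in ?M. norm (?p y * h y) \<le> norm (B * ?p y)"
        using that(2) AE_space
      proof eventually_elim
        case (elim y)
        then have "\<bar>h y\<bar> * ?p y \<le> \<bar>B\<bar> * ?p y" using p0[of y] by (intro mult_right_mono) auto
        then show ?case using p0[of y] elim by (simp add: abs_mult mult.commute)
      qed
    qed (use pi that(1) in auto)
    have b: "AE y in ?M. \<bar>\<psi> t y - L\<bar> \<le> D" using bound[OF t] by eventually_elim (auto simp: D_def)
    have i1: "integrable ?M (\<lambda>y. ?p y * \<psi> t y)" using bound[OF t] by (intro dom[of _ C]) auto
    have i2: "integrable ?M (\<lambda>y. ?p y * (\<psi> t y - L))" using b by (intro dom[of _ D]) auto
    have i3: "integrable ?M (\<lambda>y. indicator {y. \<bar>y - x\<bar> < \<delta>} y * (?p y * \<bar>\<psi> t y - L\<bar>))"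
    proof -
      have "integrable ?M (\<lambda>y. ?p y * (indicator {y. \<bar>y - x\<bar> < \<delta>} y * \<bar>\<psi> t y - L\<bar>))"
      proof (rule dom[of _ D])
        show "AE y in ?M. \<bar>indicator {y. \<bar>y - x\<bar> < \<delta>} y * \<bar>\<psi> t y - L\<bar>\<bar> \<le> D"
          using b by eventually_elim (auto simp: indicator_def)
      qed measurable
      then show ?thesis by (simp add: mult_ac)
    qed
    have i4: "integrable ?M (\<lambda>y. D * (indicator {y. \<delta> \<le> \<bar>y - x\<bar>} y * ?p y))"
    proof -
      have "integrable ?M (\<lambda>y. ?p y * (indicator {y. \<delta> \<le> \<bar>y - x\<bar>} y))"
      proof (rule dom[of _ 1])
        show "AE y in ?M. \<bar>indicator {y. \<delta> \<le> \<bar>y - x\<bar>} y\<bar> \<le> (1::real)"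
          by (auto simp: indicator_def)
      qed measurable
      then show ?thesis by (simp add: mult_ac)
    qed
    have "(\<integral>y. ?p y * \<psi> t y \<partial>?M) - L = (\<integral>y. ?p y * \<psi> t y \<partial>?M) - (\<integral>y. ?p y * L \<partial>?M)"
      using integral_bessel_density[OF \<mu> t x] by simp
    also have "\<dots> = (\<integral>y. ?p y * (\<psi> t y - L) \<partial>?M)"
      using i1 pi by (subst Bochner_Integration.integral_diff[symmetric]) (auto simp: right_diff_distrib)
    finally have "\<bar>(\<integral>y. ?p y * \<psi> t y \<partial>?M) - L\<bar> \<le> (\<integral>y. \<bar>?p y * (\<psi> t y - L)\<bar> \<partial>?M)"
      using integral_abs_bound by simp
    also have "\<dots> \<le> (\<integral>y. indicator {y. \<bar>y - x\<bar> < \<delta>} y * (?p y * \<bar>\<psi> t y - L\<bar>)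
        + D * (indicator {y. \<delta> \<le> \<bar>y - x\<bar>} y * ?p y) \<partial>?M)"
    proof (rule integral_mono_AE)
      show "AE y in ?M. \<bar>?p y * (\<psi> t y - L)\<bar> \<le> indicator {y. \<bar>y - x\<bar> < \<delta>} y * (?p y * \<bar>\<psi> t y - L\<bar>)
        + D * (indicator {y. \<delta> \<le> \<bar>y - x\<bar>} y * ?p y)"
        using b AE_space
      proof eventually_elim
        case (elim y)
        then have y: "0 \<le> ?p y" using p0[of y] by simp
        then have "?p y * \<bar>\<psi> t y - L\<bar> \<le> ?p y * D" using elim by (intro mult_left_mono) auto
        then show ?case using y by (auto simp: indicator_def abs_mult mult.commute)
      qed
    qed (use i2 i3 i4 in auto)
    also have "\<dots> \<le> e / 2 + D * (\<integral>y. indicator {y. \<delta> \<le> \<bar>y - x\<bar>} y * ?p y \<partial>?M)"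
      using elim(1) i3 i4 by (subst Bochner_Integration.integral_add) auto
    also have "\<dots> < e" using elim(2) by simp
    finally show ?case by (simp add: dist_real_def)
  qed
qed

section \<open>A mass bound on intervals, uniform in time\<close>

lemma powr_le_endpoints:
  fixes y :: real
  assumes "0 < a" "a \<le> y" "y \<le> b"
  shows "y powr \<beta> \<le> a powr \<beta> + b powr \<beta>"
proof (cases "\<beta> \<ge> 0")
  case True
  have "y powr \<beta> \<le> b powr \<beta>" using assms True by (intro powr_mono2) auto
  then show ?thesis by (simp add: add_increasing)
next
  case False
  have "y powr \<beta> \<le> a powr \<beta>" using assms False by (intro powr_mono2') auto
  then show ?thesis by (simp add: add_increasing2)
qed

text \<open>On [a, b] the weight is bounded below, so a constant times the density dominates the
  kernel, and the density has mass 1. The two endpoint powers cover both signs of \<mu> + 1/2. The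
  bound is free of t, which makes the Duhamel integral converge at \<tau> = 0.\<close>

lemma integral_bessel_kernel_le:
  assumes \<mu>: "\<mu> > -1" and t: "t > 0" and x: "x > 0" and a: "0 < a" "a \<le> b"
  shows "(\<integral>y. bessel_kernel \<mu> t x y \<partial>lebesgue_on {a..b})
    \<le> (a powr - (\<mu> + 1 / 2) + b powr - (\<mu> + 1 / 2)) * x powr (\<mu> + 1 / 2)"
proof -
  let ?p = "bessel_density \<mu> t x"
  define C where "C = (a powr - (\<mu> + 1 / 2) + b powr - (\<mu> + 1 / 2)) * x powr (\<mu> + 1 / 2)"
  have C: "C \<ge> 0" by (simp add: C_def)
  have pi: "integrable lebesgue (\<lambda>y. indicator {0<..} y *\<^sub>R ?p y)" and p1: "(\<integral>y. indicator {0<..} y *\<^sub>R ?p y \<partial>lebesgue) = 1"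
    using integrable_bessel_density[OF \<mu> t x] integral_bessel_density[OF \<mu> t x]
    by (simp_all add: integrable_restrict_space integral_restrict_space)
  have "(\<integral>y. bessel_kernel \<mu> t x y \<partial>lebesgue_on {a..b}) = (\<integral>y. indicator {a..b} y *\<^sub>R bessel_kernel \<mu> t x y \<partial>lebesgue)"
    by (simp add: integral_restrict_space)
  also have "\<dots> \<le> (\<integral>y. C * (indicator {0<..} y *\<^sub>R ?p y) \<partial>lebesgue)"
  proof (rule integral_mono')
    show "integrable lebesgue (\<lambda>y. C * (indicator {0<..} y *\<^sub>R ?p y))" using pi by simp
    fix y :: real
    show "0 \<le> C * (indicator {0<..} y *\<^sub>R ?p y)"
      using C bessel_density_nonneg[OF \<mu> t x, of y] by (auto simp: indicator_def)
    show "indicator {a..b} y *\<^sub>R bessel_kernel \<mu> t x y \<le> C * (indicator {0<..} y *\<^sub>R ?p y)"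
    proof (cases "y \<in> {a..b}")
      case True
      then have y: "y > 0" using a by auto
      have "1 \<le> (a powr - (\<mu> + 1 / 2) + b powr - (\<mu> + 1 / 2)) * y powr (\<mu> + 1 / 2)"
      proof -
        have "y powr - (\<mu> + 1 / 2) \<le> a powr - (\<mu> + 1 / 2) + b powr - (\<mu> + 1 / 2)"
          using True a by (intro powr_le_endpoints) auto
        then have "y powr - (\<mu> + 1 / 2) * y powr (\<mu> + 1 / 2) \<le>
            (a powr - (\<mu> + 1 / 2) + b powr - (\<mu> + 1 / 2)) * y powr (\<mu> + 1 / 2)"
          by (intro mult_right_mono) auto
        then show ?thesis using y by (simp add: powr_add[symmetric])
      qed
      then have "bessel_kernel \<mu> t x y * 1 \<le> bessel_kernel \<mu> t x y *
          ((a powr - (\<mu> + 1 / 2) + b powr - (\<mu> + 1 / 2)) * y powr (\<mu> + 1 / 2))"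
        using bessel_kernel_pos[OF \<mu> t x y] by (intro mult_left_mono) auto
      also have "\<dots> = C * ?p y" using x by (simp add: C_def bessel_density_def)
      finally show ?thesis using True y by simp
    qed (use C bessel_density_nonneg[OF \<mu> t x, of y] in \<open>auto simp: indicator_def\<close>)
  qed
  also have "\<dots> = C" using p1 by simp
  finally show ?thesis by (simp add: C_def)
qed

section \<open>Gaussian upper bound\<close>

text \<open>\<open>V = e\<^sup>-\<^sup>z z\<^sup>1\<^sup>/\<^sup>2 I\<^sub>\<mu>(z)\<close> (up to a constant) and \<open>B = V' + 2 V\<close> satisfy
  \<open>B' = \<kappa> V / z\<^sup>2\<close>. In the coordinates \<open>B\<close>, \<open>D = V - B / 2\<close>, with \<open>B / 2\<close> the slow manifold, the energy
  \<open>L = B\<^sup>2 + D\<^sup>2\<close> satisfies \<open>L' \<le> 2 \<bar>\<kappa>\<bar> L / z\<^sup>2\<close>, and \<open>z\<^sup>-\<^sup>2\<close> is integrable at infinity.\<close>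
lemma bessel_I_upper_bound:
  assumes z0: "z0 > 0"
  shows "\<exists>C>0. \<forall>z\<ge>z0. sqrt z * bessel_I \<mu> z \<le> C * exp z"
proof -
  define \<alpha> where "\<alpha> = \<mu> + 1 / 2"
  define \<kappa> where "\<kappa> = \<alpha>\<^sup>2 - \<alpha>"
  define E where "E z = exp (- z) * z powr \<alpha>" for z :: real
  define H where "H \<nu> z = bessel_series \<nu> (z\<^sup>2 / 4)" for \<nu> z :: real
  define V where "V z = E z * H \<mu> z" for z
  define B where "B z = E z * ((\<alpha> / z + 1) * H \<mu> z + z / 2 * H (\<mu> + 1) z)" for z
  define D where "D z = V z - B z / 2" for z
  define L where "L z = (B z)\<^sup>2 + (D z)\<^sup>2" for z
  \<comment> \<open>The exponent is 2 |\<kappa>| times the integral of z^-2 from z to infinity; this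
    integrating factor turns the differential inequality for L into monotonicity of m.\<close>
  define m where "m z = L z * exp (2 * \<bar>\<kappa>\<bar> / z)" for z
  have E': "(E has_real_derivative E z * (\<alpha> / z - 1)) (at z)" if "z > 0" for z
  proof -
    have "z powr (\<alpha> - 1) = z powr \<alpha> / z" using that by (simp add: powr_diff)
    then show ?thesis unfolding E_def
      by (auto intro!: derivative_eq_intros has_real_derivative_powr that simp: right_diff_distrib mult_ac)
  qed
  have H': "(H \<nu> has_real_derivative H (\<nu> + 1) z * (z / 2)) (at z)" for \<nu> z
    unfolding H_def by (rule DERIV_chain2[OF bessel_series_has_derivative])
      (auto intro!: derivative_eq_intros)
  have ode: "z\<^sup>2 / 4 * H (\<mu> + 2) z + (\<mu> + 1) * H (\<mu> + 1) z = H \<mu> z" for z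
    unfolding H_def by (rule bessel_series_ode)
  have V': "(V has_real_derivative B z - 2 * V z) (at z)" if z: "z > 0" for z
    unfolding V_def B_def by (rule DERIV_cong[OF DERIV_mult[OF E'[OF z] H']]) (simp add: algebra_simps)
  have B': "(B has_real_derivative \<kappa> * V z / z\<^sup>2) (at z)" if z: "z > 0" for z
  proof -
    have r: "((\<lambda>z. \<alpha> / z + 1) has_real_derivative - \<alpha> / z\<^sup>2) (at z)"
      using z by (auto intro!: derivative_eq_intros simp: power2_eq_square)
    have h: "((\<lambda>z. z / 2) has_real_derivative 1 / 2) (at z)"
      by (auto intro!: derivative_eq_intros)
    have "(B has_real_derivative E z * (\<alpha> / z - 1) * ((\<alpha> / z + 1) * H \<mu> z + z / 2 * H (\<mu> + 1) z)
       + (- \<alpha> / z\<^sup>2 * H \<mu> z + H (\<mu> + 1) z * (z / 2) * (\<alpha> / z + 1)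
        + (1 / 2 * H (\<mu> + 1) z + H (\<mu> + 1 + 1) z * (z / 2) * (z / 2))) * E z) (at z)"
      unfolding B_def by (rule DERIV_mult[OF E'[OF z] DERIV_add[OF DERIV_mult[OF r H'] DERIV_mult[OF h H']]])
    note B1 = this
    have alg: "(\<alpha> / z - 1) * ((\<alpha> / z + 1) * h0 + z / 2 * h1)
       + (- \<alpha> / z\<^sup>2 * h0 + h1 * (z / 2) * (\<alpha> / z + 1) + (1 / 2 * h1 + h2 * (z / 2) * (z / 2)))
       = \<kappa> / z\<^sup>2 * h0" if "z\<^sup>2 / 4 * h2 + (\<mu> + 1) * h1 = h0" for h0 h1 h2
    proof -
      have e: "h2 * (z / 2) * (z / 2) = h0 - (\<alpha> + 1 / 2) * h1"
        using that by (simp add: \<alpha>_def power2_eq_square field_simps)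
      have "(\<alpha> / z - 1) * ((\<alpha> / z + 1) * h0 + z / 2 * h1) = (\<alpha>\<^sup>2 / z\<^sup>2 - 1) * h0 + (\<alpha> / 2 - z / 2) * h1"
        using z by (simp add: field_simps power2_eq_square)
      moreover have "h1 * (z / 2) * (\<alpha> / z + 1) = (\<alpha> / 2 + z / 2) * h1"
        using z by (simp add: field_simps)
      ultimately show ?thesis unfolding e
        by (simp add: \<kappa>_def algebra_simps diff_divide_distrib)
    qed
    have "e * a * b + c * e = \<kappa> * (e * h) / z\<^sup>2" if "a * b + c = \<kappa> / z\<^sup>2 * h" for e a b c h
    proof -
      have "e * a * b + c * e = e * (a * b + c)" by (simp add: algebra_simps)
      then show ?thesis unfolding that by simp
    qed
    from this[OF alg[OF ode]] show ?thesis
      using B1 unfolding V_def by (simp add: add.assoc)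
  qed
  have m': "\<exists>d. (m has_real_derivative d) (at z) \<and> d \<le> 0" if z: "z > 0" for z
  proof -
    have D': "(D has_real_derivative (B z - 2 * V z) - \<kappa> * V z / z\<^sup>2 / 2) (at z)"
      unfolding D_def by (intro DERIV_diff DERIV_cdivide V' B' z)
    define \<epsilon> where "\<epsilon> = \<kappa> / z\<^sup>2"
    have VD: "V z = D z + B z / 2" by (simp add: D_def)
    define L' where "L' = 2 * B z * (\<kappa> * V z / z\<^sup>2) + 2 * D z * ((B z - 2 * V z) - \<kappa> * V z / z\<^sup>2 / 2)"
    have L': "(L has_real_derivative L') (at z)"
      unfolding L_def L'_def by (auto intro!: derivative_eq_intros D' B' z)
    have x: "((\<lambda>z. exp (2 * \<bar>\<kappa>\<bar> / z)) has_real_derivative exp (2 * \<bar>\<kappa>\<bar> / z) * (- 2 * \<bar>\<epsilon>\<bar>)) (at z)"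
      using z by (auto intro!: derivative_eq_intros simp: \<epsilon>_def power2_eq_square)
    \<comment> \<open>Since B - 2 V = -2 D, the fast coordinate D is damped; this produces -4 D^2,
      which has the good sign and is dropped.\<close>
    have "L' = \<epsilon> * (3 / 2 * B z * D z + (B z)\<^sup>2 - (D z)\<^sup>2) - 4 * (D z)\<^sup>2"
      unfolding L'_def VD by (simp add: \<epsilon>_def power2_eq_square algebra_simps add_divide_distrib diff_divide_distrib)
    also have "\<dots> \<le> \<bar>\<epsilon>\<bar> * (2 * L z)"
    proof -
      have "\<bar>3 / 2 * B z * D z + (B z)\<^sup>2 - (D z)\<^sup>2\<bar> \<le> 2 * L z"
      proof -
        have "0 \<le> (B z - D z)\<^sup>2" "0 \<le> (B z + D z)\<^sup>2" by auto
        then have "B z * D z \<le> ((B z)\<^sup>2 + (D z)\<^sup>2) / 2" "- (B z * D z) \<le> ((B z)\<^sup>2 + (D z)\<^sup>2) / 2"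
          by (simp_all add: power2_diff power2_sum)
        moreover have "\<bar>3 / 2 * p + q - r\<bar> \<le> 2 * (q + r)"
          if "p \<le> (q + r) / 2" "- p \<le> (q + r) / 2" "0 \<le> q" "0 \<le> r" for p q r :: real
          using that by (simp add: abs_le_iff field_simps)
        ultimately show ?thesis unfolding L_def mult.assoc by simp
      qed
      then have "\<bar>\<epsilon>\<bar> * \<bar>3 / 2 * B z * D z + (B z)\<^sup>2 - (D z)\<^sup>2\<bar> \<le> \<bar>\<epsilon>\<bar> * (2 * L z)"
        by (intro mult_left_mono) auto
      moreover have "\<epsilon> * (3 / 2 * B z * D z + (B z)\<^sup>2 - (D z)\<^sup>2) \<le> \<bar>\<epsilon> * (3 / 2 * B z * D z + (B z)\<^sup>2 - (D z)\<^sup>2)\<bar>"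
        by (rule abs_ge_self)
      moreover have "0 \<le> (D z)\<^sup>2" by simp
      moreover have "X - 4 * d \<le> W" if "Y \<le> W" "X \<le> Y" "0 \<le> d" for X Y W d :: real
        using that by linarith
      ultimately show ?thesis unfolding abs_mult by blast
    qed
    finally have "(L' - 2 * \<bar>\<epsilon>\<bar> * L z) * exp (2 * \<bar>\<kappa>\<bar> / z) \<le> 0"
      by (intro mult_nonpos_nonneg) auto
    moreover have "(m has_real_derivative (L' - 2 * \<bar>\<epsilon>\<bar> * L z) * exp (2 * \<bar>\<kappa>\<bar> / z)) (at z)"
      unfolding m_def by (rule DERIV_cong[OF DERIV_mult[OF L' x]]) (simp add: algebra_simps)
    ultimately show ?thesis by blast
  qed
  \<comment> \<open>The square root bounds V, by V^2 \<le> 2 L \<le> 2 m(z0); the power of 2 comes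
    from (z/2)^\<mu>, and the summand 1 makes C positive.\<close>
  define C where "C = 2 powr - \<mu> * sqrt (2 * m z0) + 1"
  have "sqrt z * bessel_I \<mu> z \<le> C * exp z" if z: "z \<ge> z0" for z
  proof -
    have "m z \<le> m z0"
      by (rule DERIV_nonpos_imp_nonincreasing[OF z]) (use m' z0 in force)
    moreover have "L z * 1 \<le> m z"
      unfolding m_def using z z0 by (intro mult_left_mono) (auto simp: L_def)
    moreover have "(V z)\<^sup>2 \<le> 2 * L z"
    proof -
      have "2 * (b\<^sup>2 + d\<^sup>2) - (d + b / 2)\<^sup>2 = (d - b / 2)\<^sup>2 + 3 / 2 * b\<^sup>2" for b d :: real
        by (simp add: power2_eq_square field_simps)
      moreover have "0 \<le> (d - b / 2)\<^sup>2 + 3 / 2 * b\<^sup>2" for b d :: real by simp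
      ultimately have "(d + b / 2)\<^sup>2 \<le> 2 * (b\<^sup>2 + d\<^sup>2)" for b d :: real
        by (metis diff_ge_0_iff_ge)
      from this[of "D z" "B z"] show ?thesis by (simp add: L_def D_def)
    qed
    ultimately have "(V z)\<^sup>2 \<le> 2 * m z0" by linarith
    then have V: "V z \<le> sqrt (2 * m z0)" by (rule real_le_rsqrt)
    have "sqrt z * bessel_I \<mu> z = 2 powr - \<mu> * V z * exp z"
    proof -
      have "z powr \<alpha> = z powr \<mu> * sqrt z" using z z0 by (simp add: \<alpha>_def powr_add powr_half_sqrt)
      then show ?thesis
        using z z0 by (simp add: bessel_I_eq V_def H_def E_def powr_divide powr_minus exp_minus field_simps)
    qed
    also have "\<dots> \<le> 2 powr - \<mu> * sqrt (2 * m z0) * exp z"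
      using V by (intro mult_right_mono mult_left_mono) auto
    also have "\<dots> \<le> C * exp z" unfolding C_def by (simp add: distrib_right)
    finally show ?thesis .
  qed
  moreover have "C > 0"
  proof -
    have "L z0 \<ge> 0" by (simp add: L_def)
    then have "m z0 \<ge> 0" by (simp add: m_def)
    then show ?thesis by (simp add: C_def add_nonneg_pos)
  qed
  ultimately show ?thesis by blast
qed

text \<open>For t \<le> 1 and y \<ge> a the Bessel argument stays above xa / 2, where
  \<open>bessel_I_upper_bound\<close> applies; its exponential completes the square in the Gaussian
  factor. The constant depends on x.\<close>

lemma bessel_kernel_gaussian_bound:
  assumes x: "x > 0" and a: "a > 0"
  shows "\<exists>C>0. \<forall>t y. 0 < t \<and> t \<le> 1 \<and> a \<le> y \<longrightarrow>
    bessel_kernel \<mu> t x y \<le> C / sqrt t * exp (- (x - y)\<^sup>2 / (4 * t))"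
proof -
  obtain C where C: "C > 0" "\<And>z. z \<ge> x * a / 2 \<Longrightarrow> sqrt z * bessel_I \<mu> z \<le> C * exp z"
    using bessel_I_upper_bound[of "x * a / 2" \<mu>] x a by auto
  have "bessel_kernel \<mu> t x y \<le> C / sqrt t * exp (- (x - y)\<^sup>2 / (4 * t))" if t: "0 < t" "t \<le> 1" and y: "a \<le> y" for t y
  proof -
    define z where "z = x * y / (2 * t)"
    have "x * a / 2 \<le> z"
    proof -
      have "x * a * t \<le> x * y * 1" using t x a y by (intro mult_mono) auto
      then show ?thesis using t by (simp add: z_def field_simps)
    qed
    note zb = C(2)[OF this]
    have "sqrt (x * y) = sqrt (2 * t) * sqrt z"
      using t by (simp add: z_def real_sqrt_mult[symmetric])
    moreover have "sqrt (2 * t) / (2 * t) = 1 / sqrt (2 * t)"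
      using t by (simp add: real_div_sqrt field_simps)
    ultimately have "sqrt (x * y) / (2 * t) = 1 / sqrt (2 * t) * sqrt z"
      by (metis mult.commute times_divide_eq_right)
    then have "bessel_kernel \<mu> t x y = 1 / sqrt (2 * t) * (sqrt z * bessel_I \<mu> z) * exp (- (x\<^sup>2 + y\<^sup>2) / (4 * t))"
      unfolding bessel_kernel_def z_def[symmetric] by (simp only: mult.assoc)
    also have "\<dots> \<le> 1 / sqrt t * (C * exp z) * exp (- (x\<^sup>2 + y\<^sup>2) / (4 * t))"
    proof (rule mult_right_mono)
      have "1 / sqrt (2 * t) \<le> 1 / sqrt t" using t by (intro divide_left_mono) auto
      then have "1 / sqrt (2 * t) * (sqrt z * bessel_I \<mu> z) \<le> 1 / sqrt (2 * t) * (C * exp z)"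
          "1 / sqrt (2 * t) * (C * exp z) \<le> 1 / sqrt t * (C * exp z)"
        using zb C(1) t by (auto intro!: mult_left_mono mult_right_mono simp del: times_divide_eq_left)
      then show "1 / sqrt (2 * t) * (sqrt z * bessel_I \<mu> z) \<le> 1 / sqrt t * (C * exp z)" by linarith
    qed simp
    also have "\<dots> = C / sqrt t * exp (z - (x\<^sup>2 + y\<^sup>2) / (4 * t))"
    proof -
      have "exp z * exp (- S / q) = exp (z - S / q)" for S q :: real by (simp add: mult_exp_exp)
      then show ?thesis by (simp only: mult.assoc) simp
    qed
    also have "z - (x\<^sup>2 + y\<^sup>2) / (4 * t) = - (x - y)\<^sup>2 / (4 * t)"
      using t by (simp add: z_def power2_diff field_simps)
    finally show ?thesis .
  qed
  with C(1) show ?thesis by blast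
qed

text \<open>The Gaussian is dominated by a sum of indicators of growing intervals around x: with s =
  |y - x| / sqrt t, the inequality -s^2 / 4 \<le> 1 - s gives weight e^(1 - k) to radius (k + 1)
  sqrt t. The sum of (k + 1) e^-k is 1 / (1 - e^-1)^2.\<close>

lemma nn_integral_gaussian_average_le:
  fixes G :: "real \<Rightarrow> real"
  assumes t: "t > 0" and G: "G \<in> borel_measurable lebesgue" "\<And>y. 0 \<le> G y" and \<epsilon>: "\<epsilon> \<ge> 0" and d: "\<delta> > 0"
    and avg: "\<And>r. 0 < r \<Longrightarrow> r \<le> \<delta> \<Longrightarrow> (\<integral>\<^sup>+y. ennreal (G y) * indicator {x - r..x + r} y \<partial>lebesgue) \<le> ennreal (\<epsilon> * r)"
  shows "(\<integral>\<^sup>+y. ennreal (exp (- (x - y)\<^sup>2 / (4 * t)) * G y) * indicator {y. \<bar>y - x\<bar> < \<delta>} y \<partial>lebesgue)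
    \<le> ennreal (exp 1 / (1 - exp (-1))\<^sup>2 * \<epsilon> * sqrt t)"
proof -
  \<comment> \<open>The radii are capped at \<delta> because the averages are controlled only up to
    there; the points to be covered lie within \<delta> of x anyway.\<close>
  define r where "r k = min ((real k + 1) * sqrt t) \<delta>" for k :: nat
  define c :: "nat \<Rightarrow> real" where "c k = exp 1 * exp (-1) ^ k" for k
  have r: "0 < r k" "r k \<le> \<delta>" "r k \<le> (real k + 1) * sqrt t" for k
    using t d by (auto simp: r_def)
  have c: "c k \<ge> 0" for k by (simp add: c_def)
  have Gm [measurable]: "(\<lambda>y. ennreal (G y) * indicator {x - r k..x + r k} y) \<in> borel_measurable lebesgue" for k
    using G(1) by (intro borel_measurable_times_ennreal measurable_compose[OF G(1)] borel_measurable_indicator) auto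
  have "(\<integral>\<^sup>+y. ennreal (exp (- (x - y)\<^sup>2 / (4 * t)) * G y) * indicator {y. \<bar>y - x\<bar> < \<delta>} y \<partial>lebesgue)
    \<le> (\<integral>\<^sup>+y. (\<Sum>k. ennreal (c k) * (ennreal (G y) * indicator {x - r k..x + r k} y)) \<partial>lebesgue)"
  proof (rule nn_integral_mono)
    fix y :: real
    show "ennreal (exp (- (x - y)\<^sup>2 / (4 * t)) * G y) * indicator {y. \<bar>y - x\<bar> < \<delta>} y
      \<le> (\<Sum>k. ennreal (c k) * (ennreal (G y) * indicator {x - r k..x + r k} y))"
    proof (cases "\<bar>y - x\<bar> < \<delta>")
      case True
      define s where "s = \<bar>y - x\<bar> / sqrt t"
      define k where "k = nat \<lfloor>s\<rfloor>"
      have s: "0 \<le> s" "real k \<le> s" "s < real k + 1" using t by (auto simp: s_def k_def)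
      have "\<bar>y - x\<bar> = s * sqrt t" using t by (simp add: s_def)
      also have "\<dots> \<le> (real k + 1) * sqrt t" using s t by (intro mult_right_mono) auto
      finally have "\<bar>y - x\<bar> \<le> r k" using True by (simp add: r_def)
      then have y: "y \<in> {x - r k..x + r k}" by auto
      have "(x - y)\<^sup>2 / (4 * t) = s\<^sup>2 / 4" using t by (simp add: s_def power_divide power2_commute)
      moreover have "- (s\<^sup>2 / 4) \<le> 1 - s"
      proof -
        have "0 \<le> (s - 2)\<^sup>2" by simp
        then show ?thesis by (simp add: power2_eq_square algebra_simps)
      qed
      ultimately have "- (x - y)\<^sup>2 / (4 * t) \<le> 1 - real k" using s by simp
      then have "exp (- (x - y)\<^sup>2 / (4 * t)) \<le> exp (1 - real k)" by simp
      also have "exp (1 - real k) = c k"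
        by (simp add: c_def exp_of_nat_mult[symmetric] exp_add[symmetric])
      finally have "ennreal (exp (- (x - y)\<^sup>2 / (4 * t)) * G y) \<le> ennreal (c k * G y)"
        using G(2) by (intro ennreal_leI mult_right_mono)
      also have "\<dots> = ennreal (c k) * (ennreal (G y) * indicator {x - r k..x + r k} y)"
        using y c by (simp add: ennreal_mult')
      also have "\<dots> = (\<Sum>k\<in>{k}. ennreal (c k) * (ennreal (G y) * indicator {x - r k..x + r k} y))" by simp
      also have "\<dots> \<le> (\<Sum>k. ennreal (c k) * (ennreal (G y) * indicator {x - r k..x + r k} y))"
        by (rule sum_le_suminf) auto
      finally show ?thesis using True by simp
    qed simp
  qed
  also have "\<dots> = (\<Sum>k. \<integral>\<^sup>+y. ennreal (c k) * (ennreal (G y) * indicator {x - r k..x + r k} y) \<partial>lebesgue)"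
    by (intro nn_integral_suminf) measurable
  also have "\<dots> = (\<Sum>k. ennreal (c k) * (\<integral>\<^sup>+y. ennreal (G y) * indicator {x - r k..x + r k} y \<partial>lebesgue))"
    by (intro suminf_cong nn_integral_cmult) measurable
  also have "\<dots> \<le> (\<Sum>k. ennreal (exp 1 * \<epsilon> * sqrt t * (real (Suc k) * exp (-1) ^ k)))"
  proof (intro suminf_le summableI)
    fix k
    have "ennreal (c k) * (\<integral>\<^sup>+y. ennreal (G y) * indicator {x - r k..x + r k} y \<partial>lebesgue) \<le> ennreal (c k) * ennreal (\<epsilon> * r k)"
      using r by (intro mult_left_mono avg) auto
    also have "\<dots> = ennreal (c k * (\<epsilon> * r k))" using c by (intro ennreal_mult'[symmetric])
    also have "\<dots> \<le> ennreal (c k * (\<epsilon> * ((real k + 1) * sqrt t)))"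
      using c \<epsilon> r by (intro ennreal_leI mult_left_mono) auto
    also have "c k * (\<epsilon> * ((real k + 1) * sqrt t)) = exp 1 * \<epsilon> * sqrt t * (real (Suc k) * exp (-1) ^ k)"
      by (simp add: c_def)
    finally show "ennreal (c k) * (\<integral>\<^sup>+y. ennreal (G y) * indicator {x - r k..x + r k} y \<partial>lebesgue)
      \<le> ennreal (exp 1 * \<epsilon> * sqrt t * (real (Suc k) * exp (-1) ^ k))" .
  qed
  also have "\<dots> = ennreal (exp 1 / (1 - exp (-1))\<^sup>2 * \<epsilon> * sqrt t)"
  proof -
    have "(\<lambda>k. exp 1 * \<epsilon> * sqrt t * (real (Suc k) * exp (-1) ^ k)) sums (exp 1 * \<epsilon> * sqrt t * (1 / (1 - exp (-1))\<^sup>2))"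
      using geometric_deriv_sums[of "exp (-1) :: real"] by (intro sums_mult) simp
    then have "(\<lambda>k. ennreal (exp 1 * \<epsilon> * sqrt t * (real (Suc k) * exp (-1) ^ k))) sums ennreal (exp 1 * \<epsilon> * sqrt t * (1 / (1 - exp (-1))\<^sup>2))"
      using \<epsilon> t by (subst sums_ennreal) auto
    then show ?thesis by (simp add: sums_iff)
  qed
  finally show ?thesis .
qed

text \<open>Near x the density is at most A C / sqrt t times a Gaussian, where A bounds the quotient
  of weights on [x/2, 2x]. The Gaussian average of |\<psi> - \<psi> x| is of order \<epsilon> sqrt
  t, so the powers of t cancel.\<close>

lemma bessel_density_tendsto_lebesgue_point:
  assumes \<mu>: "\<mu> > -1" and x: "x > 0" and int: "integrable lebesgue \<psi>"
    and bound: "AE y in lebesgue_on {0<..}. \<bar>\<psi> y\<bar> \<le> M"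
    and leb: "\<And>\<epsilon>. \<epsilon> > 0 \<Longrightarrow> \<exists>\<delta>>0. \<forall>r. 0 < r \<and> r < \<delta> \<longrightarrow> integral {x - r..x + r} (\<lambda>y. \<bar>\<psi> y - \<psi> x\<bar>) \<le> \<epsilon> * r"
  shows "((\<lambda>t. \<integral>y. bessel_density \<mu> t x y * \<psi> y \<partial>lebesgue_on {0<..}) \<longlongrightarrow> \<psi> x) (at_right 0)"
proof (rule bessel_density_approximate_identity[OF \<mu> x _ bound])
  show "\<psi> \<in> borel_measurable (lebesgue_on {0<..})"
    using int by (intro measurable_restrict_space1) auto
  fix e :: real assume e: "e > 0"
  obtain C where C: "C > 0" "\<And>t y. 0 < t \<Longrightarrow> t \<le> 1 \<Longrightarrow> x / 2 \<le> y \<Longrightarrow>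
    bessel_kernel \<mu> t x y \<le> C / sqrt t * exp (- (x - y)\<^sup>2 / (4 * t))"
    using bessel_kernel_gaussian_bound[OF x, of "x / 2" \<mu>] x by auto
  define A where "A = ((x / 2) powr (\<mu> + 1 / 2) + (2 * x) powr (\<mu> + 1 / 2)) / x powr (\<mu> + 1 / 2)"
  have A: "A > 0" using x by (simp add: A_def add_pos_pos)
  define K :: real where "K = exp 1 / (1 - exp (-1))\<^sup>2"
  have K: "K > 0" by (simp add: K_def)
  \<comment> \<open>Chosen to absorb the three constants of the final estimate.\<close>
  define \<epsilon> where "\<epsilon> = e / (A * C * K)"
  have \<epsilon>: "\<epsilon> > 0" "A * C * K * \<epsilon> = e" using e A C K by (auto simp: \<epsilon>_def)
  obtain \<delta>' where d': "\<delta>' > 0" "\<And>r. 0 < r \<and> r < \<delta>' \<Longrightarrow> integral {x - r..x + r} (\<lambda>y. \<bar>\<psi> y - \<psi> x\<bar>) \<le> \<epsilon> * r"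
    using leb[OF \<epsilon>(1)] by blast
  define \<delta> where "\<delta> = min (x / 2) (\<delta>' / 2)"
  have d: "\<delta> > 0" "\<delta> \<le> x / 2" "\<delta> < \<delta>'" using x d' by (auto simp: \<delta>_def)
  define G where "G y = \<bar>\<psi> y - \<psi> x\<bar>" for y
  have Gm [measurable]: "G \<in> borel_measurable lebesgue" unfolding G_def using int by measurable
  have avg: "(\<integral>\<^sup>+y. ennreal (G y) * indicator {x - r..x + r} y \<partial>lebesgue) \<le> ennreal (\<epsilon> * r)"
    if "0 < r" "r \<le> \<delta>" for r
  proof -
    have "(\<lambda>y. G y) integrable_on {x - r..x + r}"
      unfolding G_def by (rule integrable_on_abs_diff_const[OF int])
    then have "(G has_integral integral {x - r..x + r} G) {x - r..x + r}" by (rule integrable_integral)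
    then have "(\<integral>\<^sup>+y. ennreal (G y) * indicator {x - r..x + r} y \<partial>lborel) = ennreal (integral {x - r..x + r} G)"
      by (rule nn_integral_has_integral_lebesgue'[rotated]) (auto simp: G_def)
    then show ?thesis
      using d'(2)[of r] that d by (simp add: nn_integral_completion G_def[abs_def] ennreal_leI)
  qed
  have "(\<integral>y. indicator {y. \<bar>y - x\<bar> < \<delta>} y * (bessel_density \<mu> t x y * \<bar>\<psi> y - \<psi> x\<bar>) \<partial>lebesgue_on {0<..}) \<le> e"
    if t: "0 < t" "t < 1" for t
  proof (rule integral_real_bounded)
    have "(\<integral>\<^sup>+y. ennreal (indicator {y. \<bar>y - x\<bar> < \<delta>} y * (bessel_density \<mu> t x y * \<bar>\<psi> y - \<psi> x\<bar>)) \<partial>lebesgue_on {0<..})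
      = (\<integral>\<^sup>+y. ennreal (indicator {y. \<bar>y - x\<bar> < \<delta>} y * (bessel_density \<mu> t x y * \<bar>\<psi> y - \<psi> x\<bar>)) * indicator {0<..} y \<partial>lebesgue)"
      by (simp add: nn_integral_restrict_space)
    also have "\<dots> \<le> (\<integral>\<^sup>+y. ennreal (A * C / sqrt t) * (ennreal (exp (- (x - y)\<^sup>2 / (4 * t)) * G y) * indicator {y. \<bar>y - x\<bar> < \<delta>} y) \<partial>lebesgue)"
    proof (rule nn_integral_mono)
      fix y :: real
      show "ennreal (indicator {y. \<bar>y - x\<bar> < \<delta>} y * (bessel_density \<mu> t x y * \<bar>\<psi> y - \<psi> x\<bar>)) * indicator {0<..} y
        \<le> ennreal (A * C / sqrt t) * (ennreal (exp (- (x - y)\<^sup>2 / (4 * t)) * G y) * indicator {y. \<bar>y - x\<bar> < \<delta>} y)"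
      proof (cases "\<bar>y - x\<bar> < \<delta>")
        case True
        then have y: "x / 2 \<le> y" "y \<le> 2 * x" using d by auto
        have "bessel_density \<mu> t x y \<le> (C / sqrt t * exp (- (x - y)\<^sup>2 / (4 * t))) * A"
          unfolding bessel_density_def
        proof (rule mult_mono)
          show "y powr (\<mu> + 1 / 2) / x powr (\<mu> + 1 / 2) \<le> A"
            unfolding A_def using x y by (intro divide_right_mono powr_le_endpoints) auto
        qed (use C t y x in auto)
        then have "bessel_density \<mu> t x y * G y \<le> A * C / sqrt t * (exp (- (x - y)\<^sup>2 / (4 * t)) * G y)"
        proof -
          assume "bessel_density \<mu> t x y \<le> (C / sqrt t * exp (- (x - y)\<^sup>2 / (4 * t))) * A"
          then have "bessel_density \<mu> t x y * G y \<le> (C / sqrt t * exp (- (x - y)\<^sup>2 / (4 * t))) * A * G y"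
            by (rule mult_right_mono) (simp add: G_def)
          then show ?thesis by (simp only: mult_ac times_divide_eq_left times_divide_eq_right)
        qed
        then have "ennreal (bessel_density \<mu> t x y * G y) \<le> ennreal (A * C / sqrt t) * ennreal (exp (- (x - y)\<^sup>2 / (4 * t)) * G y)"
          using A C t by (subst ennreal_mult'[symmetric]) (auto intro: ennreal_leI)
        then show ?thesis using True y x by (simp add: G_def)
      qed simp
    qed
    also have "\<dots> = ennreal (A * C / sqrt t) * (\<integral>\<^sup>+y. ennreal (exp (- (x - y)\<^sup>2 / (4 * t)) * G y) * indicator {y. \<bar>y - x\<bar> < \<delta>} y \<partial>lebesgue)"
    proof (rule nn_integral_cmult)
      have "(\<lambda>y. exp (- (x - y)\<^sup>2 / (4 * t))) \<in> borel_measurable lebesgue"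
        by (intro measurable_completion) simp
      moreover have "{y. \<bar>y - x\<bar> < \<delta>} \<in> sets lebesgue"
        by (intro sets_completionI_sets) simp
      ultimately show "(\<lambda>y. ennreal (exp (- (x - y)\<^sup>2 / (4 * t)) * G y) * indicator {y. \<bar>y - x\<bar> < \<delta>} y)
          \<in> borel_measurable lebesgue"
        by measurable
    qed
    also have "\<dots> \<le> ennreal (A * C / sqrt t) * ennreal (K * \<epsilon> * sqrt t)"
      unfolding K_def using t \<epsilon> d avg
      by (intro mult_left_mono nn_integral_gaussian_average_le Gm) (auto simp: G_def)
    also have "\<dots> = ennreal (A * C / sqrt t * (K * \<epsilon> * sqrt t))"
      using A C t by (intro ennreal_mult'[symmetric]) auto
    also have "A * C / sqrt t * (K * \<epsilon> * sqrt t) = e" using \<epsilon>(2) t by (simp add: field_simps)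
    finally show "(\<integral>\<^sup>+y. ennreal (indicator {y. \<bar>y - x\<bar> < \<delta>} y * (bessel_density \<mu> t x y * \<bar>\<psi> y - \<psi> x\<bar>)) \<partial>lebesgue_on {0<..}) \<le> ennreal e" .
  qed (use e in simp)
  then have "eventually (\<lambda>t. (\<integral>y. indicator {y. \<bar>y - x\<bar> < \<delta>} y * (bessel_density \<mu> t x y * \<bar>\<psi> y - \<psi> x\<bar>) \<partial>lebesgue_on {0<..}) \<le> e) (at_right 0)"
    using eventually_mono[OF eventually_at_right_real[of 0 "1::real"]] by auto
  then show "\<exists>\<delta>>0. eventually (\<lambda>t. (\<integral>y. indicator {y. \<bar>y - x\<bar> < \<delta>} y * (bessel_density \<mu> t x y * \<bar>\<psi> y - \<psi> x\<bar>) \<partial>lebesgue_on {0<..}) \<le> e) (at_right 0)"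
    using d(1) by blast
qed

section \<open>Initial values\<close>

text \<open>Moves the weight onto the data, so that convergence results for the density carry over
  to the kernel; data supported away from 0 and infinity stay bounded after division by the
  weight.\<close>

lemma bessel_kernel_eq_density:
  assumes "x > 0" "y > 0"
  shows "bessel_kernel \<mu> t x y * g
    = x powr (\<mu> + 1 / 2) * (bessel_density \<mu> t x y * (g * y powr - (\<mu> + 1 / 2)))"
proof -
  have "y powr (\<mu> + 1 / 2) * y powr - (\<mu> + 1 / 2) = 1"
    using assms by (simp add: powr_add[symmetric])
  then have "x powr (\<mu> + 1 / 2) * (w * (y powr (\<mu> + 1 / 2) / x powr (\<mu> + 1 / 2)) * (g * y powr - (\<mu> + 1 / 2))) = w * g" for w
    using assms by (simp add: field_simps)
  then show ?thesis unfolding bessel_density_def by simp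
qed

lemma set_integral_bessel_kernel_eq_density:
  assumes "x > 0"
  shows "(LINT y:{0<..}|lebesgue. bessel_kernel \<mu> t x y * g y)
    = x powr (\<mu> + 1 / 2) * (\<integral>y. bessel_density \<mu> t x y * (g y * y powr - (\<mu> + 1 / 2)) \<partial>lebesgue_on {0<..})"
proof -
  have "(LINT y:{0<..}|lebesgue. bessel_kernel \<mu> t x y * g y)
      = (\<integral>y. bessel_kernel \<mu> t x y * g y \<partial>lebesgue_on {0<..})"
    by (simp add: set_lebesgue_integral_def integral_restrict_space)
  also have "\<dots> = (\<integral>y. x powr (\<mu> + 1 / 2) * (bessel_density \<mu> t x y * (g y * y powr - (\<mu> + 1 / 2))) \<partial>lebesgue_on {0<..})"
    using assms by (intro Bochner_Integration.integral_cong refl bessel_kernel_eq_density) auto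
  finally show ?thesis by simp
qed

lemma measurable_powr_lebesgue_on:
  "(\<lambda>y::real. y powr \<beta>) \<in> borel_measurable (lebesgue_on {0<..})"
  by (intro continuous_imp_measurable_on_sets_lebesgue continuous_intros) auto

lemma AE_bound_mult_powr:
  fixes g :: "real \<Rightarrow> real"
  assumes "0 < a" and g: "AE y in lebesgue_on {0<..}. \<bar>g y\<bar> \<le> C \<and> (y \<notin> {a..b} \<longrightarrow> g y = 0)"
  shows "AE y in lebesgue_on {0<..}. \<bar>g y * y powr \<beta>\<bar> \<le> \<bar>C\<bar> * (a powr \<beta> + b powr \<beta>)
     \<and> (y \<notin> {a..b} \<longrightarrow> g y * y powr \<beta> = 0)"
  using g
proof eventually_elim
  case (elim y)
  show ?case
  proof (cases "y \<in> {a..b}")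
    case True
    have "\<bar>g y\<bar> * y powr \<beta> \<le> \<bar>C\<bar> * (a powr \<beta> + b powr \<beta>)"
      using elim True assms(1) by (intro mult_mono powr_le_endpoints) auto
    then show ?thesis using True by (simp add: abs_mult)
  qed (use elim in simp)
qed

text \<open>The data depend on t so that the lemma serves both for \<open>g\<close> at its
  continuity points and for the source at the shifted time t - \<tau>.\<close>

lemma bessel_kernel_tendsto_of_continuity:
  fixes \<phi> :: "real \<Rightarrow> real \<Rightarrow> real"
  assumes \<mu>: "\<mu> > -1" and x: "x > 0" and a: "0 < a"
    and meas: "\<And>t. t > 0 \<Longrightarrow> \<phi> t \<in> borel_measurable (lebesgue_on {0<..})"
    and bound: "\<And>t. t > 0 \<Longrightarrow> AE y in lebesgue_on {0<..}. \<bar>\<phi> t y\<bar> \<le> C \<and> (y \<notin> {a..b} \<longrightarrow> \<phi> t y = 0)"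
    and near: "\<And>\<epsilon>. \<epsilon> > 0 \<Longrightarrow> \<exists>\<delta>>0. \<forall>t y. 0 < t \<and> t < \<delta> \<and> \<bar>y - x\<bar> < \<delta> \<longrightarrow> \<bar>\<phi> t y - c\<bar> \<le> \<epsilon>"
  shows "((\<lambda>t. LINT y:{0<..}|lebesgue. bessel_kernel \<mu> t x y * \<phi> t y) \<longlongrightarrow> c) (at_right 0)"
proof -
  define \<beta> where "\<beta> = - (\<mu> + 1 / 2)"
  define L where "L = c * x powr \<beta>"
  have "((\<lambda>t. \<integral>y. bessel_density \<mu> t x y * (\<phi> t y * y powr \<beta>) \<partial>lebesgue_on {0<..}) \<longlongrightarrow> L) (at_right 0)"
  proof (rule bessel_density_approximate_identity[OF \<mu> x])
    show "(\<lambda>y. \<phi> t y * y powr \<beta>) \<in> borel_measurable (lebesgue_on {0<..})" if "t > 0" for t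
      using meas[OF that] measurable_powr_lebesgue_on by (intro borel_measurable_times)
    show "AE y in lebesgue_on {0<..}. \<bar>\<phi> t y * y powr \<beta>\<bar> \<le> \<bar>C\<bar> * (a powr \<beta> + b powr \<beta>)" if "t > 0" for t
      using AE_bound_mult_powr[OF a bound[OF that]] by eventually_elim auto
    fix \<epsilon> :: real assume \<epsilon>: "\<epsilon> > 0"
    define X where "X = x powr \<beta>"
    have X: "X \<ge> 0" by (simp add: X_def)
    \<comment> \<open>The difference is split as (\<phi> - c) y^\<beta> + c (y^\<beta> - x^\<beta>).
      Capping \<open>e2\<close> at 1 bounds y^\<beta> by X + 1; each part then contributes at most
      \<epsilon> / 2.\<close>
    define e1 where "e1 = \<epsilon> / (2 * (X + 1))"
    define e2 where "e2 = min 1 (\<epsilon> / (2 * (\<bar>c\<bar> + 1)))"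
    have e1: "e1 > 0" and e2: "e2 > 0" using \<epsilon> X by (auto simp: e1_def e2_def)
    obtain d1 where d1: "d1 > 0" "\<And>t y. 0 < t \<Longrightarrow> t < d1 \<Longrightarrow> \<bar>y - x\<bar> < d1 \<Longrightarrow> \<bar>\<phi> t y - c\<bar> \<le> e1"
      using near[OF e1] by blast
    have "isCont (\<lambda>y. y powr \<beta>) x" using x by (intro continuous_intros) auto
    then obtain d2 where d2: "d2 > 0" "\<And>y. \<bar>y - x\<bar> < d2 \<Longrightarrow> \<bar>y powr \<beta> - X\<bar> < e2"
      using e2 unfolding continuous_at_eps_delta X_def dist_real_def by blast
    define d where "d = min d1 d2"
    have ptw: "\<bar>\<phi> t y * y powr \<beta> - L\<bar> \<le> \<epsilon>" if "0 < t" "t < d" "\<bar>y - x\<bar> < d" for t y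
    proof -
      have 1: "\<bar>\<phi> t y - c\<bar> \<le> e1" using d1(2) that by (simp add: d_def)
      have 2: "\<bar>y powr \<beta> - X\<bar> < e2" using d2(2) that by (simp add: d_def)
      have "\<phi> t y * y powr \<beta> - L = (\<phi> t y - c) * y powr \<beta> + c * (y powr \<beta> - X)"
        by (simp add: L_def X_def algebra_simps)
      then have "\<bar>\<phi> t y * y powr \<beta> - L\<bar> \<le> \<bar>\<phi> t y - c\<bar> * y powr \<beta> + \<bar>c\<bar> * \<bar>y powr \<beta> - X\<bar>"
        using abs_triangle_ineq[of "(\<phi> t y - c) * y powr \<beta>" "c * (y powr \<beta> - X)"] by (simp add: abs_mult)
      also have "\<dots> \<le> e1 * (X + 1) + (\<bar>c\<bar> + 1) * e2"
        using 1 2 e1 by (intro add_mono mult_mono) (auto simp: e2_def)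
      also have "\<dots> \<le> \<epsilon> / 2 + (\<bar>c\<bar> + 1) * (\<epsilon> / (2 * (\<bar>c\<bar> + 1)))"
      proof -
        have "e1 * (X + 1) = \<epsilon> / 2" using X by (simp add: e1_def field_simps)
        moreover have "(\<bar>c\<bar> + 1) * e2 \<le> (\<bar>c\<bar> + 1) * (\<epsilon> / (2 * (\<bar>c\<bar> + 1)))"
          by (intro mult_left_mono) (auto simp: e2_def)
        ultimately show ?thesis by linarith
      qed
      also have "\<dots> = \<epsilon>" by (simp add: field_simps)
      finally show ?thesis .
    qed
    have "(\<integral>y. indicator {y. \<bar>y - x\<bar> < d} y * (bessel_density \<mu> t x y * \<bar>\<phi> t y * y powr \<beta> - L\<bar>) \<partial>lebesgue_on {0<..}) \<le> \<epsilon>"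
      if t: "0 < t" "t < d" for t
    proof -
      have "(\<integral>y. indicator {y. \<bar>y - x\<bar> < d} y * (bessel_density \<mu> t x y * \<bar>\<phi> t y * y powr \<beta> - L\<bar>) \<partial>lebesgue_on {0<..})
        \<le> (\<integral>y. bessel_density \<mu> t x y * \<epsilon> \<partial>lebesgue_on {0<..})"
      proof (rule integral_mono')
        show "integrable (lebesgue_on {0<..}) (\<lambda>y. bessel_density \<mu> t x y * \<epsilon>)"
          using integrable_bessel_density[OF \<mu> t(1) x] by simp
        fix y assume "y \<in> space (lebesgue_on {0::real<..})"
        then have p: "bessel_density \<mu> t x y \<ge> 0" using bessel_density_nonneg[OF \<mu> t(1) x, of y] by simp
        then show "0 \<le> bessel_density \<mu> t x y * \<epsilon>" using \<epsilon> by simp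
        show "indicator {y. \<bar>y - x\<bar> < d} y * (bessel_density \<mu> t x y * \<bar>\<phi> t y * y powr \<beta> - L\<bar>) \<le> bessel_density \<mu> t x y * \<epsilon>"
          using p \<epsilon> ptw[OF t, of y] mult_left_mono[OF _ p] by (cases "\<bar>y - x\<bar> < d") auto
      qed
      also have "\<dots> = \<epsilon>" using integral_bessel_density[OF \<mu> t(1) x] by simp
      finally show ?thesis .
    qed
    moreover have "d > 0" using d1 d2 by (simp add: d_def)
    ultimately show "\<exists>\<delta>>0. eventually (\<lambda>t. (\<integral>y. indicator {y. \<bar>y - x\<bar> < \<delta>} y *
        (bessel_density \<mu> t x y * \<bar>\<phi> t y * y powr \<beta> - L\<bar>) \<partial>lebesgue_on {0<..}) \<le> \<epsilon>) (at_right 0)"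
      using eventually_mono[OF eventually_at_right_real[of 0 d]] by (intro exI[of _ d]) auto
  qed
  then have "((\<lambda>t. x powr (\<mu> + 1 / 2) * (\<integral>y. bessel_density \<mu> t x y * (\<phi> t y * y powr \<beta>) \<partial>lebesgue_on {0<..}))
      \<longlongrightarrow> x powr (\<mu> + 1 / 2) * L) (at_right 0)"
    by (intro tendsto_mult tendsto_const)
  moreover have "x powr (\<mu> + 1 / 2) * L = c"
    using x by (simp add: L_def \<beta>_def powr_add[symmetric] mult.left_commute)
  ultimately show ?thesis
    unfolding set_integral_bessel_kernel_eq_density[OF x] \<beta>_def by simp
qed

text \<open>The Lebesgue points are those of g divided by the weight, the function that the density
  averages; compact support makes it integrable on the line.\<close>

lemma bessel_kernel_tendsto_AE:
  assumes \<mu>: "\<mu> > -1" and a: "0 < a"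
    and meas: "g \<in> borel_measurable (lebesgue_on {0<..})"
    and g: "AE y in lebesgue_on {0<..}. \<bar>g y\<bar> \<le> C \<and> (y \<notin> {a..b} \<longrightarrow> g y = 0)"
  shows "AE x in lebesgue_on {0<..}. ((\<lambda>t. LINT y:{0<..}|lebesgue. bessel_kernel \<mu> t x y * g y) \<longlongrightarrow> g x) (at_right 0)"
proof -
  define \<beta> where "\<beta> = - (\<mu> + 1 / 2)"
  define D where "D = \<bar>C\<bar> * (a powr \<beta> + b powr \<beta>)"
  define \<psi> where "\<psi> y = indicator {0<..} y *\<^sub>R (g y * y powr \<beta>)" for y
  have gb: "AE y in lebesgue_on {0<..}. \<bar>g y * y powr \<beta>\<bar> \<le> D \<and> (y \<notin> {a..b} \<longrightarrow> g y * y powr \<beta> = 0)"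
    unfolding D_def by (rule AE_bound_mult_powr[OF a g])
  have "integrable (lebesgue_on {0<..}) (\<lambda>y. g y * y powr \<beta>)"
  proof (rule Bochner_Integration.integrable_bound[of _ "\<lambda>y. D * indicator {a..b} y"])
    have "integrable lebesgue (\<lambda>y. indicator {0<..} y *\<^sub>R (D * indicator {a..b} y))"
    proof -
      have "integrable lebesgue (\<lambda>y. D * indicator {a..b} y)"
        by (intro integrable_mult_right) (simp add: lmeasurable_iff_integrable[symmetric])
      moreover have "(\<lambda>y. indicator {0<..} y *\<^sub>R (D * indicator {a..b} y)) = (\<lambda>y. D * indicator {a..b} y)"
        using a by (auto simp: indicator_def intro!: ext)
      ultimately show ?thesis by simp
    qed
    then show "integrable (lebesgue_on {0<..}) (\<lambda>y. D * indicator {a..b} y)"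
      by (rule integrable_restrict_space[THEN iffD2, rotated]) simp
    show "(\<lambda>y. g y * y powr \<beta>) \<in> borel_measurable (lebesgue_on {0<..})"
      using meas measurable_powr_lebesgue_on by (intro borel_measurable_times)
    show "AE y in lebesgue_on {0<..}. norm (g y * y powr \<beta>) \<le> norm (D * indicator {a..b} y)"
      using gb
    proof eventually_elim
      case (elim y)
      then show ?case by (cases "y \<in> {a..b}") (auto simp: abs_mult)
    qed
  qed
  then have int: "integrable lebesgue \<psi>"
    unfolding \<psi>_def by (simp add: integrable_restrict_space)
  have pb: "AE y in lebesgue_on {0<..}. \<bar>\<psi> y\<bar> \<le> D"
    using gb AE_space by eventually_elim (auto simp: \<psi>_def)
  have "AE x in lebesgue_on {0<..}. \<forall>\<epsilon>>0. \<exists>\<delta>>0. \<forall>r. 0 < r \<and> r < \<delta> \<longrightarrow>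
    integral {x - r..x + r} (\<lambda>y. \<bar>\<psi> y - \<psi> x\<bar>) \<le> \<epsilon> * r"
    using lebesgue_points[OF int] by (subst AE_restrict_space_iff) (auto elim: eventually_mono)
  then show ?thesis
    using AE_space
  proof eventually_elim
    case (elim x)
    then have x: "x > 0" by simp
    have "((\<lambda>t. x powr (\<mu> + 1 / 2) * (\<integral>y. bessel_density \<mu> t x y * \<psi> y \<partial>lebesgue_on {0<..}))
        \<longlongrightarrow> x powr (\<mu> + 1 / 2) * \<psi> x) (at_right 0)"
      using elim by (intro tendsto_mult tendsto_const bessel_density_tendsto_lebesgue_point[OF \<mu> x int pb]) auto
    moreover have "x powr (\<mu> + 1 / 2) * \<psi> x = g x"
      using x by (simp add: \<psi>_def \<beta>_def powr_add[symmetric] mult.left_commute)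
    moreover have "(\<integral>y. bessel_density \<mu> t x y * \<psi> y \<partial>lebesgue_on {0<..})
        = (\<integral>y. bessel_density \<mu> t x y * (g y * y powr - (\<mu> + 1 / 2)) \<partial>lebesgue_on {0<..})" for t
      by (intro Bochner_Integration.integral_cong refl) (simp add: \<psi>_def \<beta>_def)
    ultimately show ?case
      unfolding set_integral_bessel_kernel_eq_density[OF x] by simp
  qed
qed

section \<open>Compact supports and measurable data\<close>

lemma compact_pos_subset_interval:
  fixes K :: "real set"
  assumes "compact K" "K \<subseteq> {0<..}"
  shows "\<exists>a b. 0 < a \<and> a < b \<and> K \<subseteq> {a..b}"
proof (cases "K = {}")
  case True
  then show ?thesis by (intro exI[of _ 1] exI[of _ 2]) simp
next
  case False
  obtain l where l: "l \<in> K" "\<And>k. k \<in> K \<Longrightarrow> l \<le> k"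
    using compact_attains_inf[OF assms(1) False] by blast
  obtain u where u: "u \<in> K" "\<And>k. k \<in> K \<Longrightarrow> k \<le> u"
    using compact_attains_sup[OF assms(1) False] by blast
  show ?thesis
    \<comment> \<open>The \<open>+ 1\<close> keeps the interval nondegenerate when K is a single
      point.\<close>
    using l u assms(2) by (intro exI[of _ l] exI[of _ "u + 1"]) force
qed

lemma compact_quadrant_subset_square:
  assumes "compact K" "K \<subseteq> quadrant"
  shows "\<exists>a b. 0 < a \<and> a < b \<and> K \<subseteq> {a..b} \<times> {a..b}"
proof -
  have "compact (fst ` K \<union> snd ` K)"
    using assms(1) by (intro compact_Un compact_continuous_image continuous_intros) auto
  moreover have "fst ` K \<union> snd ` K \<subseteq> {0<..}" using assms(2) by (auto simp: quadrant_def)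
  ultimately have "\<exists>a b. 0 < a \<and> a < b \<and> fst ` K \<union> snd ` K \<subseteq> {a..b}"
    by (rule compact_pos_subset_interval)
  then obtain a b where ab: "0 < a" "a < b" "fst ` K \<union> snd ` K \<subseteq> {a..b}"
    by (elim exE conjE)
  have "K \<subseteq> {a..b} \<times> {a..b}"
  proof
    fix z assume "z \<in> K"
    then have "fst z \<in> {a..b}" "snd z \<in> {a..b}" using ab(3) by (simp_all add: subset_eq del: atLeastAtMost_iff)
    then show "z \<in> {a..b} \<times> {a..b}" by (simp only: mem_Times_iff)
  qed
  with ab(1,2) show ?thesis by (intro exI[of _ a] exI[of _ b] conjI)
qed

lemma Linfty_compact_support_interval:
  fixes g :: "real \<Rightarrow> real"
  assumes "Linfty_on {0<..} g" "compactly_supported_in {0<..} g"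
  obtains a b C where "0 < a" "a < b" "C \<ge> 0" "g \<in> borel_measurable (lebesgue_on {0<..})"
    "AE y in lebesgue_on {0<..}. \<bar>g y\<bar> \<le> C \<and> (y \<notin> {a..b} \<longrightarrow> g y = 0)"
proof -
  obtain C where C: "AE y in lebesgue_on {0<..}. \<bar>g y\<bar> \<le> C" using assms(1) by (auto simp: Linfty_on_def)
  obtain K where K: "compact K" "K \<subseteq> {0<..}" "AE y in lebesgue_on {0<..}. y \<notin> K \<longrightarrow> g y = 0"
    using assms(2) by (auto simp: compactly_supported_in_def)
  obtain a b where ab: "0 < a" "a < b" "K \<subseteq> {a..b}"
    using compact_pos_subset_interval[OF K(1,2)] by blast
  have "AE y in lebesgue_on {0<..}. \<bar>g y\<bar> \<le> \<bar>C\<bar> \<and> (y \<notin> {a..b} \<longrightarrow> g y = 0)"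
    using C K(3) by eventually_elim (use ab(3) in auto)
  then show ?thesis using that[of a b "\<bar>C\<bar>"] ab assms(1) by (simp add: Linfty_on_def)
qed

text \<open>Composing a Lebesgue measurable function with a Borel map can destroy measurability.
  Here preimages under T are images under T, and differentiable images of Lebesgue sets are Lebesgue
  sets.\<close>

lemma borel_measurable_lebesgue_involution:
  fixes T :: "'a::euclidean_space \<Rightarrow> 'a" and h :: "'a \<Rightarrow> real"
  assumes h: "h \<in> borel_measurable lebesgue"
    and T: "T differentiable_on UNIV" "\<And>z. T (T z) = z"
  shows "(\<lambda>z. h (T z)) \<in> borel_measurable lebesgue"
proof (rule measurableI)
  fix B :: "real set" assume "B \<in> sets borel"
  then have "h -` B \<in> sets lebesgue" using measurable_sets[OF h] by simp
  then have "T ` (h -` B) \<in> sets lebesgue"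
    using T(1) by (intro differentiable_image_in_sets_lebesgue) (auto intro: differentiable_on_subset)
  moreover have "(\<lambda>z. h (T z)) -` B = T ` (h -` B)"
  proof (intro equalityI subsetI)
    fix z assume "z \<in> (\<lambda>z. h (T z)) -` B"
    then show "z \<in> T ` (h -` B)" using T(2)[of z] by (intro image_eqI[of _ _ "T z"]) auto
  qed (use T(2) in auto)
  ultimately show "(\<lambda>z. h (T z)) -` B \<inter> space lebesgue \<in> sets lebesgue" by simp
qed simp

section \<open>Integrals of the kernel against data of compact support\<close>

lemma continuous_on_compact_bound:
  fixes f :: "'a::topological_space \<Rightarrow> real"
  assumes "compact S" "continuous_on S f"
  obtains C where "C \<ge> 0" "\<And>z. z \<in> S \<Longrightarrow> \<bar>f z\<bar> \<le> C"
proof -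
  have "bounded (f ` S)" by (intro compact_imp_bounded compact_continuous_image assms)
  then obtain C where "\<And>z. z \<in> S \<Longrightarrow> \<bar>f z\<bar> \<le> C" by (auto simp: bounded_iff)
  then have "\<And>z. z \<in> S \<Longrightarrow> \<bar>f z\<bar> \<le> \<bar>C\<bar>" by force
  then show ?thesis using that[of "\<bar>C\<bar>"] by simp
qed

lemma integrable_continuous_mult:
  fixes g k :: "real \<Rightarrow> real"
  assumes k: "continuous_on {a..b} k" and g: "integrable (lebesgue_on {a..b}) g"
  shows "integrable (lebesgue_on {a..b}) (\<lambda>y. k y * g y)"
proof -
  obtain C where C: "C \<ge> 0" "\<And>y. y \<in> {a..b} \<Longrightarrow> \<bar>k y\<bar> \<le> C"
    using continuous_on_compact_bound[OF compact_Icc k] by blast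
  show ?thesis
  proof (rule Bochner_Integration.integrable_bound[of _ "\<lambda>y. C * g y"])
    show "(\<lambda>y. k y * g y) \<in> borel_measurable (lebesgue_on {a..b})"
      by (intro borel_measurable_times borel_measurable_integrable[OF g]
          continuous_imp_measurable_on_sets_lebesgue k) simp
    show "AE y in lebesgue_on {a..b}. norm (k y * g y) \<le> norm (C * g y)"
    proof (rule AE_I2)
      fix y assume "y \<in> space (lebesgue_on {a..b})"
      then have "\<bar>k y\<bar> * \<bar>g y\<bar> \<le> C * \<bar>g y\<bar>" using C(2)[of y] by (intro mult_right_mono) auto
      then show "norm (k y * g y) \<le> norm (C * g y)" using C(1) by (simp add: abs_mult)
    qed
  qed (use g in simp)
qed

text \<open>Lets the arguments below run once for an abstract kernel and serve the Bessel kernel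
  together with its three derivatives.\<close>

definition kernel_continuous :: "(real \<Rightarrow> real \<Rightarrow> real \<Rightarrow> real) \<Rightarrow> bool" where
  "kernel_continuous k \<longleftrightarrow> continuous_on ({0<..} \<times> {0<..} \<times> {0<..}) (\<lambda>(t, x, y). k t x y)"

lemma kernel_continuous_kernels:
  "kernel_continuous (bessel_kernel \<mu>)" "kernel_continuous (kernel_t \<mu>)"
  "kernel_continuous (kernel_x \<mu>)" "kernel_continuous (kernel_xx \<mu>)"
  unfolding kernel_continuous_def by (rule continuous_on_kernels)+

lemma kernel_continuous_compose:
  assumes k: "kernel_continuous k"
    and c: "continuous_on S \<alpha>" "continuous_on S \<beta>" "continuous_on S \<gamma>"
    and p: "\<And>z. z \<in> S \<Longrightarrow> 0 < \<alpha> z" "\<And>z. z \<in> S \<Longrightarrow> 0 < \<beta> z" "\<And>z. z \<in> S \<Longrightarrow> 0 < \<gamma> z"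
  shows "continuous_on S (\<lambda>z. k (\<alpha> z) (\<beta> z) (\<gamma> z))"
proof -
  have 1: "continuous_on S (\<lambda>z. (\<alpha> z, \<beta> z, \<gamma> z))" by (intro continuous_intros c)
  have "(\<lambda>z. (\<alpha> z, \<beta> z, \<gamma> z)) ` S \<subseteq> {0<..} \<times> {0<..} \<times> {0<..}" using p by auto
  with continuous_on_compose2[OF k[unfolded kernel_continuous_def] 1] show ?thesis by simp
qed

lemma continuous_on_compose_pair:
  assumes "continuous_on (A \<times> B) (\<lambda>(s, y). h s y)" "continuous_on S \<alpha>" "continuous_on S \<beta>"
    and "\<And>z. z \<in> S \<Longrightarrow> \<alpha> z \<in> A" "\<And>z. z \<in> S \<Longrightarrow> \<beta> z \<in> B"
  shows "continuous_on S (\<lambda>z. h (\<alpha> z) (\<beta> z))"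
proof -
  have 1: "continuous_on S (\<lambda>z. (\<alpha> z, \<beta> z))" by (intro continuous_intros assms)
  have "(\<lambda>z. (\<alpha> z, \<beta> z)) ` S \<subseteq> A \<times> B" using assms(4,5) by auto
  with continuous_on_compose2[OF assms(1) 1] show ?thesis by simp
qed

lemma continuous_on_slice:
  assumes "continuous_on (U \<times> V) (\<lambda>(p, y). k p y)" "p \<in> U"
  shows "continuous_on V (k p)"
  using assms(2) by (intro continuous_on_compose_pair[OF assms(1)] continuous_intros) auto

text \<open>A closed ball times [a, b] is compact, so joint continuity of k already supplies the
  constant for dominated convergence; g need only be integrable.\<close>

lemma continuous_on_kernel_integral:
  fixes k :: "'p::euclidean_space \<Rightarrow> real \<Rightarrow> real"
  assumes U: "open U" and k: "continuous_on (U \<times> {a..b}) (\<lambda>(p, y). k p y)"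
    and g: "integrable (lebesgue_on {a..b}) g"
  shows "continuous_on U (\<lambda>p. \<integral>y. k p y * g y \<partial>lebesgue_on {a..b})"
  unfolding continuous_on_eq_continuous_within
proof
  fix p0 assume p0: "p0 \<in> U"
  obtain e where e: "e > 0" "cball p0 e \<subseteq> U" using U p0 open_contains_cball by blast
  have "continuous_on (cball p0 e \<times> {a..b}) (\<lambda>(p, y). k p y)"
    using e(2) by (intro continuous_on_subset[OF k]) auto
  then obtain C where C: "C \<ge> 0" "\<And>z. z \<in> cball p0 e \<times> {a..b} \<Longrightarrow> \<bar>case z of (p, y) \<Rightarrow> k p y\<bar> \<le> C"
    using continuous_on_compact_bound[OF compact_Times[OF compact_cball compact_Icc]] by blast
  show "continuous (at p0 within U) (\<lambda>p. \<integral>y. k p y * g y \<partial>lebesgue_on {a..b})"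
  proof (rule continuous_within_integral[where U="ball p0 e" and B="\<lambda>y. C * \<bar>g y\<bar>"])
    fix p assume p: "p \<in> U \<inter> ball p0 e"
    then show "(\<lambda>y. k p y * g y) \<in> borel_measurable (lebesgue_on {a..b})"
      using integrable_continuous_mult[OF continuous_on_slice[OF k] g, of p] by auto
    fix y assume "y \<in> space (lebesgue_on {a..b})"
    then have "\<bar>k p y\<bar> \<le> C" using p C(2)[of "(p, y)"] by auto
    then show "\<bar>k p y * g y\<bar> \<le> C * \<bar>g y\<bar>" unfolding abs_mult by (intro mult_right_mono) auto
  next
    fix y assume "y \<in> space (lebesgue_on {a..b})"
    then have "(\<lambda>p. (p, y)) ` U \<subseteq> U \<times> {a..b}" by auto
    moreover have "continuous_on U (\<lambda>p. (p, y))" by (intro continuous_intros)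
    ultimately have "continuous_on U (\<lambda>p. k p y)"
      using continuous_on_compose2[OF k, of U "\<lambda>p. (p, y)"] by simp
    then show "continuous (at p0 within U) (\<lambda>p. k p y * g y)"
      using p0 by (intro continuous_mult continuous_const) (simp add: continuous_on_eq_continuous_within)
  qed (use e p0 g in auto)
qed

lemma has_real_derivative_kernel_integral:
  fixes k k' :: "real \<Rightarrow> real \<Rightarrow> real"
  assumes U: "open U" "p0 \<in> U"
    and k: "continuous_on (U \<times> {a..b}) (\<lambda>(p, y). k p y)"
    and k': "continuous_on (U \<times> {a..b}) (\<lambda>(p, y). k' p y)"
    and der: "\<And>p y. p \<in> U \<Longrightarrow> y \<in> {a..b} \<Longrightarrow> ((\<lambda>p. k p y) has_real_derivative k' p y) (at p)"
    and g: "integrable (lebesgue_on {a..b}) g"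
  shows "((\<lambda>p. \<integral>y. k p y * g y \<partial>lebesgue_on {a..b}) has_real_derivative
    (\<integral>y. k' p0 y * g y \<partial>lebesgue_on {a..b})) (at p0)"
proof -
  obtain e where e: "e > 0" "cball p0 e \<subseteq> U" using U open_contains_cball by blast
  have "continuous_on (cball p0 e \<times> {a..b}) (\<lambda>(p, y). k' p y)"
    using e(2) by (intro continuous_on_subset[OF k']) auto
  then obtain C where C: "C \<ge> 0" "\<And>z. z \<in> cball p0 e \<times> {a..b} \<Longrightarrow> \<bar>case z of (p, y) \<Rightarrow> k' p y\<bar> \<le> C"
    using continuous_on_compact_bound[OF compact_Times[OF compact_cball compact_Icc]] by blast
  have pU: "p \<in> U" "p \<in> cball p0 e" if "\<bar>p - p0\<bar> < e" for p
    using that e(2) by (auto simp: dist_real_def abs_minus_commute)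
  show ?thesis
  proof (rule has_real_derivative_integral(1)[OF e(1), where B="\<lambda>y. C * \<bar>g y\<bar>"])
    fix p assume p: "\<bar>p - p0\<bar> < e"
    show "integrable (lebesgue_on {a..b}) (\<lambda>y. k p y * g y)"
      by (intro integrable_continuous_mult continuous_on_slice[OF k] pU p g)
    fix y assume "y \<in> space (lebesgue_on {a..b})"
    then have y: "y \<in> {a..b}" by simp
    show "((\<lambda>p. k p y * g y) has_real_derivative k' p y * g y) (at p)"
      using der[OF pU(1)[OF p] y] by (rule DERIV_cmult_right)
    have "\<bar>k' p y\<bar> \<le> C" using pU[OF p] y C(2)[of "(p, y)"] by auto
    then show "\<bar>k' p y * g y\<bar> \<le> C * \<bar>g y\<bar>" unfolding abs_mult by (intro mult_right_mono) auto
  qed (use g in simp)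
qed

text \<open>Since g vanishes almost everywhere outside [a, b], integrals over the half-line reduce
  to a compact interval, on which any continuous k is a bounded multiplier. Behaviour of k near 0 or
  infinity never matters.\<close>

lemma
  fixes g k :: "real \<Rightarrow> real"
  assumes a: "0 < a" and meas: "g \<in> borel_measurable (lebesgue_on {0<..})"
    and g: "AE y in lebesgue_on {0<..}. \<bar>g y\<bar> \<le> C \<and> (y \<notin> {a..b} \<longrightarrow> g y = 0)"
  shows integrable_Linfty_support: "integrable (lebesgue_on {a..b}) g"
    and set_integrable_Linfty_support: "continuous_on {a..b} k \<Longrightarrow> set_integrable lebesgue {0<..} (\<lambda>y. k y * g y)"
    and set_integral_Linfty_support: "continuous_on {a..b} k \<Longrightarrow> (LINT y:{0<..}|lebesgue. k y * g y) = (\<integral>y. k y * g y \<partial>lebesgue_on {a..b})"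
proof -
  have sub: "{a..b} \<subseteq> {0<..}" using a by auto
  have gl: "AE y in lebesgue. 0 < y \<longrightarrow> \<bar>g y\<bar> \<le> C \<and> (y \<notin> {a..b} \<longrightarrow> g y = 0)"
    using g by (subst (asm) AE_restrict_space_iff) auto
  have eq: "AE y in lebesgue. indicator {0<..} y *\<^sub>R (k y * g y) = indicator {a..b} y *\<^sub>R (k y * g y)" for k
    using gl by eventually_elim (use a in \<open>auto simp: indicator_def\<close>)
  have m0: "(\<lambda>y. indicator {0<..} y *\<^sub>R g y) \<in> borel_measurable lebesgue"
    using meas by (simp add: borel_measurable_restrict_space_iff)
  have mab: "(\<lambda>y. indicator {a..b} y *\<^sub>R g y) \<in> borel_measurable lebesgue"
  proof -
    have "(\<lambda>y. indicator {a..b} y *\<^sub>R (indicator {0<..} y *\<^sub>R g y)) \<in> borel_measurable lebesgue"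
      by (rule borel_measurable_scaleR[OF borel_measurable_indicator m0]) simp
    moreover have "(\<lambda>y. indicator {a..b} y *\<^sub>R (indicator {0<..} y *\<^sub>R g y)) = (\<lambda>y. indicator {a..b} y *\<^sub>R g y)"
      using a by (auto simp: indicator_def intro!: ext)
    ultimately show ?thesis by simp
  qed
  have "integrable lebesgue (\<lambda>y. indicator {a..b} y *\<^sub>R g y)"
  proof (rule Bochner_Integration.integrable_bound[of _ "\<lambda>y. C * indicator {a..b} y"])
    show "integrable lebesgue (\<lambda>y. C * indicator {a..b} y)"
      by (intro integrable_mult_right) (simp add: lmeasurable_iff_integrable[symmetric])
    show "AE y in lebesgue. norm (indicator {a..b} y *\<^sub>R g y) \<le> norm (C * indicator {a..b} y)"
      using gl by eventually_elim (use a in \<open>auto simp: indicator_def\<close>)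
  qed (rule mab)
  then show gi: "integrable (lebesgue_on {a..b}) g"
    by (simp add: integrable_restrict_space)
  assume k: "continuous_on {a..b} k"
  have int: "integrable lebesgue (\<lambda>y. indicator {a..b} y *\<^sub>R (k y * g y))"
    using integrable_continuous_mult[OF k gi] by (simp add: integrable_restrict_space)
  then have m1: "(\<lambda>y. indicator {a..b} y *\<^sub>R (k y * g y)) \<in> borel_measurable lebesgue" by auto
  have m2: "(\<lambda>y. indicator {0<..} y *\<^sub>R (k y * g y)) \<in> borel_measurable lebesgue"
    by (rule borel_measurable_AE[OF m1 eventually_mono[OF eq[of k] sym]])
  show "set_integrable lebesgue {0<..} (\<lambda>y. k y * g y)"
    unfolding set_integrable_def using int integrable_cong_AE[OF m2 m1 eq] by simp
  show "(LINT y:{0<..}|lebesgue. k y * g y) = (\<integral>y. k y * g y \<partial>lebesgue_on {a..b})"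
    unfolding set_lebesgue_integral_def using integral_cong_AE[OF m2 m1 eq]
    by (simp add: integral_restrict_space)
qed

text \<open>After the time reversal the source is dominated almost everywhere by C on a square, so
  the integrand is dominated by C times the kernel on (0, t) times [a, b]. By Tonelli and
  \<open>integral_bessel_kernel_le\<close> that majorant has integral at most C D t.\<close>

lemma set_integrable_bessel_kernel_product:
  fixes f :: "real \<times> real \<Rightarrow> real"
  assumes \<mu>: "\<mu> > -1" and f: "Linfty_on quadrant f" "compactly_supported_in quadrant f"
    and t: "t > 0" and x: "x > 0"
  shows "set_integrable lebesgue ({0<..<t} \<times> {0<..}) (\<lambda>(\<tau>, y). bessel_kernel \<mu> \<tau> x y * f (t - \<tau>, y))"
proof -
  obtain C' where C': "AE z in lebesgue_on quadrant. \<bar>f z\<bar> \<le> C'" and fm: "f \<in> borel_measurable (lebesgue_on quadrant)"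
    using f(1) by (auto simp: Linfty_on_def)
  obtain K where K: "compact K" "K \<subseteq> quadrant" "AE z in lebesgue_on quadrant. z \<notin> K \<longrightarrow> f z = 0"
    using f(2) by (auto simp: compactly_supported_in_def)
  obtain a b where ab: "0 < a" "a < b" "K \<subseteq> {a..b} \<times> {a..b}"
    using compact_quadrant_subset_square[OF K(1,2)] by (elim exE conjE)
  define C where "C = \<bar>C'\<bar>"
  have C: "C \<ge> 0" by (simp add: C_def)
  have "open quadrant" by (simp add: quadrant_def open_Times)
  then have Q: "quadrant \<in> sets lebesgue" by (simp add: borel_open sets_completionI_sets)
  define T where "T z = (t - fst z, snd z)" for z :: "real \<times> real"
  have T: "T differentiable_on UNIV" "\<And>z. T (T z) = z"
  proof -
    have "(T has_derivative (\<lambda>h. (0 - fst h, snd h))) (at z)" for z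
      unfolding T_def by (intro derivative_intros)
    then show "T differentiable_on UNIV"
      unfolding differentiable_on_def differentiable_def by blast
  qed (simp add: T_def)
  define f0 where "f0 z = indicator quadrant z *\<^sub>R f z" for z
  have f0m: "f0 \<in> borel_measurable lebesgue"
    unfolding f0_def using fm Q by (simp add: borel_measurable_restrict_space_iff)
  have "AE z in lebesgue_on quadrant. \<bar>f0 z\<bar> \<le> C * indicator ({a..b} \<times> {a..b}) z"
    using C' K(3)
  proof eventually_elim
    case (elim z)
    show ?case
    proof (cases "z \<in> K")
      case True
      then have "z \<in> {a..b} \<times> {a..b}" using ab(3) by (rule rev_subsetD)
      then show ?thesis using elim by (auto simp: f0_def C_def indicator_def)
    qed (use elim C in \<open>simp add: f0_def\<close>)
  qed
  then have "AE z in lebesgue. z \<in> quadrant \<longrightarrow> \<bar>f0 z\<bar> \<le> C * indicator ({a..b} \<times> {a..b}) z"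
    using Q by (subst (asm) AE_restrict_space_iff) auto
  then have f0b: "AE z in lebesgue. \<bar>f0 z\<bar> \<le> C * indicator ({a..b} \<times> {a..b}) z"
  proof eventually_elim
    case (elim z)
    then show ?case using C by (cases "z \<in> quadrant") (simp_all add: f0_def)
  qed
  \<comment> \<open>S is the domain of integration; S' is the part of it where, up to a null set,
    the time-reversed source can be nonzero.\<close>
  define S where "S = {0<..<t} \<times> {0::real<..}"
  define S' where "S' = {0<..<t} \<times> {a..b}"
  have S: "S \<in> sets borel" "S' \<in> sets borel" 
    unfolding S_def S'_def borel_prod[symmetric] by (auto intro!: pair_measureI)
  define w where "w z = bessel_kernel \<mu> (fst z) x (snd z)" for z
  have wc: "continuous_on ({0<..} \<times> {0<..}) w"
    unfolding w_def using x
    by (intro kernel_continuous_compose[OF kernel_continuous_kernels(1)] continuous_intros) auto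
  have wS: "(\<lambda>z. indicator A z *\<^sub>R w z) \<in> borel_measurable borel" if "A \<in> sets borel" "A \<subseteq> {0<..} \<times> {0<..}" for A
    by (rule borel_measurable_continuous_on_indicator[OF that(1) continuous_on_subset[OF wc that(2)]])
  have wm: "(\<lambda>z. indicator S z *\<^sub>R w z) \<in> borel_measurable borel"
    by (rule wS[OF S(1)]) (auto simp: S_def)
  have wm': "(\<lambda>z. indicator S' z *\<^sub>R w z) \<in> borel_measurable borel"
    by (rule wS[OF S(2)]) (use ab(1) in \<open>auto simp: S'_def\<close>)
  define D where "D = (a powr - (\<mu> + 1 / 2) + b powr - (\<mu> + 1 / 2)) * x powr (\<mu> + 1 / 2)"
  have D: "D \<ge> 0" by (simp add: D_def)
  have w0: "w z \<ge> 0" if "z \<in> S'" for z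
    using that ab(1) bessel_kernel_pos[OF \<mu> _ x, of "fst z" "snd z"] by (force simp: S'_def w_def)
  \<comment> \<open>The kernel is continuous, hence Borel on S', so Tonelli applies over
    \<open>lborel\<close>; the majorant passes to Lebesgue measure afterwards.\<close>
  have "integrable lborel (\<lambda>z. C * (indicator S' z *\<^sub>R w z))"
  proof (intro integrable_mult_right integrableI_nonneg)
    show "AE z in lborel. 0 \<le> indicator S' z *\<^sub>R w z"
      using w0 by (intro AE_I2) (auto simp: indicator_def)
    have "(\<integral>\<^sup>+z. ennreal (indicator S' z *\<^sub>R w z) \<partial>lborel)
        = (\<integral>\<^sup>+z. ennreal (indicator S' z *\<^sub>R w z) \<partial>(lborel \<Otimes>\<^sub>M lborel))"
      by (simp add: lborel_prod)
    also have "\<dots> = (\<integral>\<^sup>+\<tau>. \<integral>\<^sup>+y. ennreal (indicator S' (\<tau>, y) *\<^sub>R w (\<tau>, y)) \<partial>lborel \<partial>lborel)"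
      using wm' by (intro lborel.nn_integral_fst[symmetric]) (simp add: borel_prod[symmetric] cong: measurable_cong_sets)
    also have "\<dots> \<le> (\<integral>\<^sup>+\<tau>. ennreal D * indicator {0<..<t} \<tau> \<partial>lborel)"
    proof (rule nn_integral_mono)
      fix \<tau> :: real
      show "(\<integral>\<^sup>+y. ennreal (indicator S' (\<tau>, y) *\<^sub>R w (\<tau>, y)) \<partial>lborel) \<le> ennreal D * indicator {0<..<t} \<tau>"
      proof (cases "\<tau> \<in> {0<..<t}")
        case True
        then have \<tau>: "\<tau> > 0" by simp
        have "(\<integral>\<^sup>+y. ennreal (indicator S' (\<tau>, y) *\<^sub>R w (\<tau>, y)) \<partial>lborel)
          = (\<integral>\<^sup>+y. ennreal (bessel_kernel \<mu> \<tau> x y) \<partial>lebesgue_on {a..b})"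
          using True by (simp add: nn_integral_restrict_space nn_integral_completion S'_def w_def)
            (intro nn_integral_cong, auto simp: indicator_def)
        also have "\<dots> = ennreal (\<integral>y. bessel_kernel \<mu> \<tau> x y \<partial>lebesgue_on {a..b})"
        proof (rule nn_integral_eq_integral)
          show "integrable (lebesgue_on {a..b}) (bessel_kernel \<mu> \<tau> x)"
            by (intro continuous_imp_integrable_real continuous_on_subset[OF continuous_on_bessel_kernel_y[OF \<tau> x]])
              (use ab(1) in auto)
          show "AE y in lebesgue_on {a..b}. 0 \<le> bessel_kernel \<mu> \<tau> x y"
          proof (rule AE_I2)
            fix y assume "y \<in> space (lebesgue_on {a..b})"
            then show "0 \<le> bessel_kernel \<mu> \<tau> x y" using bessel_kernel_pos[OF \<mu> \<tau> x, of y] ab(1) by simp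
          qed
        qed
        also have "\<dots> \<le> ennreal D"
          unfolding D_def using ab by (intro ennreal_leI integral_bessel_kernel_le \<mu> \<tau> x) auto
        finally show ?thesis using True by simp
      next
        case False
        then have "indicator S' (\<tau>, y) = (0 :: real)" for y by (auto simp: S'_def)
        then show ?thesis by simp
      qed
    qed
    also have "\<dots> = ennreal D * ennreal t" using t by (subst nn_integral_cmult_indicator) auto
    also have "\<dots> < \<infinity>" by (simp add: ennreal_mult_less_top)
    finally show "(\<integral>\<^sup>+z. ennreal (indicator S' z *\<^sub>R w z) \<partial>lborel) < \<infinity>" .
  qed (use wm' in simp)
  then have hi: "integrable lebesgue (\<lambda>z. C * (indicator S' z *\<^sub>R w z))"
    using wm' by (subst integrable_completion) auto
  have "integrable lebesgue (\<lambda>z. (indicator S z *\<^sub>R w z) * f0 (T z))"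
  proof (rule Bochner_Integration.integrable_bound[OF hi])
    show "(\<lambda>z. (indicator S z *\<^sub>R w z) * f0 (T z)) \<in> borel_measurable lebesgue"
      using wm by (intro borel_measurable_times borel_measurable_lebesgue_involution[OF f0m T] measurable_completion) simp
    show "AE z in lebesgue. norm ((indicator S z *\<^sub>R w z) * f0 (T z)) \<le> norm (C * (indicator S' z *\<^sub>R w z))"
      using AE_lebesgue_involution[OF f0b T]
    proof eventually_elim
      case (elim z)
      have "\<bar>indicator S z *\<^sub>R w z\<bar> * \<bar>f0 (T z)\<bar> \<le> \<bar>indicator S z *\<^sub>R w z\<bar> * (C * indicator ({a..b} \<times> {a..b}) (T z))"
        using elim by (rule mult_left_mono) simp
      also have "\<dots> \<le> \<bar>C * (indicator S' z *\<^sub>R w z)\<bar>"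
        using C by (auto simp: indicator_def S_def S'_def T_def abs_mult)
      finally show ?case by (simp add: abs_mult)
    qed
  qed
  moreover have "(indicator S z *\<^sub>R w z) * f0 (T z) = indicator S z *\<^sub>R (case z of (\<tau>, y) \<Rightarrow> bessel_kernel \<mu> \<tau> x y * f (t - \<tau>, y))" for z
    by (cases z) (auto simp: indicator_def S_def f0_def T_def w_def quadrant_def)
  ultimately show ?thesis unfolding set_integrable_def S_def[symmetric] by (simp only:)
qed

section \<open>The Duhamel integral\<close>

lemma kernel_t_sym: "kernel_t \<mu> t x y = kernel_t \<mu> t y x"
proof -
  have "bessel_prefactor \<mu> t x y = bessel_prefactor \<mu> t y x"
    by (simp add: bessel_prefactor_def mult.commute add.commute)
  moreover have "bessel_arg t x y = bessel_arg t y x"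
    by (simp add: bessel_arg_def mult.commute)
  ultimately show ?thesis by (simp add: kernel_t_def add.commute mult.commute)
qed

lemma bessel_kernel_has_derivative_y:
  assumes "t > 0" "x > 0" "y > 0"
  shows "((\<lambda>y. bessel_kernel \<mu> t x y) has_real_derivative kernel_x \<mu> t y x) (at y)"
  using bessel_kernel_has_derivative_x[OF assms(1,3,2)] by (subst bessel_kernel_sym)

text \<open>A function of compact support in the open quadrant, extended by zero. Its support is kept in
  the open square \<open>(a, b)\<^sup>2\<close> so that no boundary terms arise on \<open>[a, b]\<close>.\<close>
locale bessel_source =
  fixes \<mu> a b :: real and F Ft Fy Fyy :: "real \<Rightarrow> real \<Rightarrow> real"
  assumes \<mu>: "\<mu> > -1" and a: "0 < a" and ab: "a < b"
    and dFt: "\<And>s y. ((\<lambda>s. F s y) has_real_derivative Ft s y) (at s)"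
    and dFy: "\<And>s y. (F s has_real_derivative Fy s y) (at y)"
    and dFyy: "\<And>s y. (Fy s has_real_derivative Fyy s y) (at y)"
    and F_cont: "continuous_on UNIV (\<lambda>(s, y). F s y)"
    and Ft_cont: "continuous_on UNIV (\<lambda>(s, y). Ft s y)"
    and Fyy_cont: "continuous_on UNIV (\<lambda>(s, y). Fyy s y)"
    and F_supp: "\<And>s y. s \<notin> {a<..<b} \<or> y \<notin> {a<..<b} \<Longrightarrow> F s y = 0"
    and Ft_supp: "\<And>s y. s \<notin> {a<..<b} \<or> y \<notin> {a<..<b} \<Longrightarrow> Ft s y = 0"
    and Fy_supp: "\<And>s y. s \<notin> {a<..<b} \<or> y \<notin> {a<..<b} \<Longrightarrow> Fy s y = 0"
    and Fyy_supp: "\<And>s y. s \<notin> {a<..<b} \<or> y \<notin> {a<..<b} \<Longrightarrow> Fyy s y = 0"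
begin

abbreviation W where "W \<equiv> bessel_kernel \<mu>"

text \<open>Kernel time \<tau> and source time s are kept independent: bounds are uniform in s, and
  s = t - \<tau> is inserted only in the outer integral.\<close>

definition inner_int where
  "inner_int k \<Psi> \<tau> s x = (\<integral>y. k \<tau> x y * \<Psi> s y \<partial>lebesgue_on {a..b})"
  for k :: "real \<Rightarrow> real \<Rightarrow> real \<Rightarrow> real" and \<Psi> :: "real \<Rightarrow> real \<Rightarrow> real"

text \<open>The half-line replaces (0, t) because the source vanishes at nonpositive times;
  differentiating in t then gives no boundary term.\<close>

definition outer_int where
  "outer_int k \<Psi> t x = (\<integral>\<tau>. inner_int k \<Psi> \<tau> (t - \<tau>) x \<partial>lebesgue_on {0<..})"

text \<open>The common properties of \<open>F\<close>, \<open>Ft\<close> and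
  \<open>bessel_F\<close>. The variable y is confined to [a, b] because of the factor y^-2 in the
  last one.\<close>

definition admissible :: "(real \<Rightarrow> real \<Rightarrow> real) \<Rightarrow> bool" where
  "admissible \<Psi> \<longleftrightarrow> continuous_on (UNIV \<times> {a..b}) (\<lambda>(s, y). \<Psi> s y) \<and>
     (\<forall>s y. s \<notin> {a<..<b} \<longrightarrow> \<Psi> s y = 0)"

text \<open>The essential point is uniformity down to \<tau> = 0; it provides the dominating
  constants for differentiating the outer integral.\<close>

definition locally_bounded where
  "locally_bounded k \<Psi> \<longleftrightarrow> (\<forall>l u. 0 < l \<longrightarrow>
     (\<exists>C\<ge>0. \<forall>\<tau> s x. 0 < \<tau> \<and> l \<le> x \<and> x \<le> u \<longrightarrow> \<bar>inner_int k \<Psi> \<tau> s x\<bar> \<le> C))"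

definition bessel_F where
  "bessel_F s y = Fyy s y + (1 / 4 - \<mu>\<^sup>2) / y\<^sup>2 * F s y"

lemma admissible_F: "admissible F"
  and admissible_Ft: "admissible Ft"
  and admissible_bessel_F: "admissible bessel_F"
proof -
  note F = continuous_on_subset[OF F_cont subset_UNIV, of "UNIV \<times> {a..b}", unfolded case_prod_unfold]
  note Fyy = continuous_on_subset[OF Fyy_cont subset_UNIV, of "UNIV \<times> {a..b}", unfolded case_prod_unfold]
  show "admissible F"
    unfolding admissible_def using F F_supp by (auto simp: case_prod_unfold)
  show "admissible Ft"
    unfolding admissible_def using continuous_on_subset[OF Ft_cont subset_UNIV] Ft_supp by auto
  have "continuous_on (UNIV \<times> {a..b}) (\<lambda>z. Fyy (fst z) (snd z) + (1 / 4 - \<mu>\<^sup>2) / (snd z)\<^sup>2 * F (fst z) (snd z))"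
    using a by (intro continuous_intros F Fyy) auto
  then show "admissible bessel_F"
    unfolding admissible_def bessel_F_def case_prod_unfold using F_supp Fyy_supp by auto
qed

lemma admissible_slice: "admissible \<Psi> \<Longrightarrow> continuous_on {a..b} (\<Psi> s)"
  unfolding admissible_def using continuous_on_slice[of UNIV "{a..b}" \<Psi> s] by auto

lemma admissible_bound:
  assumes "admissible \<Psi>"
  obtains C where "C \<ge> 0" "\<And>s y. y \<in> {a..b} \<Longrightarrow> \<bar>\<Psi> s y\<bar> \<le> C"
proof -
  have "continuous_on ({a..b} \<times> {a..b}) (\<lambda>(s, y). \<Psi> s y)"
    using assms unfolding admissible_def by (auto intro: continuous_on_subset)
  then obtain C where C: "C \<ge> 0" "\<And>z. z \<in> {a..b} \<times> {a..b} \<Longrightarrow> \<bar>case z of (s, y) \<Rightarrow> \<Psi> s y\<bar> \<le> C"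
    using continuous_on_compact_bound[OF compact_Times[OF compact_Icc compact_Icc], of a b a b "\<lambda>(s, y). \<Psi> s y"]
    by metis
  have "\<bar>\<Psi> s y\<bar> \<le> C" if "y \<in> {a..b}" for s y
  proof (cases "s \<in> {a..b}")
    case True
    then show ?thesis using C(2)[of "(s, y)"] that by auto
  next
    case False
    then have "s \<notin> {a<..<b}" by auto
    then show ?thesis using assms C(1) by (simp add: admissible_def)
  qed
  with C(1) show ?thesis by (rule that)
qed

lemma integrable_inner:
  assumes k: "kernel_continuous k" and \<Psi>: "admissible \<Psi>" and "\<tau> > 0" "x > 0"
  shows "integrable (lebesgue_on {a..b}) (\<lambda>y. k \<tau> x y * \<Psi> s y)"
proof (rule continuous_imp_integrable_real)
  show "continuous_on {a..b} (\<lambda>y. k \<tau> x y * \<Psi> s y)"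
    using assms a by (intro continuous_on_mult admissible_slice kernel_continuous_compose[OF k] continuous_intros) auto
qed

lemma inner_int_eq_0: "admissible \<Psi> \<Longrightarrow> s \<notin> {a<..<b} \<Longrightarrow> inner_int k \<Psi> \<tau> s x = 0"
  by (simp add: inner_int_def admissible_def)

lemma continuous_on_inner_int:
  assumes k: "kernel_continuous k" and \<Psi>: "admissible \<Psi>"
  shows "continuous_on ({0<..} \<times> UNIV \<times> {0<..}) (\<lambda>(\<tau>, s, x). inner_int k \<Psi> \<tau> s x)"
proof -
  define q :: "real \<times> real \<times> real \<Rightarrow> real \<Rightarrow> real"
    where "q p y = k (fst p) (snd (snd p)) y * \<Psi> (fst (snd p)) y" for p y
  have "continuous_on ({0<..} \<times> UNIV \<times> {0<..}) (\<lambda>p. \<integral>y. q p y * 1 \<partial>lebesgue_on {a..b})"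
  proof (rule continuous_on_kernel_integral)
    show "continuous_on (({0<..} \<times> UNIV \<times> {0<..}) \<times> {a..b}) (\<lambda>(p, y). q p y)"
    proof -
      have "continuous_on (({0<..} \<times> UNIV \<times> {0<..}) \<times> {a..b}) (\<lambda>z. k (fst (fst z)) (snd (snd (fst z))) (snd z))"
        using a by (intro kernel_continuous_compose[OF k] continuous_intros) auto
      moreover have "continuous_on (({0<..} \<times> UNIV \<times> {0<..}) \<times> {a..b}) (\<lambda>z. \<Psi> (fst (snd (fst z))) (snd z))"
        using \<Psi> by (intro continuous_on_compose_pair[of UNIV "{a..b}" \<Psi>] continuous_intros) (auto simp: admissible_def)
      ultimately show ?thesis
        unfolding q_def case_prod_unfold by (rule continuous_on_mult)
    qed
    show "open ({0::real<..} \<times> (UNIV :: real set) \<times> {0::real<..})" by (intro open_Times) auto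
  qed (simp add: continuous_imp_integrable_real)
  then show ?thesis by (simp add: q_def inner_int_def case_prod_unfold)
qed

lemma inner_int_bessel_bound:
  assumes "admissible \<Psi>"
  shows "locally_bounded W \<Psi>"
  unfolding locally_bounded_def
proof (intro allI impI)
  fix l u :: real assume l: "0 < l"
  obtain C where C: "C \<ge> 0" "\<And>s y. y \<in> {a..b} \<Longrightarrow> \<bar>\<Psi> s y\<bar> \<le> C" using admissible_bound[OF assms] by blast
  define A where "A = (a powr - (\<mu> + 1 / 2) + b powr - (\<mu> + 1 / 2))"
  define X where "X = (l powr (\<mu> + 1 / 2) + u powr (\<mu> + 1 / 2))"
  have AX: "A \<ge> 0" "X \<ge> 0" by (auto simp: A_def X_def)
  have "\<bar>inner_int W \<Psi> \<tau> s x\<bar> \<le> C * (A * X)" if h: "0 < \<tau>" "l \<le> x" "x \<le> u" for \<tau> s x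
  proof -
    have x: "x > 0" using h l by simp
    have wi: "integrable (lebesgue_on {a..b}) (W \<tau> x)"
      by (intro continuous_imp_integrable_real continuous_on_subset[OF continuous_on_bessel_kernel_y[OF h(1) x]]) (use a in auto)
    have "\<bar>inner_int W \<Psi> \<tau> s x\<bar> \<le> (\<integral>y. \<bar>W \<tau> x y * \<Psi> s y\<bar> \<partial>lebesgue_on {a..b})"
      unfolding inner_int_def by (rule integral_abs_bound)
    also have "\<dots> \<le> (\<integral>y. W \<tau> x y * C \<partial>lebesgue_on {a..b})"
    proof (rule integral_mono')
      fix y assume "y \<in> space (lebesgue_on {a..b})"
      then have y: "y \<in> {a..b}" by simp
      have w: "W \<tau> x y \<ge> 0" using bessel_kernel_pos[OF \<mu> h(1) x, of y] y a by auto
      then show "0 \<le> W \<tau> x y * C" using C(1) by simp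
      show "\<bar>W \<tau> x y * \<Psi> s y\<bar> \<le> W \<tau> x y * C"
        using w C(2)[OF y] by (simp add: abs_mult mult_left_mono)
    qed (use wi in simp)
    also have "\<dots> = C * (\<integral>y. W \<tau> x y \<partial>lebesgue_on {a..b})" by (simp add: mult.commute)
    also have "\<dots> \<le> C * (A * x powr (\<mu> + 1 / 2))"
      unfolding A_def using a ab by (intro mult_left_mono integral_bessel_kernel_le \<mu> h(1) x C(1)) auto
    also have "\<dots> \<le> C * (A * X)"
      unfolding X_def using l h by (intro mult_left_mono AX C(1) powr_le_endpoints) auto
    finally show ?thesis .
  qed
  then show "\<exists>C\<ge>0. \<forall>\<tau> s x. 0 < \<tau> \<and> l \<le> x \<and> x \<le> u \<longrightarrow> \<bar>inner_int W \<Psi> \<tau> s x\<bar> \<le> C"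
    using AX C(1) by (intro exI[of _ "C * (A * X)"]) auto
qed

text \<open>Green's formula: \<open>F\<close> vanishes near the end points.\<close>
lemma inner_int_kernel_t:
  assumes t: "\<tau> > 0" and x: "x > 0"
  shows "inner_int (kernel_t \<mu>) F \<tau> s x = inner_int W bessel_F \<tau> s x"
proof -
  \<comment> \<open>The boundary expression of Green's formula. The kernel is symmetric, so
    \<open>kernel_x\<close> with x and y exchanged is its y-derivative.\<close>
  define G where "G y = kernel_x \<mu> \<tau> y x * F s y - W \<tau> x y * Fy s y" for y
  have G': "(G has_real_derivative kernel_xx \<mu> \<tau> y x * F s y - W \<tau> x y * Fyy s y) (at y)"
    if y: "y > 0" for y
    unfolding G_def
    by (rule DERIV_cong[OF DERIV_diff[OF DERIV_mult[OF kernel_x_has_derivative_x[OF t y x] dFy]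
          DERIV_mult[OF bessel_kernel_has_derivative_y[OF t x y] dFyy]]]) simp
  \<comment> \<open>The heat equation is used in the variable y; the potential term it brings is
    absorbed into \<open>bessel_F\<close>.\<close>
  have eq: "kernel_xx \<mu> \<tau> y x * F s y - W \<tau> x y * Fyy s y
      = kernel_t \<mu> \<tau> x y * F s y - W \<tau> x y * bessel_F s y" for y
    unfolding kernel_xx_def bessel_F_def kernel_t_sym[of \<mu> \<tau> y x] bessel_kernel_sym[of \<mu> \<tau> y x]
    by (simp add: algebra_simps)
  have "((\<lambda>y. kernel_t \<mu> \<tau> x y * F s y - W \<tau> x y * bessel_F s y) has_integral (G b - G a)) {a..b}"
    unfolding eq[symmetric] using ab a
    by (intro fundamental_theorem_of_calculus)
      (auto intro!: G'[THEN DERIV_subset[THEN has_real_derivative_iff_has_vector_derivative[THEN iffD1]]])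
  moreover have "G b - G a = 0" using F_supp Fy_supp by (simp add: G_def)
  moreover have i: "integrable (lebesgue_on {a..b}) (\<lambda>y. kernel_t \<mu> \<tau> x y * F s y)"
    "integrable (lebesgue_on {a..b}) (\<lambda>y. W \<tau> x y * bessel_F s y)"
    by (intro integrable_inner kernel_continuous_kernels admissible_F admissible_bessel_F t x)+
  moreover have "(\<integral>y. kernel_t \<mu> \<tau> x y * F s y - W \<tau> x y * bessel_F s y \<partial>lebesgue_on {a..b})
      = integral {a..b} (\<lambda>y. kernel_t \<mu> \<tau> x y * F s y - W \<tau> x y * bessel_F s y)"
    using i by (intro lebesgue_integral_eq_integral Bochner_Integration.integrable_diff) auto
  ultimately show ?thesis
    by (simp add: inner_int_def integral_unique)
qed

lemma inner_int_kernel_xx: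
  assumes t: "\<tau> > 0" and x: "x > 0" and \<Psi>: "admissible \<Psi>"
  shows "inner_int (kernel_xx \<mu>) \<Psi> \<tau> s x
    = inner_int (kernel_t \<mu>) \<Psi> \<tau> s x - (1 / 4 - \<mu>\<^sup>2) / x\<^sup>2 * inner_int W \<Psi> \<tau> s x"
proof -
  have i: "integrable (lebesgue_on {a..b}) (\<lambda>y. kernel_t \<mu> \<tau> x y * \<Psi> s y)"
    "integrable (lebesgue_on {a..b}) (\<lambda>y. W \<tau> x y * \<Psi> s y)"
    by (intro integrable_inner kernel_continuous_kernels t x \<Psi>)+
  have "(\<lambda>y. kernel_xx \<mu> \<tau> x y * \<Psi> s y) = (\<lambda>y. kernel_t \<mu> \<tau> x y * \<Psi> s y - (1 / 4 - \<mu>\<^sup>2) / x\<^sup>2 * (W \<tau> x y * \<Psi> s y))"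
    by (simp add: kernel_xx_def algebra_simps)
  then show ?thesis
    unfolding inner_int_def using i by simp
qed

lemma locally_bounded_kernel_t: "locally_bounded (kernel_t \<mu>) F"
proof -
  have "\<bar>inner_int (kernel_t \<mu>) F \<tau> s x\<bar> \<le> C \<longleftrightarrow> \<bar>inner_int W bessel_F \<tau> s x\<bar> \<le> C"
    if "0 < l" "0 < \<tau> \<and> l \<le> x \<and> x \<le> u" for C \<tau> s x l u
    using inner_int_kernel_t[of \<tau> x s] that by simp
  then show ?thesis
    using inner_int_bessel_bound[OF admissible_bessel_F] unfolding locally_bounded_def by metis
qed

text \<open>By the heat equation in x the second derivative differs from \<open>kernel_t\<close> by
  the potential times the kernel, and the potential is bounded for x \<ge> l.\<close>

lemma locally_bounded_kernel_xx: "locally_bounded (kernel_xx \<mu>) F"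
  unfolding locally_bounded_def
proof (intro allI impI)
  fix l u :: real assume l: "0 < l"
  obtain C1 where C1: "C1 \<ge> 0" "\<And>\<tau> s x. 0 < \<tau> \<and> l \<le> x \<and> x \<le> u \<Longrightarrow> \<bar>inner_int (kernel_t \<mu>) F \<tau> s x\<bar> \<le> C1"
    using locally_bounded_kernel_t l unfolding locally_bounded_def by blast
  obtain C2 where C2: "C2 \<ge> 0" "\<And>\<tau> s x. 0 < \<tau> \<and> l \<le> x \<and> x \<le> u \<Longrightarrow> \<bar>inner_int W F \<tau> s x\<bar> \<le> C2"
    using inner_int_bessel_bound[OF admissible_F] l unfolding locally_bounded_def by blast
  have "\<bar>inner_int (kernel_xx \<mu>) F \<tau> s x\<bar> \<le> C1 + \<bar>1 / 4 - \<mu>\<^sup>2\<bar> / l\<^sup>2 * C2" if h: "0 < \<tau> \<and> l \<le> x \<and> x \<le> u" for \<tau> s x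
  proof -
    have x: "x > 0" using h l by auto
    have "\<bar>(1 / 4 - \<mu>\<^sup>2) / x\<^sup>2 * inner_int W F \<tau> s x\<bar> \<le> \<bar>1 / 4 - \<mu>\<^sup>2\<bar> / l\<^sup>2 * C2"
      unfolding abs_mult abs_divide using C2 h l by (intro mult_mono divide_mono) (auto intro!: power_mono)
    then show ?thesis using C1(2)[OF h, of s] h x unfolding inner_int_kernel_xx[OF conjunct1[OF h] x admissible_F]
      by linarith
  qed
  then show "\<exists>C\<ge>0. \<forall>\<tau> s x. 0 < \<tau> \<and> l \<le> x \<and> x \<le> u \<longrightarrow> \<bar>inner_int (kernel_xx \<mu>) F \<tau> s x\<bar> \<le> C"
    using C1(1) C2(1) by (intro exI[of _ "C1 + \<bar>1 / 4 - \<mu>\<^sup>2\<bar> / l\<^sup>2 * C2"]) auto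
qed

lemma inner_int_has_derivative_x:
  assumes k: "kernel_continuous k" "kernel_continuous k'"
    and der: "\<And>t x y. t > 0 \<Longrightarrow> x > 0 \<Longrightarrow> y > 0 \<Longrightarrow> ((\<lambda>x. k t x y) has_real_derivative k' t x y) (at x)"
    and \<Psi>: "admissible \<Psi>" and t: "\<tau> > 0" and x: "x > 0"
  shows "((\<lambda>x. inner_int k \<Psi> \<tau> s x) has_real_derivative inner_int k' \<Psi> \<tau> s x) (at x)"
  unfolding inner_int_def
proof (rule has_real_derivative_kernel_integral[where U="{0<..}"])
  have "continuous_on ({0<..} \<times> {a..b}) (\<lambda>z. h \<tau> (fst z) (snd z))" if "kernel_continuous h" for h
    using a t by (intro kernel_continuous_compose[OF that] continuous_intros) auto
  then show "continuous_on ({0<..} \<times> {a..b}) (\<lambda>(p, y). k \<tau> p y)" "continuous_on ({0<..} \<times> {a..b}) (\<lambda>(p, y). k' \<tau> p y)"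
    using k by (simp_all add: case_prod_unfold)
  show "integrable (lebesgue_on {a..b}) (\<Psi> s)"
    by (intro continuous_imp_integrable_real admissible_slice \<Psi>)
qed (use x der t a in auto)

text \<open>The Bessel operator contains no first derivative, so Green's formula gives no direct
  bound; one is interpolated between orders 0 and 2.\<close>

lemma locally_bounded_kernel_x: "locally_bounded (kernel_x \<mu>) F"
  unfolding locally_bounded_def
proof (intro allI impI)
  fix l u :: real assume l: "0 < l"
  \<comment> \<open>The bounds reach up to u + 1 because interpolation at x looks at the interval
    [x, x + 1].\<close>
  obtain M where M: "M \<ge> 0" "\<And>\<tau> s x. 0 < \<tau> \<and> l \<le> x \<and> x \<le> u + 1 \<Longrightarrow> \<bar>inner_int W F \<tau> s x\<bar> \<le> M"
    using inner_int_bessel_bound[OF admissible_F] l unfolding locally_bounded_def by blast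
  obtain N where N: "N \<ge> 0" "\<And>\<tau> s x. 0 < \<tau> \<and> l \<le> x \<and> x \<le> u + 1 \<Longrightarrow> \<bar>inner_int (kernel_xx \<mu>) F \<tau> s x\<bar> \<le> N"
    using locally_bounded_kernel_xx l unfolding locally_bounded_def by blast
  have "\<bar>inner_int (kernel_x \<mu>) F \<tau> s x\<bar> \<le> 2 * M / 1 + N * 1" if h: "0 < \<tau> \<and> l \<le> x \<and> x \<le> u" for \<tau> s x
  proof (rule derivative_interpolation[where \<phi>="inner_int W F \<tau> s" and \<phi>'="inner_int (kernel_x \<mu>) F \<tau> s"
        and \<phi>''="inner_int (kernel_xx \<mu>) F \<tau> s"])
    fix z assume z: "z \<in> {x..x + 1}"
    then have z0: "z > 0" and t: "\<tau> > 0" using h l by auto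
    show "(inner_int W F \<tau> s has_real_derivative inner_int (kernel_x \<mu>) F \<tau> s z) (at z)"
      by (intro inner_int_has_derivative_x kernel_continuous_kernels bessel_kernel_has_derivative_x admissible_F z0 t)
    show "(inner_int (kernel_x \<mu>) F \<tau> s has_real_derivative inner_int (kernel_xx \<mu>) F \<tau> s z) (at z)"
      by (intro inner_int_has_derivative_x kernel_continuous_kernels kernel_x_has_derivative_x admissible_F z0 t)
    show "\<bar>inner_int W F \<tau> s z\<bar> \<le> M" "\<bar>inner_int (kernel_xx \<mu>) F \<tau> s z\<bar> \<le> N"
      using M(2)[of \<tau> z s] N(2)[of \<tau> z s] z h by auto
  qed simp
  then show "\<exists>C\<ge>0. \<forall>\<tau> s x. 0 < \<tau> \<and> l \<le> x \<and> x \<le> u \<longrightarrow> \<bar>inner_int (kernel_x \<mu>) F \<tau> s x\<bar> \<le> C"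
    using M(1) N(1) by (intro exI[of _ "2 * M / 1 + N * 1"]) auto
qed

end

section \<open>Differentiating the Duhamel integral\<close>

context bessel_source
begin

lemma inner_int_shift_continuous:
  assumes k: "kernel_continuous k" and \<Psi>: "admissible \<Psi>" and x: "x > 0"
  shows "continuous_on {0<..} (\<lambda>\<tau>. inner_int k \<Psi> \<tau> (t - \<tau>) x)"
proof -
  have 1: "continuous_on {0<..} (\<lambda>\<tau>. (\<tau>, t - \<tau>, x))" by (intro continuous_intros)
  have "(\<lambda>\<tau>. (\<tau>, t - \<tau>, x)) ` {0<..} \<subseteq> {0<..} \<times> UNIV \<times> {0<..}" using x by auto
  with continuous_on_compose2[OF continuous_on_inner_int[OF k \<Psi>] 1] show ?thesis by simp
qed

lemma inner_int_shift_measurable: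
  assumes k: "kernel_continuous k" and \<Psi>: "admissible \<Psi>" and x: "x > 0"
  shows "(\<lambda>\<tau>. inner_int k \<Psi> \<tau> (t - \<tau>) x) \<in> borel_measurable (lebesgue_on {0<..})"
  by (intro continuous_imp_measurable_on_sets_lebesgue inner_int_shift_continuous assms) simp

lemma integrable_indicator_pos: "integrable (lebesgue_on {0<..}) (\<lambda>\<tau>. C * indicator {0<..<T::real} \<tau> :: real)"
proof -
  have "integrable lebesgue (\<lambda>\<tau>. C * indicator {0<..<T} \<tau> :: real)"
    by (intro integrable_mult_right) (simp add: lmeasurable_iff_integrable[symmetric])
  moreover have "(\<lambda>\<tau>. indicator {0<..} \<tau> *\<^sub>R (C * indicator {0<..<T} \<tau>)) = (\<lambda>\<tau>. C * indicator {0<..<T} \<tau>)"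
    by (auto simp: indicator_def intro!: ext)
  ultimately show ?thesis
    by (subst integrable_restrict_space) simp_all
qed

text \<open>For \<tau> \<ge> T the source is taken at a nonpositive time and vanishes. The resulting
  integrable majorant is the same for all t \<le> T, as differentiation in t requires.\<close>

lemma inner_int_shift_bound:
  assumes \<Psi>: "admissible \<Psi>" and C: "C \<ge> 0" "\<bar>inner_int k \<Psi> \<tau> (t - \<tau>) x\<bar> \<le> C" and "\<tau> > 0" "t \<le> T"
  shows "\<bar>inner_int k \<Psi> \<tau> (t - \<tau>) x\<bar> \<le> C * indicator {0<..<T} \<tau>"
proof (cases "\<tau> < T")
  case False
  then have "t - \<tau> \<notin> {a<..<b}" using a assms(5) by auto
  then show ?thesis using C by (simp add: inner_int_eq_0[OF \<Psi>])
qed (use assms in simp)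

lemma integrable_outer:
  assumes k: "kernel_continuous k" and \<Psi>: "admissible \<Psi>" and lb: "locally_bounded k \<Psi>" and x: "x > 0"
  shows "integrable (lebesgue_on {0<..}) (\<lambda>\<tau>. inner_int k \<Psi> \<tau> (t - \<tau>) x)"
proof -
  obtain C where C: "C \<ge> 0" "\<And>\<tau> s x'. 0 < \<tau> \<and> x \<le> x' \<and> x' \<le> x \<Longrightarrow> \<bar>inner_int k \<Psi> \<tau> s x'\<bar> \<le> C"
    using lb x unfolding locally_bounded_def by blast
  show ?thesis
  proof (rule Bochner_Integration.integrable_bound[OF integrable_indicator_pos[of C t]])
    show "AE \<tau> in lebesgue_on {0<..}. norm (inner_int k \<Psi> \<tau> (t - \<tau>) x) \<le> norm (C * indicator {0<..<t} \<tau>)"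
    proof (rule AE_I2)
      fix \<tau> assume "\<tau> \<in> space (lebesgue_on {0::real<..})"
      then have "\<tau> > 0" by simp
      then show "norm (inner_int k \<Psi> \<tau> (t - \<tau>) x) \<le> norm (C * indicator {0<..<t} \<tau>)"
        using inner_int_shift_bound[OF \<Psi> C(1), of k \<tau> t x t] C by (simp add: abs_mult)
    qed
  qed (rule inner_int_shift_measurable[OF k \<Psi> x])
qed

lemma continuous_on_outer:
  assumes k: "kernel_continuous k" and \<Psi>: "admissible \<Psi>" and lb: "locally_bounded k \<Psi>"
  shows "continuous_on quadrant (\<lambda>(t, x). outer_int k \<Psi> t x)"
  unfolding continuous_on_eq_continuous_within
proof
  fix p0 :: "real \<times> real" assume p0: "p0 \<in> quadrant"
  obtain t0 x0 where p: "p0 = (t0, x0)" by (cases p0)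
  have x0: "x0 > 0" using p0 p by (simp add: quadrant_def)
  obtain C where C: "C \<ge> 0" "\<And>\<tau> s x. 0 < \<tau> \<and> x0 / 2 \<le> x \<and> x \<le> 2 * x0 \<Longrightarrow> \<bar>inner_int k \<Psi> \<tau> s x\<bar> \<le> C"
    using lb[unfolded locally_bounded_def, rule_format, of "x0 / 2" "2 * x0"] x0 by auto
  have "continuous (at p0 within quadrant) (\<lambda>p. \<integral>\<tau>. inner_int k \<Psi> \<tau> (fst p - \<tau>) (snd p) \<partial>lebesgue_on {0<..})"
  proof (rule continuous_within_integral[where U="{..<t0 + 1} \<times> {x0 / 2<..<2 * x0}" and B="\<lambda>\<tau>. C * indicator {0<..<t0 + 1} \<tau>"])
    show "p0 \<in> {..<t0 + 1} \<times> {x0 / 2<..<2 * x0}" using x0 by (simp add: p)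
    show "integrable (lebesgue_on {0<..}) (\<lambda>\<tau>. C * indicator {0<..<t0 + 1} \<tau>)"
      by (rule integrable_indicator_pos)
    fix \<tau> assume "\<tau> \<in> space (lebesgue_on {0::real<..})"
    then have \<tau>: "\<tau> > 0" by simp
    have 1: "continuous_on quadrant (\<lambda>p. (\<tau>, fst p - \<tau>, snd p))" by (intro continuous_intros)
    have "(\<lambda>p. (\<tau>, fst p - \<tau>, snd p)) ` quadrant \<subseteq> {0<..} \<times> UNIV \<times> {0<..}" using \<tau> by (auto simp: quadrant_def)
    with continuous_on_compose2[OF continuous_on_inner_int[OF k \<Psi>] 1]
    have "continuous_on quadrant (\<lambda>p. inner_int k \<Psi> \<tau> (fst p - \<tau>) (snd p))" by simp
    then show "continuous (at p0 within quadrant) (\<lambda>p. inner_int k \<Psi> \<tau> (fst p - \<tau>) (snd p))"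
      using p0 by (simp add: continuous_on_eq_continuous_within)
    fix p assume p: "p \<in> quadrant \<inter> ({..<t0 + 1} \<times> {x0 / 2<..<2 * x0})"
    then show "\<bar>inner_int k \<Psi> \<tau> (fst p - \<tau>) (snd p)\<bar> \<le> C * indicator {0<..<t0 + 1} \<tau>"
      using \<tau> by (intro inner_int_shift_bound[OF \<Psi> C(1)] C(2)) (auto simp: quadrant_def)
  next
    fix p assume "p \<in> quadrant \<inter> ({..<t0 + 1} \<times> {x0 / 2<..<2 * x0})"
    then show "(\<lambda>\<tau>. inner_int k \<Psi> \<tau> (fst p - \<tau>) (snd p)) \<in> borel_measurable (lebesgue_on {0<..})"
      by (intro inner_int_shift_measurable k \<Psi>) (auto simp: quadrant_def)
  qed (use p0 in \<open>auto intro: open_Times\<close>)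
  then show "continuous (at p0 within quadrant) (\<lambda>(t, x). outer_int k \<Psi> t x)"
    by (simp add: outer_int_def case_prod_unfold)
qed

lemma outer_int_has_derivative_x:
  assumes k: "kernel_continuous k" "kernel_continuous k'"
    and der: "\<And>t x y. t > 0 \<Longrightarrow> x > 0 \<Longrightarrow> y > 0 \<Longrightarrow> ((\<lambda>x. k t x y) has_real_derivative k' t x y) (at x)"
    and \<Psi>: "admissible \<Psi>" and lb: "locally_bounded k \<Psi>" "locally_bounded k' \<Psi>" and x0: "x0 > 0"
  shows "(outer_int k \<Psi> t has_real_derivative outer_int k' \<Psi> t x0) (at x0)"
  unfolding outer_int_def[abs_def]
proof -
  obtain C where C: "C \<ge> 0" "\<And>\<tau> s x. 0 < \<tau> \<and> x0 / 2 \<le> x \<and> x \<le> 2 * x0 \<Longrightarrow> \<bar>inner_int k' \<Psi> \<tau> s x\<bar> \<le> C"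
    using lb(2)[unfolded locally_bounded_def, rule_format, of "x0 / 2" "2 * x0"] x0 by auto
  have near: "x0 / 2 \<le> x" "x \<le> 2 * x0" "x > 0" if "\<bar>x - x0\<bar> < x0 / 2" for x
    using that x0 unfolding abs_less_iff by (simp_all add: field_simps)
  show "((\<lambda>x. \<integral>\<tau>. inner_int k \<Psi> \<tau> (t - \<tau>) x \<partial>lebesgue_on {0<..}) has_real_derivative
      (\<integral>\<tau>. inner_int k' \<Psi> \<tau> (t - \<tau>) x0 \<partial>lebesgue_on {0<..})) (at x0)"
  proof (rule has_real_derivative_integral(1)[where e="x0 / 2" and B="\<lambda>\<tau>. C * indicator {0<..<t} \<tau>"])
    fix x assume x: "\<bar>x - x0\<bar> < x0 / 2"
    show "integrable (lebesgue_on {0<..}) (\<lambda>\<tau>. inner_int k \<Psi> \<tau> (t - \<tau>) x)"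
      by (rule integrable_outer[OF k(1) \<Psi> lb(1) near(3)[OF x]])
    fix \<tau> assume "\<tau> \<in> space (lebesgue_on {0::real<..})"
    then have \<tau>: "\<tau> > 0" by simp
    show "((\<lambda>x. inner_int k \<Psi> \<tau> (t - \<tau>) x) has_real_derivative inner_int k' \<Psi> \<tau> (t - \<tau>) x) (at x)"
      by (rule inner_int_has_derivative_x[OF k der \<Psi> \<tau> near(3)[OF x]])
    show "\<bar>inner_int k' \<Psi> \<tau> (t - \<tau>) x\<bar> \<le> C * indicator {0<..<t} \<tau>"
      using \<tau> near[OF x] by (intro inner_int_shift_bound[OF \<Psi> C(1)] C(2)) auto
  qed (use x0 integrable_indicator_pos in auto)
qed

lemma inner_int_shift_has_derivative_t:
  assumes \<tau>: "\<tau> > 0" and x: "x > 0"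
  shows "((\<lambda>t. inner_int W F \<tau> (t - \<tau>) x) has_real_derivative
    inner_int W Ft \<tau> (t - \<tau>) x) (at t)"
proof -
  note F = continuous_on_compose_pair[of UNIV UNIV F, OF F_cont[folded UNIV_Times_UNIV]]
  note Ft = continuous_on_compose_pair[of UNIV UNIV Ft, OF Ft_cont[folded UNIV_Times_UNIV]]
  have "((\<lambda>t. \<integral>y. (W \<tau> x y * F (t - \<tau>) y) * 1 \<partial>lebesgue_on {a..b}) has_real_derivative
     (\<integral>y. (W \<tau> x y * Ft (t - \<tau>) y) * 1 \<partial>lebesgue_on {a..b})) (at t)"
  proof (rule has_real_derivative_kernel_integral[where U=UNIV])
    show "continuous_on (UNIV \<times> {a..b}) (\<lambda>(t, y). W \<tau> x y * F (t - \<tau>) y)"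
      "continuous_on (UNIV \<times> {a..b}) (\<lambda>(t, y). W \<tau> x y * Ft (t - \<tau>) y)"
      unfolding case_prod_unfold using a \<tau> x
      by (auto intro!: continuous_on_mult kernel_continuous_compose[OF kernel_continuous_kernels(1)] F Ft continuous_intros)
    fix t y :: real
    have "((\<lambda>t. F (t - \<tau>) y) has_real_derivative Ft (t - \<tau>) y * 1) (at t)"
      by (rule DERIV_chain2[of "\<lambda>s. F s y"]) (auto intro!: dFt derivative_eq_intros)
    then show "((\<lambda>t. W \<tau> x y * F (t - \<tau>) y) has_real_derivative W \<tau> x y * Ft (t - \<tau>) y) (at t)"
      by (auto intro: DERIV_cmult)
  qed (simp_all add: continuous_imp_integrable_real)
  then show ?thesis by (simp add: inner_int_def)
qed

text \<open>The kernel is not touched: its integral against \<open>Ft\<close> is bounded uniformly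
  in \<tau>, so the singularity at \<tau> = 0 does not appear.\<close>

lemma outer_int_has_derivative_t:
  assumes x: "x > 0"
  shows "((\<lambda>t. outer_int W F t x) has_real_derivative outer_int W Ft t0 x) (at t0)"
  unfolding outer_int_def
proof -
  note lb = inner_int_bessel_bound
  obtain C where C: "C \<ge> 0" "\<And>\<tau> s x'. 0 < \<tau> \<and> x \<le> x' \<and> x' \<le> x \<Longrightarrow> \<bar>inner_int W Ft \<tau> s x'\<bar> \<le> C"
    using lb[OF admissible_Ft] x unfolding locally_bounded_def by blast
  show "((\<lambda>t. \<integral>\<tau>. inner_int W F \<tau> (t - \<tau>) x \<partial>lebesgue_on {0<..}) has_real_derivative
      (\<integral>\<tau>. inner_int W Ft \<tau> (t0 - \<tau>) x \<partial>lebesgue_on {0<..})) (at t0)"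
  proof (rule has_real_derivative_integral(1)[where e=1 and B="\<lambda>\<tau>. C * indicator {0<..<t0 + 1} \<tau>"])
    fix t assume t: "\<bar>t - t0\<bar> < 1"
    show "integrable (lebesgue_on {0<..}) (\<lambda>\<tau>. inner_int W F \<tau> (t - \<tau>) x)"
      by (intro integrable_outer kernel_continuous_kernels admissible_F lb x)
    fix \<tau> assume "\<tau> \<in> space (lebesgue_on {0::real<..})"
    then have \<tau>: "\<tau> > 0" by simp
    show "((\<lambda>t. inner_int W F \<tau> (t - \<tau>) x) has_real_derivative inner_int W Ft \<tau> (t - \<tau>) x) (at t)"
      by (rule inner_int_shift_has_derivative_t[OF \<tau> x])
    show "\<bar>inner_int W Ft \<tau> (t - \<tau>) x\<bar> \<le> C * indicator {0<..<t0 + 1} \<tau>"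
      using \<tau> t by (intro inner_int_shift_bound[OF admissible_Ft C(1)] C(2)) auto
  qed (use integrable_indicator_pos in auto)
qed

text \<open>Both factors depend on \<tau>; the inner derivative of t - \<tau> gives the minus sign.
  This identity connects the derivative of the source with that of the kernel.\<close>

lemma inner_int_shift_has_derivative_tau:
  assumes \<tau>: "\<tau> > 0" and x: "x > 0"
  shows "((\<lambda>\<tau>. inner_int W F \<tau> (t - \<tau>) x) has_real_derivative
    inner_int (kernel_t \<mu>) F \<tau> (t - \<tau>) x - inner_int W Ft \<tau> (t - \<tau>) x) (at \<tau>)"
proof -
  note F = continuous_on_compose_pair[of UNIV UNIV F, OF F_cont[folded UNIV_Times_UNIV]]
  note Ft = continuous_on_compose_pair[of UNIV UNIV Ft, OF Ft_cont[folded UNIV_Times_UNIV]]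
  have "((\<lambda>\<tau>. \<integral>y. (W \<tau> x y * F (t - \<tau>) y) * 1 \<partial>lebesgue_on {a..b}) has_real_derivative
     (\<integral>y. (kernel_t \<mu> \<tau> x y * F (t - \<tau>) y - W \<tau> x y * Ft (t - \<tau>) y) * 1 \<partial>lebesgue_on {a..b})) (at \<tau>)"
  proof (rule has_real_derivative_kernel_integral[where U="{0<..}"])
    show "continuous_on ({0<..} \<times> {a..b}) (\<lambda>(\<tau>, y). W \<tau> x y * F (t - \<tau>) y)"
      "continuous_on ({0<..} \<times> {a..b}) (\<lambda>(\<tau>, y). kernel_t \<mu> \<tau> x y * F (t - \<tau>) y - W \<tau> x y * Ft (t - \<tau>) y)"
      unfolding case_prod_unfold using a x
      by (auto intro!: continuous_on_mult continuous_on_diff kernel_continuous_compose[OF kernel_continuous_kernels(1)]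
          kernel_continuous_compose[OF kernel_continuous_kernels(2)] F Ft continuous_intros)
    fix \<tau> y :: real assume "\<tau> \<in> {0<..}" "y \<in> {a..b}"
    then have p: "\<tau> > 0" "y > 0" using a by auto
    have "((\<lambda>\<tau>. F (t - \<tau>) y) has_real_derivative Ft (t - \<tau>) y * (- 1)) (at \<tau>)"
      by (rule DERIV_chain2[of "\<lambda>s. F s y"]) (auto intro!: dFt derivative_eq_intros)
    from DERIV_mult[OF bessel_kernel_has_derivative_t[OF p(1) x p(2)] this]
    show "((\<lambda>\<tau>. W \<tau> x y * F (t - \<tau>) y) has_real_derivative
        kernel_t \<mu> \<tau> x y * F (t - \<tau>) y - W \<tau> x y * Ft (t - \<tau>) y) (at \<tau>)"
      by (rule DERIV_cong) simp
  qed (use \<tau> in \<open>simp_all add: continuous_imp_integrable_real\<close>)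
  moreover have "(\<integral>y. (kernel_t \<mu> \<tau> x y * F (t - \<tau>) y - W \<tau> x y * Ft (t - \<tau>) y) \<partial>lebesgue_on {a..b})
    = inner_int (kernel_t \<mu>) F \<tau> (t - \<tau>) x - inner_int W Ft \<tau> (t - \<tau>) x"
    unfolding inner_int_def
    by (intro Bochner_Integration.integral_diff integrable_inner kernel_continuous_kernels admissible_F admissible_Ft \<tau> x)
  ultimately show ?thesis by (simp add: inner_int_def)
qed

lemma F_slice_measurable: "F s \<in> borel_measurable (lebesgue_on {0<..})"
proof -
  have "continuous_on UNIV (F s)"
    using DERIV_continuous_on[of UNIV "F s" "Fy s"] dFy by auto
  then show ?thesis
    by (intro continuous_imp_measurable_on_sets_lebesgue) (auto intro: continuous_on_subset)
qed

lemma F_slice_bound: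
  obtains C where "\<And>s. AE y in lebesgue_on {0<..}. \<bar>F s y\<bar> \<le> C \<and> (y \<notin> {a..b} \<longrightarrow> F s y = 0)"
proof -
  obtain C where C: "C \<ge> 0" "\<And>s y. y \<in> {a..b} \<Longrightarrow> \<bar>F s y\<bar> \<le> C"
    using admissible_bound[OF admissible_F] by blast
  have "AE y in lebesgue_on {0<..}. \<bar>F s y\<bar> \<le> C \<and> (y \<notin> {a..b} \<longrightarrow> F s y = 0)" for s
  proof (rule AE_I2)
    fix y
    show "\<bar>F s y\<bar> \<le> C \<and> (y \<notin> {a..b} \<longrightarrow> F s y = 0)"
    proof (cases "y \<in> {a..b}")
      case False
      then have "F s y = 0" using F_supp[of s y] by auto
      then show ?thesis using C(1) by simp
    qed (use C(2) in simp)
  qed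
  then show ?thesis by (rule that)
qed

text \<open>The kernel concentrates at x while the source time t - \<tau> moves as well, so joint
  continuity of F at (t, x) is what is used.\<close>

lemma inner_int_shift_tendsto:
  assumes x: "x > 0"
  shows "((\<lambda>\<tau>. inner_int W F \<tau> (t - \<tau>) x) \<longlongrightarrow> F t x) (at_right 0)"
proof -
  obtain C where C: "\<And>s. AE y in lebesgue_on {0<..}. \<bar>F s y\<bar> \<le> C \<and> (y \<notin> {a..b} \<longrightarrow> F s y = 0)"
    using F_slice_bound by blast
  have "((\<lambda>\<tau>. LINT y:{0<..}|lebesgue. W \<tau> x y * F (t - \<tau>) y) \<longlongrightarrow> F t x) (at_right 0)"
  proof (rule bessel_kernel_tendsto_of_continuity[OF \<mu> x a])
    fix \<epsilon> :: real assume \<epsilon>: "\<epsilon> > 0"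
    have "continuous (at (t, x)) (\<lambda>(s, y). F s y)"
      using F_cont by (simp add: continuous_on_eq_continuous_at)
    then obtain d where d: "d > 0" "\<And>z. dist z (t, x) < d \<Longrightarrow> dist (case z of (s, y) \<Rightarrow> F s y) (F t x) < \<epsilon>"
      using \<epsilon> unfolding continuous_at_eps_delta by auto
    have "\<bar>F (t - \<tau>) y - F t x\<bar> \<le> \<epsilon>" if "0 < \<tau>" "\<tau> < d / 2" "\<bar>y - x\<bar> < d / 2" for \<tau> y
    proof -
      have "dist (t - \<tau>, y) (t, x) \<le> dist (t - \<tau>) t + dist y x"
        unfolding dist_Pair_Pair by (rule sqrt_sum_squares_le_sum) auto
      also have "\<dots> < d" using that by (simp add: dist_real_def)
      finally show ?thesis using d(2)[of "(t - \<tau>, y)"] by (simp add: dist_real_def)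
    qed
    then show "\<exists>\<delta>>0. \<forall>\<tau> y. 0 < \<tau> \<and> \<tau> < \<delta> \<and> \<bar>y - x\<bar> < \<delta> \<longrightarrow> \<bar>F (t - \<tau>) y - F t x\<bar> \<le> \<epsilon>"
      using d(1) by (intro exI[of _ "d / 2"]) auto
  qed (use F_slice_measurable C in auto)
  moreover have "eventually (\<lambda>\<tau>. (LINT y:{0<..}|lebesgue. W \<tau> x y * F (t - \<tau>) y)
      = inner_int W F \<tau> (t - \<tau>) x) (at_right 0)"
    using eventually_at_right_less[of "0::real"]
  proof eventually_elim
    case (elim \<tau>)
    have "continuous_on {a..b} (W \<tau> x)"
      by (rule continuous_on_subset[OF continuous_on_bessel_kernel_y[OF elim x]]) (use a in auto)
    then show ?case
      unfolding inner_int_def by (rule set_integral_Linfty_support[OF a F_slice_measurable C])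
  qed
  ultimately show ?thesis by (rule Lim_transform_eventually)
qed

text \<open>From \<tau> = t - a on, the source is taken at times up to a, outside its support. Hence
  one value of the integral serves r = t, the truncations r = t - \<epsilon>, and r = 0 for small
  t.\<close>

lemma outer_int_restrict:
  assumes \<Psi>: "admissible \<Psi>" and r: "t - a \<le> r"
  shows "outer_int k \<Psi> t x = (LINT \<tau>:{0<..<r}|lebesgue. inner_int k \<Psi> \<tau> (t - \<tau>) x)"
proof -
  have "indicator {0<..} \<tau> *\<^sub>R inner_int k \<Psi> \<tau> (t - \<tau>) x = indicator {0<..<r} \<tau> *\<^sub>R inner_int k \<Psi> \<tau> (t - \<tau>) x" for \<tau>
  proof (cases "\<tau> < r")
    case False
    then have "t - \<tau> \<notin> {a<..<b}" using r by auto
    then show ?thesis by (simp add: inner_int_eq_0[OF \<Psi>])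
  qed (simp add: indicator_def)
  note eq = this
  have "outer_int k \<Psi> t x = (\<integral>\<tau>. indicator {0<..} \<tau> *\<^sub>R inner_int k \<Psi> \<tau> (t - \<tau>) x \<partial>lebesgue)"
    unfolding outer_int_def by (rule integral_restrict_space) simp
  then show ?thesis unfolding eq set_lebesgue_integral_def .
qed

lemma set_integrable_outer:
  assumes "kernel_continuous k" "admissible \<Psi>" "locally_bounded k \<Psi>" "x > 0"
  shows "set_integrable lebesgue {0<..<r} (\<lambda>\<tau>. inner_int k \<Psi> \<tau> (t - \<tau>) x)"
proof -
  have "set_integrable lebesgue {0<..} (\<lambda>\<tau>. inner_int k \<Psi> \<tau> (t - \<tau>) x)"
    using integrable_outer[OF assms] by (simp add: set_integrable_def integrable_restrict_space)
  then show ?thesis by (rule set_integrable_subset) auto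
qed

text \<open>Integrating the \<open>\<tau>\<close>-derivative of \<open>\<integral> W\<^sub>\<tau>(x, y) F(t - \<tau>, y) dy\<close> over \<open>(0, t)\<close> produces the
  source term \<open>F(t, x)\<close> as the limit at \<open>\<tau> = 0\<close>.\<close>
lemma outer_int_Ft:
  assumes t: "t > 0" and x: "x > 0"
  shows "outer_int W Ft t x = F t x + outer_int (kernel_t \<mu>) F t x"
proof -
  \<comment> \<open>The value at 0 is the limit from the right, which makes D continuous on [0, t];
    the fundamental theorem then needs a derivative only in the interior.\<close>
  define D where "D \<tau> = (if \<tau> \<le> 0 then F t x else inner_int W F \<tau> (t - \<tau>) x)" for \<tau>
  define D' where "D' \<tau> = inner_int (kernel_t \<mu>) F \<tau> (t - \<tau>) x - inner_int W Ft \<tau> (t - \<tau>) x" for \<tau>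
  have der: "(D has_real_derivative D' \<tau>) (at \<tau>)" if "\<tau> > 0" for \<tau>
    unfolding D'_def
    by (rule has_field_derivative_transform_within_open[OF inner_int_shift_has_derivative_tau[OF that x], of "{0<..}"])
      (use that in \<open>auto simp: D_def\<close>)
  have cont0: "(D \<longlongrightarrow> D 0) (at_right 0)"
  proof -
    have "eventually (\<lambda>\<tau>. inner_int W F \<tau> (t - \<tau>) x = D \<tau>) (at_right 0)"
      using eventually_at_right_less[of "0::real"] by eventually_elim (simp add: D_def)
    then show ?thesis
      using Lim_transform_eventually[OF inner_int_shift_tendsto[OF x]] by (simp add: D_def)
  qed
  have "continuous_on {0..t} D"
    unfolding continuous_on_eq_continuous_within
  proof
    fix \<tau> assume \<tau>: "\<tau> \<in> {0..t}"
    show "continuous (at \<tau> within {0..t}) D"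
    proof (cases "\<tau> = 0")
      case True
      have "at 0 within {0..t} = at_right 0"
        using t by (simp add: at_within_Icc_at_right)
      then show ?thesis using cont0 True by (simp add: continuous_within)
    next
      case False
      then have "isCont D \<tau>" using der[of \<tau>] \<tau> by (intro DERIV_isCont) auto
      then show ?thesis by (rule continuous_at_imp_continuous_at_within)
    qed
  qed
  then have "(D' has_integral (D t - D 0)) {0..t}"
    using t der by (intro fundamental_theorem_of_calculus_interior)
      (auto simp: has_real_derivative_iff_has_vector_derivative[symmetric])
  then have hi: "(D' has_integral (D t - D 0)) {0<..<t}"
    by (simp add: has_integral_Icc_iff_Ioo)
  have lb: "locally_bounded (kernel_t \<mu>) F" "locally_bounded W Ft"
    using locally_bounded_kernel_t inner_int_bessel_bound[OF admissible_Ft] by auto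
  note si = set_integrable_outer[OF kernel_continuous_kernels(2) admissible_F lb(1) x, of t]
    set_integrable_outer[OF kernel_continuous_kernels(1) admissible_Ft lb(2) x, of t]
  have "(LINT \<tau>:{0<..<t}|lebesgue. D' \<tau>) = integral {0<..<t} D'"
    unfolding D'_def by (intro set_lebesgue_integral_eq_integral(2) set_integral_diff(1) si)
  also have "\<dots> = D t - D 0" using hi by (rule integral_unique)
  \<comment> \<open>At \<tau> = t the source is taken at time 0, outside its support, so D t
    vanishes and only - D 0 remains.\<close>
  also have "\<dots> = - F t x"
  proof -
    have "0 \<notin> {a<..<b}" using a by simp
    then show ?thesis using t by (simp add: D_def inner_int_eq_0[OF admissible_F])
  qed
  finally have "(LINT \<tau>:{0<..<t}|lebesgue. inner_int (kernel_t \<mu>) F \<tau> (t - \<tau>) x)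
     - (LINT \<tau>:{0<..<t}|lebesgue. inner_int W Ft \<tau> (t - \<tau>) x) = - F t x"
    unfolding D'_def using set_integral_diff(2)[OF si] by simp
  then show ?thesis
    using a by (simp add: outer_int_restrict[OF admissible_F, of t t] outer_int_restrict[OF admissible_Ft, of t t])
qed

lemma outer_int_kernel_t:
  assumes x: "x > 0"
  shows "outer_int (kernel_t \<mu>) F t x
    = outer_int (kernel_xx \<mu>) F t x + (1 / 4 - \<mu>\<^sup>2) / x\<^sup>2 * outer_int W F t x"
proof -
  note i = integrable_outer[OF kernel_continuous_kernels(4) admissible_F locally_bounded_kernel_xx x, of t]
    integrable_outer[OF kernel_continuous_kernels(1) admissible_F inner_int_bessel_bound[OF admissible_F] x, of t]
  have "outer_int (kernel_t \<mu>) F t x = (\<integral>\<tau>. inner_int (kernel_xx \<mu>) F \<tau> (t - \<tau>) x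
      + (1 / 4 - \<mu>\<^sup>2) / x\<^sup>2 * inner_int W F \<tau> (t - \<tau>) x \<partial>lebesgue_on {0<..})"
    unfolding outer_int_def
    by (intro Bochner_Integration.integral_cong refl) (simp add: inner_int_kernel_xx[OF _ x admissible_F])
  then show ?thesis using i by (simp add: outer_int_def)
qed

end

section \<open>Existence of the classical solution\<close>

lemma kernel_section_cont:
  assumes k: "kernel_continuous k" and "t > 0" "x > 0" "0 < c"
  shows "continuous_on {c..d} (k t x)"
  using assms by (intro kernel_continuous_compose[OF k] continuous_intros) auto

lemma deriv_deriv_eq:
  assumes "open S" "x \<in> S" and 1: "\<And>z. z \<in> S \<Longrightarrow> (h has_real_derivative h' z) (at z)"
    and 2: "(h' has_real_derivative h'') (at x)"
  shows "deriv (deriv h) x = h''" and "deriv h field_differentiable at x"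
proof -
  have "(deriv h has_real_derivative h'') (at x)"
    by (rule has_field_derivative_transform_within_open[OF 2 assms(1,2)]) (simp add: DERIV_imp_deriv[OF 1])
  then show "deriv (deriv h) x = h''" "deriv h field_differentiable at x"
    by (auto dest: DERIV_imp_deriv simp: field_differentiable_def)
qed

lemma deriv_bessel_kernel_t:
  assumes "t > 0" "x > 0" "y > 0"
  shows "deriv (\<lambda>s. bessel_kernel \<mu> s x y) t = kernel_t \<mu> t x y"
  using bessel_kernel_has_derivative_t[OF assms] by (rule DERIV_imp_deriv)

lemma deriv_deriv_bessel_kernel_x:
  assumes "t > 0" "x > 0" "y > 0"
  shows "deriv (deriv (\<lambda>z. bessel_kernel \<mu> t z y)) x = kernel_xx \<mu> t x y"
  using assms
  by (intro deriv_deriv_eq(1)[of "{0<..}" _ _ "\<lambda>z. kernel_x \<mu> t z y"]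
      bessel_kernel_has_derivative_x kernel_x_has_derivative_x) auto

lemma has_real_derivative_kernel_family:
  assumes "kernel_continuous k" "kernel_continuous k'" and x: "x > 0" and t: "t > 0" and c: "0 < c"
    and g: "integrable (lebesgue_on {c..d}) g"
  shows "(\<And>t y. t > 0 \<Longrightarrow> y > 0 \<Longrightarrow> ((\<lambda>t. k t x y) has_real_derivative k' t x y) (at t)) \<Longrightarrow>
      ((\<lambda>t. \<integral>y. k t x y * g y \<partial>lebesgue_on {c..d}) has_real_derivative (\<integral>y. k' t x y * g y \<partial>lebesgue_on {c..d})) (at t)"
    and "(\<And>x y. x > 0 \<Longrightarrow> y > 0 \<Longrightarrow> ((\<lambda>x. k t x y) has_real_derivative k' t x y) (at x)) \<Longrightarrow>
      ((\<lambda>x. \<integral>y. k t x y * g y \<partial>lebesgue_on {c..d}) has_real_derivative (\<integral>y. k' t x y * g y \<partial>lebesgue_on {c..d})) (at x)"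
proof -
  have 1: "continuous_on ({0<..} \<times> {c..d}) (\<lambda>(t, y). h t x y)" "continuous_on ({0<..} \<times> {c..d}) (\<lambda>(x, y). h t x y)"
    if "kernel_continuous h" for h
    unfolding case_prod_unfold using c t x
    by (auto intro!: kernel_continuous_compose[OF that] continuous_intros)
  show "((\<lambda>t. \<integral>y. k t x y * g y \<partial>lebesgue_on {c..d}) has_real_derivative (\<integral>y. k' t x y * g y \<partial>lebesgue_on {c..d})) (at t)"
    if "\<And>t y. t > 0 \<Longrightarrow> y > 0 \<Longrightarrow> ((\<lambda>t. k t x y) has_real_derivative k' t x y) (at t)"
    by (rule has_real_derivative_kernel_integral[where U="{0<..}"]) (use that c t g 1 assms(1,2) in auto)
  show "((\<lambda>x. \<integral>y. k t x y * g y \<partial>lebesgue_on {c..d}) has_real_derivative (\<integral>y. k' t x y * g y \<partial>lebesgue_on {c..d})) (at x)"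
    if "\<And>x y. x > 0 \<Longrightarrow> y > 0 \<Longrightarrow> ((\<lambda>x. k t x y) has_real_derivative k' t x y) (at x)"
    by (rule has_real_derivative_kernel_integral[where U="{0<..}"]) (use that c x g 1 assms(1,2) in auto)
qed

lemma continuous_on_kernel_family:
  assumes "kernel_continuous k" and c: "0 < c" and g: "integrable (lebesgue_on {c..d}) g"
  shows "continuous_on quadrant (\<lambda>(t, x). \<integral>y. k t x y * g y \<partial>lebesgue_on {c..d})"
proof -
  have "continuous_on quadrant (\<lambda>p. \<integral>y. k (fst p) (snd p) y * g y \<partial>lebesgue_on {c..d})"
  proof (rule continuous_on_kernel_integral[OF _ _ g])
    show "open quadrant" by (simp add: quadrant_def open_Times)
    show "continuous_on (quadrant \<times> {c..d}) (\<lambda>(p, y). k (fst p) (snd p) y)"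
      unfolding case_prod_unfold using c
      by (intro kernel_continuous_compose[OF assms(1)] continuous_intros) (auto simp: quadrant_def)
  qed
  then show ?thesis by (simp add: case_prod_unfold)
qed

section \<open>Extension of a twice differentiable source by zero\<close>

lemma continuous_extension_by_zero:
  fixes h :: "'a::topological_space \<Rightarrow> real"
  assumes "open S" "closed K" "K \<subseteq> S" "continuous_on S h" and 0: "\<And>z. z \<in> S - K \<Longrightarrow> h z = 0"
  shows "continuous_on UNIV (\<lambda>z. if z \<in> S then h z else 0)"
proof -
  \<comment> \<open>S and the complement of K are open and cover the space; on the second the
    extended function is zero.\<close>
  have "continuous_on (S \<union> - K) (\<lambda>z. if z \<in> S then h z else 0)"
  proof (rule continuous_on_open_Un)
    show "continuous_on S (\<lambda>z. if z \<in> S then h z else 0)"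
      using assms(4) by (rule continuous_on_eq) simp
    show "continuous_on (- K) (\<lambda>z. if z \<in> S then h z else 0)"
      by (rule continuous_on_eq[of _ "\<lambda>_. 0"]) (use 0 in auto)
  qed (use assms in auto)
  moreover have "S \<union> - K = UNIV" using assms(3) by auto
  ultimately show ?thesis by simp
qed

lemma has_real_derivative_extension_by_zero:
  fixes h h' :: "'a::topological_space \<Rightarrow> real" and i :: "real \<Rightarrow> 'a"
  assumes "open S" "closed K" "K \<subseteq> S" and i: "continuous_on UNIV i"
    and d: "i r \<in> S \<Longrightarrow> ((\<lambda>r. h (i r)) has_real_derivative h' (i r)) (at r)"
    and 0: "\<And>z. z \<in> S - K \<Longrightarrow> h z = 0" "\<And>z. z \<in> S - K \<Longrightarrow> h' z = 0"
  shows "((\<lambda>r. if i r \<in> S then h (i r) else 0) has_real_derivative (if i r \<in> S then h' (i r) else 0)) (at r)"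
proof (cases "i r \<in> S")
  case True
  have "open (i -` S)" using assms(1) i by (simp add: open_vimage)
  then show ?thesis
    using has_field_derivative_transform_within_open[OF d[OF True], of "i -` S"] True by auto
next
  case False
  then have r: "r \<in> i -` (- K)" using assms(3) by auto
  have "open (i -` (- K))" using assms(2) i by (intro open_vimage) auto
  then show ?thesis
    using has_field_derivative_transform_within_open[of "\<lambda>_. 0" 0 r "i -` (- K)" "\<lambda>r. if i r \<in> S then h (i r) else 0"]
      r False 0(1) by auto
qed

text \<open>The support condition says only that f vanishes almost everywhere off K. Continuity
  makes this hold everywhere in the quadrant, and then the derivatives vanish off K too, so the
  extensions by zero stay regular.\<close>

lemma bessel_source_of_C2:
  fixes f :: "real \<times> real \<Rightarrow> real"
  assumes \<mu>: "\<mu> > -1" and C2: "C2_on quadrant f" and supp: "compactly_supported_in quadrant f"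
  obtains a b F Ft Fy Fyy where "bessel_source \<mu> a b F Ft Fy Fyy"
    "\<And>s y. s > 0 \<Longrightarrow> y > 0 \<Longrightarrow> f (s, y) = F s y"
proof -
  obtain f' :: "real \<times> real \<Rightarrow> (real \<times> real) \<Rightarrow>\<^sub>L real"
    and f'' :: "real \<times> real \<Rightarrow> (real \<times> real) \<Rightarrow>\<^sub>L ((real \<times> real) \<Rightarrow>\<^sub>L real)"
    where f': "\<And>z. z \<in> quadrant \<Longrightarrow> (f has_derivative blinfun_apply (f' z)) (at z)"
      and f'': "\<And>z. z \<in> quadrant \<Longrightarrow> (f' has_derivative blinfun_apply (f'' z)) (at z)"
      and f''c: "continuous_on quadrant f''"
    using C2 unfolding C2_on_def by blast
  obtain K where K: "compact K" "K \<subseteq> quadrant" "AE z in lebesgue_on quadrant. z \<notin> K \<longrightarrow> f z = 0"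
    using supp by (auto simp: compactly_supported_in_def)
  obtain a0 b0 where ab0: "0 < a0" "a0 < b0" "K \<subseteq> {a0..b0} \<times> {a0..b0}"
    using compact_quadrant_subset_square[OF K(1,2)] by (elim exE conjE)
  \<comment> \<open>Enlarges the square so that K lies in the open one, where the source locale
    wants the support.\<close>
  define a b where "a = a0 / 2" and "b = b0 + 1"
  have ab: "0 < a" "a < b" using ab0 by (auto simp: a_def b_def)
  have Kab: "(s, y) \<notin> K" if "s \<notin> {a<..<b} \<or> y \<notin> {a<..<b}" for s y
  proof
    assume "(s, y) \<in> K"
    then have "(s, y) \<in> {a0..b0} \<times> {a0..b0}" using ab0(3) by (rule rev_subsetD)
    then show False using that ab0 by (auto simp: a_def b_def)
  qed
  have Q: "open quadrant" by (simp add: quadrant_def open_Times)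
  then have Ql: "quadrant \<in> sets lebesgue" by (simp add: borel_open sets_completionI_sets)
  have Kc: "closed K" using K(1) by (rule compact_imp_closed)
  have O: "open (quadrant - K)" using Q Kc by (rule open_Diff)
  have fc: "continuous_on quadrant f"
    using f' by (auto intro!: continuous_at_imp_continuous_on dest: has_derivative_continuous)
  have f'c: "continuous_on quadrant f'"
    using f'' by (auto intro!: continuous_at_imp_continuous_on dest: has_derivative_continuous)
  \<comment> \<open>The points off K where f is nonzero form an open set; being negligible, it is
    empty.\<close>
  have f0: "f z = 0" if z: "z \<in> quadrant - K" for z
  proof (rule ccontr)
    assume nz: "f z \<noteq> 0"
    define N where "N = (quadrant - K) \<inter> f -` (- {0})"
    have "open N" unfolding N_def
      using continuous_on_open_vimage[OF O, of f] continuous_on_subset[OF fc Diff_subset]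
      by (metis Int_commute open_Compl closed_singleton)
    moreover have "z \<in> N" using z nz by (simp add: N_def)
    moreover have "negligible N"
    proof -
      have "AE z in lebesgue. z \<in> quadrant \<longrightarrow> z \<notin> K \<longrightarrow> f z = 0"
        using K(3) Ql by (subst (asm) AE_restrict_space_iff) auto
      then have "AE z in lebesgue. z \<notin> N" by eventually_elim (auto simp: N_def)
      then show ?thesis by (auto simp: eventually_ae_filter_negligible elim: negligible_subset)
    qed
    ultimately show False using open_not_negligible by blast
  qed
  have f'0: "f' z = 0" if z: "z \<in> quadrant - K" for z
  proof -
    have "(f has_derivative (\<lambda>_. 0)) (at z)"
      by (rule has_derivative_transform_within_open[of "\<lambda>_. 0" _ _ _ "quadrant - K"]) (use O z f0 in auto)
    then have "blinfun_apply (f' z) = (\<lambda>_. 0)" using f'[of z] z has_derivative_unique by blast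
    then show ?thesis by (intro blinfun_eqI) simp
  qed
  have f''0: "f'' z = 0" if z: "z \<in> quadrant - K" for z
  proof -
    have "(f' has_derivative (\<lambda>_. 0)) (at z)"
      by (rule has_derivative_transform_within_open[of "\<lambda>_. 0" _ _ _ "quadrant - K"]) (use O z f'0 in auto)
    then have "blinfun_apply (f'' z) = (\<lambda>_. 0)" using f''[of z] z has_derivative_unique by blast
    then show ?thesis by (intro blinfun_eqI) simp
  qed
  define ft fy fyy where "ft z = blinfun_apply (f' z) (1, 0)" and "fy z = blinfun_apply (f' z) (0, 1)"
    and "fyy z = blinfun_apply (blinfun_apply (f'' z) (0, 1)) (0, 1)" for z
  define E where "E h s y = (if (s, y) \<in> quadrant then h (s, y) else 0)" for h :: "real \<times> real \<Rightarrow> real" and s y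
  have E0: "E h s y = 0" if "\<And>z. z \<in> quadrant - K \<Longrightarrow> h z = 0" "s \<notin> {a<..<b} \<or> y \<notin> {a<..<b}" for h s y
    using that(1)[of "(s, y)"] Kab[OF that(2)] by (auto simp: E_def)
  have Ec: "continuous_on UNIV (\<lambda>(s, y). E h s y)" if "continuous_on quadrant h" "\<And>z. z \<in> quadrant - K \<Longrightarrow> h z = 0" for h
    using continuous_extension_by_zero[OF Q Kc K(2) that] by (simp add: E_def case_prod_unfold cong: if_cong)
  have dt: "((\<lambda>r. f (r, y)) has_real_derivative ft (s, y)) (at s)" if "(s, y) \<in> quadrant" for s y
  proof -
    have "((\<lambda>r. (r, y)) has_derivative (\<lambda>h. (h, 0))) (at s)" by (auto intro!: derivative_eq_intros)
    from has_derivative_compose[OF this f'[OF that]]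
    have "((\<lambda>r. f (r, y)) has_derivative (\<lambda>h. blinfun_apply (f' (s, y)) (h, 0))) (at s)" .
    moreover have "blinfun_apply (f' (s, y)) (h, 0) = h * ft (s, y)" for h
      using blinfun.scaleR_right[of "f' (s, y)" h "(1, 0)"] by (simp add: ft_def)
    ultimately show ?thesis by (simp add: has_field_derivative_def mult_commute_abs)
  qed
  have dy: "((\<lambda>r. f (s, r)) has_real_derivative fy (s, y)) (at y)" if "(s, y) \<in> quadrant" for s y
  proof -
    have "((\<lambda>r. (s, r)) has_derivative (\<lambda>h. (0, h))) (at y)" by (auto intro!: derivative_eq_intros)
    from has_derivative_compose[OF this f'[OF that]]
    have "((\<lambda>r. f (s, r)) has_derivative (\<lambda>h. blinfun_apply (f' (s, y)) (0, h))) (at y)" .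
    moreover have "blinfun_apply (f' (s, y)) (0, h) = h * fy (s, y)" for h
      using blinfun.scaleR_right[of "f' (s, y)" h "(0, 1)"] by (simp add: fy_def)
    ultimately show ?thesis by (simp add: has_field_derivative_def mult_commute_abs)
  qed
  have dyy: "((\<lambda>r. fy (s, r)) has_real_derivative fyy (s, y)) (at y)" if "(s, y) \<in> quadrant" for s y
  proof -
    have "((\<lambda>r. (s, r)) has_derivative (\<lambda>h. (0, h))) (at y)" by (auto intro!: derivative_eq_intros)
    from has_derivative_compose[OF this f''[OF that]]
    have "((\<lambda>r. f' (s, r)) has_derivative (\<lambda>h. blinfun_apply (f'' (s, y)) (0, h))) (at y)" .
    from bounded_linear.has_derivative[OF blinfun.bounded_linear_left this, of "(0, 1)"]
    have "((\<lambda>r. fy (s, r)) has_derivative (\<lambda>h. blinfun_apply (blinfun_apply (f'' (s, y)) (0, h)) (0, 1))) (at y)"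
      by (simp add: fy_def)
    moreover have "blinfun_apply (blinfun_apply (f'' (s, y)) (0, h)) (0, 1) = h * fyy (s, y)" for h
      using blinfun.scaleR_right[of "f'' (s, y)" h "(0, 1)"] by (simp add: fyy_def blinfun.scaleR_left)
    ultimately show ?thesis by (simp add: has_field_derivative_def mult_commute_abs)
  qed
  have z0: "ft z = 0" "fy z = 0" "fyy z = 0" if "z \<in> quadrant - K" for z
    using f'0[OF that] f''0[OF that] by (simp_all add: ft_def fy_def fyy_def)
  have "bessel_source \<mu> a b (E f) (E ft) (E fy) (E fyy)"
  proof
    show "((\<lambda>s. E f s y) has_real_derivative E ft s y) (at s)" for s y
      unfolding E_def
      by (rule has_real_derivative_extension_by_zero[OF Q Kc K(2), where i="\<lambda>s. (s, y)"])
        (use dt f0 z0 in \<open>auto intro!: continuous_intros\<close>)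
    show "(E f s has_real_derivative E fy s y) (at y)" for s y
      unfolding E_def[abs_def]
      by (rule has_real_derivative_extension_by_zero[OF Q Kc K(2), where i="\<lambda>y. (s, y)"])
        (use dy f0 z0 in \<open>auto intro!: continuous_intros\<close>)
    show "(E fy s has_real_derivative E fyy s y) (at y)" for s y
      unfolding E_def[abs_def]
      by (rule has_real_derivative_extension_by_zero[OF Q Kc K(2), where i="\<lambda>y. (s, y)"])
        (use dyy z0 in \<open>auto intro!: continuous_intros\<close>)
    have c: "continuous_on quadrant ft" "continuous_on quadrant fyy"
      unfolding ft_def fyy_def by (intro continuous_intros f'c f''c)+
    show "continuous_on UNIV (\<lambda>(s, y). E f s y)" by (intro Ec fc f0)
    show "continuous_on UNIV (\<lambda>(s, y). E ft s y)" by (intro Ec c z0)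
    show "continuous_on UNIV (\<lambda>(s, y). E fyy s y)" by (intro Ec c z0)
    fix s y assume "s \<notin> {a<..<b} \<or> y \<notin> {a<..<b}"
    note E0' = E0[OF _ this]
    show "E f s y = 0" by (intro E0' f0)
    show "E ft s y = 0" "E fy s y = 0" "E fyy s y = 0" by (intro E0' z0; assumption)+
  qed (use \<mu> ab in auto)
  then show ?thesis by (rule that) (simp add: E_def quadrant_def)
qed

text \<open>Outside the open quadrant f is arbitrary while F is zero, so f may be replaced by F only
  at positive source times, that is for \<tau> < t.\<close>

locale bessel_cauchy = bessel_source +
  fixes f :: "real \<times> real \<Rightarrow> real" and g :: "real \<Rightarrow> real" and c d C :: real
  assumes f_eq: "\<And>s y. s > 0 \<Longrightarrow> y > 0 \<Longrightarrow> f (s, y) = F s y"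
    and c: "0 < c"
    and g_meas: "g \<in> borel_measurable (lebesgue_on {0<..})"
    and g_bound: "AE y in lebesgue_on {0<..}. \<bar>g y\<bar> \<le> C \<and> (y \<notin> {c..d} \<longrightarrow> g y = 0)"
begin

definition initial_int :: "(real \<Rightarrow> real \<Rightarrow> real \<Rightarrow> real) \<Rightarrow> real \<Rightarrow> real \<Rightarrow> real" where
  "initial_int k t x = (\<integral>y. k t x y * g y \<partial>lebesgue_on {c..d})"

lemma g_integrable: "integrable (lebesgue_on {c..d}) g"
  by (rule integrable_Linfty_support[OF c g_meas g_bound])

text \<open>The function h stands for the \<open>deriv\<close> expressions of the theorem, which are
  known to equal the closed-form kernel only for y > 0.\<close>

lemma
  assumes k: "kernel_continuous k" and "t > 0" "x > 0" and h: "\<And>y. y > 0 \<Longrightarrow> h y = k t x y"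
  shows set_integrable_initial: "set_integrable lebesgue {0<..} (\<lambda>y. h y * g y)"
    and set_integral_initial: "(LINT y:{0<..}|lebesgue. h y * g y) = initial_int k t x"
proof -
  note kc = kernel_section_cont[OF k assms(2,3) c, of d]
  have "set_integrable lebesgue {0<..} (\<lambda>y. h y * g y) = set_integrable lebesgue {0<..} (\<lambda>y. k t x y * g y)"
    using h by (intro set_integrable_cong) auto
  then show "set_integrable lebesgue {0<..} (\<lambda>y. h y * g y)"
    using set_integrable_Linfty_support[OF c g_meas g_bound kc] by simp
  have "(LINT y:{0<..}|lebesgue. h y * g y) = (LINT y:{0<..}|lebesgue. k t x y * g y)"
    using h by (intro set_lebesgue_integral_cong) auto
  then show "(LINT y:{0<..}|lebesgue. h y * g y) = initial_int k t x"
    using set_integral_Linfty_support[OF c g_meas g_bound kc] by (simp add: initial_int_def)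
qed

lemma
  assumes k: "kernel_continuous k" and "0 < \<tau>" "\<tau> < t" "x > 0" and h: "\<And>y. y > 0 \<Longrightarrow> h y = k \<tau> x y"
  shows set_integrable_source: "set_integrable lebesgue {0<..} (\<lambda>y. h y * f (t - \<tau>, y))"
    and set_integral_source: "(LINT y:{0<..}|lebesgue. h y * f (t - \<tau>, y)) = inner_int k F \<tau> (t - \<tau>) x"
proof -
  obtain M where M: "\<And>s. AE y in lebesgue_on {0<..}. \<bar>F s y\<bar> \<le> M \<and> (y \<notin> {a..b} \<longrightarrow> F s y = 0)"
    using F_slice_bound by blast
  note kc = kernel_section_cont[OF k assms(2,4) a, of b]
  have "set_integrable lebesgue {0<..} (\<lambda>y. h y * f (t - \<tau>, y)) = set_integrable lebesgue {0<..} (\<lambda>y. k \<tau> x y * F (t - \<tau>) y)"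
    using h assms(3) by (intro set_integrable_cong) (auto simp: f_eq)
  then show "set_integrable lebesgue {0<..} (\<lambda>y. h y * f (t - \<tau>, y))"
    using set_integrable_Linfty_support[OF a F_slice_measurable M kc] by simp
  have "(LINT y:{0<..}|lebesgue. h y * f (t - \<tau>, y)) = (LINT y:{0<..}|lebesgue. k \<tau> x y * F (t - \<tau>) y)"
    using h assms(3) by (intro set_lebesgue_integral_cong) (auto simp: f_eq)
  then show "(LINT y:{0<..}|lebesgue. h y * f (t - \<tau>, y)) = inner_int k F \<tau> (t - \<tau>) x"
    using set_integral_Linfty_support[OF a F_slice_measurable M kc] by (simp add: inner_int_def)
qed

lemma
  assumes k: "kernel_continuous k" and lb: "locally_bounded k F" and x: "x > 0" and r: "r \<le> t"
    and h: "\<And>\<tau> y. 0 < \<tau> \<Longrightarrow> y > 0 \<Longrightarrow> h \<tau> y = k \<tau> x y"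
  shows iterated_integrable_source: "iterated_integrable_on {0<..<r} {0<..} (\<lambda>\<tau> y. h \<tau> y * f (t - \<tau>, y))"
    and iterated_integral_source: "t - a \<le> r \<Longrightarrow>
      (LINT \<tau>:{0<..<r}|lebesgue. LINT y:{0<..}|lebesgue. h \<tau> y * f (t - \<tau>, y)) = outer_int k F t x"
proof -
  have eq: "(LINT y:{0<..}|lebesgue. h \<tau> y * f (t - \<tau>, y)) = inner_int k F \<tau> (t - \<tau>) x" if "\<tau> \<in> {0<..<r}" for \<tau>
    using that r h by (intro set_integral_source[OF k _ _ x]) auto
  have "set_integrable lebesgue {0<..<r} (\<lambda>\<tau>. LINT y:{0<..}|lebesgue. h \<tau> y * f (t - \<tau>, y))
    = set_integrable lebesgue {0<..<r} (\<lambda>\<tau>. inner_int k F \<tau> (t - \<tau>) x)"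
    by (rule set_integrable_cong) (use eq in auto)
  then have "set_integrable lebesgue {0<..<r} (\<lambda>\<tau>. LINT y:{0<..}|lebesgue. h \<tau> y * f (t - \<tau>, y))"
    using set_integrable_outer[OF k admissible_F lb x] by simp
  moreover have "set_integrable lebesgue {0<..} (\<lambda>y. h \<tau> y * f (t - \<tau>, y))" if "\<tau> \<in> {0<..<r}" for \<tau>
    using that r h by (intro set_integrable_source[OF k _ _ x]) auto
  ultimately show "iterated_integrable_on {0<..<r} {0<..} (\<lambda>\<tau> y. h \<tau> y * f (t - \<tau>, y))"
    unfolding iterated_integrable_on_def by blast
  assume "t - a \<le> r"
  have "(LINT \<tau>:{0<..<r}|lebesgue. LINT y:{0<..}|lebesgue. h \<tau> y * f (t - \<tau>, y))
      = (LINT \<tau>:{0<..<r}|lebesgue. inner_int k F \<tau> (t - \<tau>) x)"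
    by (rule set_lebesgue_integral_cong) (use eq in auto)
  then show "(LINT \<tau>:{0<..<r}|lebesgue. LINT y:{0<..}|lebesgue. h \<tau> y * f (t - \<tau>, y)) = outer_int k F t x"
    using outer_int_restrict[OF admissible_F \<open>t - a \<le> r\<close>] by simp
qed

text \<open>The truncation is at the end \<tau> = t, where the source vanishes, so for \<epsilon> <
  a the expression is constant. The delicate end \<tau> = 0 is covered by the bound on the inner
  integral.\<close>

lemma iterated_integral_source_tendsto:
  assumes k: "kernel_continuous k" and lb: "locally_bounded k F" and x: "x > 0"
    and h: "\<And>\<tau> y. 0 < \<tau> \<Longrightarrow> y > 0 \<Longrightarrow> h \<tau> y = k \<tau> x y"
  shows "((\<lambda>\<epsilon>. LINT \<tau>:{0<..<t - \<epsilon>}|lebesgue. LINT y:{0<..}|lebesgue. h \<tau> y * f (t - \<tau>, y))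
    \<longlongrightarrow> outer_int k F t x) (at_right 0)"
proof (rule tendsto_eventually)
  show "eventually (\<lambda>\<epsilon>. (LINT \<tau>:{0<..<t - \<epsilon>}|lebesgue. LINT y:{0<..}|lebesgue. h \<tau> y * f (t - \<tau>, y))
    = outer_int k F t x) (at_right 0)"
    using eventually_at_right_real[OF a]
  proof eventually_elim
    case (elim \<epsilon>)
    then show ?case by (intro iterated_integral_source[OF k lb x _ h]) auto
  qed
qed

lemma cauchy_solution_eq:
  assumes "t > 0" "x > 0"
  shows "cauchy_solution \<mu> f g t x = outer_int W F t x + initial_int W t x"
  unfolding cauchy_solution_def
  using iterated_integral_source[OF kernel_continuous_kernels(1) inner_int_bessel_bound[OF admissible_F] assms(2) order_refl, of "\<lambda>\<tau> y. W \<tau> x y" t]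
    set_integral_initial[OF kernel_continuous_kernels(1) assms, of "\<lambda>y. W t x y" \<mu>] a
  by simp

abbreviation u where "u \<equiv> cauchy_solution \<mu> f g"

text \<open>In the Duhamel part the derivative is on the source, in the initial part on the kernel;
  \<open>u_t_eq\<close> later moves it to the kernel in both.\<close>

definition u_t where "u_t t x = outer_int W Ft t x + initial_int (kernel_t \<mu>) t x"
definition u_x where "u_x t x = outer_int (kernel_x \<mu>) F t x + initial_int (kernel_x \<mu>) t x"
definition u_xx where "u_xx t x = outer_int (kernel_xx \<mu>) F t x + initial_int (kernel_xx \<mu>) t x"

lemma u_has_derivative_t:
  assumes "t > 0" "x > 0"
  shows "((\<lambda>t. u t x) has_real_derivative u_t t x) (at t)"
proof (rule has_field_derivative_transform_within_open[where S="{0<..}"])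
  show "((\<lambda>t. outer_int W F t x + initial_int W t x) has_real_derivative u_t t x) (at t)"
    unfolding u_t_def initial_int_def
    by (intro DERIV_add outer_int_has_derivative_t has_real_derivative_kernel_family kernel_continuous_kernels
        bessel_kernel_has_derivative_t assms c g_integrable)
qed (use assms in \<open>auto simp: cauchy_solution_eq\<close>)

lemma u_has_derivative_x:
  assumes "t > 0" "x > 0"
  shows "(u t has_real_derivative u_x t x) (at x)"
proof (rule has_field_derivative_transform_within_open[where S="{0<..}"])
  show "((\<lambda>x. outer_int W F t x + initial_int W t x) has_real_derivative u_x t x) (at x)"
    unfolding u_x_def initial_int_def
    by (intro DERIV_add outer_int_has_derivative_x has_real_derivative_kernel_family kernel_continuous_kernels
        bessel_kernel_has_derivative_x assms c g_integrable admissible_F inner_int_bessel_bound locally_bounded_kernel_x)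
qed (use assms in \<open>auto simp: cauchy_solution_eq\<close>)

lemma u_x_has_derivative_x:
  assumes "t > 0" "x > 0"
  shows "(u_x t has_real_derivative u_xx t x) (at x)"
  unfolding u_x_def[abs_def] u_xx_def initial_int_def
  by (intro DERIV_add outer_int_has_derivative_x has_real_derivative_kernel_family kernel_continuous_kernels
      kernel_x_has_derivative_x assms c g_integrable admissible_F locally_bounded_kernel_x locally_bounded_kernel_xx)

lemma deriv_u:
  assumes "t > 0" "x > 0"
  shows "deriv (\<lambda>s. u s x) t = u_t t x" "deriv (u t) x = u_x t x" "deriv (deriv (u t)) x = u_xx t x"
    "deriv (u t) field_differentiable at x"
  using DERIV_imp_deriv[OF u_has_derivative_t[OF assms]] DERIV_imp_deriv[OF u_has_derivative_x[OF assms]]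
    deriv_deriv_eq[of "{0<..}" x "u t" "u_x t", OF _ _ u_has_derivative_x u_x_has_derivative_x] assms
  by auto

lemma C12_u: "C12_on_quadrant u"
proof -
  have int: "continuous_on quadrant (\<lambda>(t, x). initial_int k t x)" if "kernel_continuous k" for k
    unfolding initial_int_def by (rule continuous_on_kernel_family[OF that c g_integrable])
  have sum: "continuous_on quadrant (\<lambda>(t, x). outer_int k \<Psi> t x + initial_int k' t x)"
    if "kernel_continuous k" "admissible \<Psi>" "locally_bounded k \<Psi>" "kernel_continuous k'" for k k' \<Psi>
    using continuous_on_add[OF continuous_on_outer[OF that(1-3)] int[OF that(4)]]
    by (simp add: case_prod_unfold)
  have "continuous_on quadrant (\<lambda>(t, x). u t x)"
    by (rule continuous_on_eq[OF sum[OF kernel_continuous_kernels(1) admissible_F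
            inner_int_bessel_bound[OF admissible_F] kernel_continuous_kernels(1)]])
      (auto simp: quadrant_def cauchy_solution_eq)
  moreover have "continuous_on quadrant (\<lambda>(t, x). deriv (\<lambda>s. u s x) t)"
    by (rule continuous_on_eq[OF sum[OF kernel_continuous_kernels(1) admissible_Ft
            inner_int_bessel_bound[OF admissible_Ft] kernel_continuous_kernels(2)]])
      (auto simp: quadrant_def deriv_u u_t_def)
  moreover have "continuous_on quadrant (\<lambda>(t, x). deriv (u t) x)"
    by (rule continuous_on_eq[OF sum[OF kernel_continuous_kernels(3) admissible_F
            locally_bounded_kernel_x kernel_continuous_kernels(3)]])
      (auto simp: quadrant_def deriv_u u_x_def)
  moreover have "continuous_on quadrant (\<lambda>(t, x). deriv (deriv (u t)) x)"
    by (rule continuous_on_eq[OF sum[OF kernel_continuous_kernels(4) admissible_F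
            locally_bounded_kernel_xx kernel_continuous_kernels(4)]])
      (auto simp: quadrant_def deriv_u u_xx_def)
  moreover have "(\<lambda>s. u s x) field_differentiable at t" "u t field_differentiable at x" if "t > 0" "x > 0" for t x
    using u_has_derivative_t[OF that] u_has_derivative_x[OF that] unfolding field_differentiable_def by blast+
  ultimately show ?thesis unfolding C12_on_quadrant_def using deriv_u(4) by blast
qed

lemma u_t_eq:
  assumes "t > 0" "x > 0"
  shows "u_t t x = outer_int (kernel_t \<mu>) F t x + initial_int (kernel_t \<mu>) t x + f (t, x)"
  using outer_int_Ft[OF assms] f_eq[OF assms] by (simp add: u_t_def)

lemma u_equation:
  assumes "t > 0" "x > 0"
  shows "deriv (\<lambda>s. u s x) t = bessel_operator \<mu> (u t) x + f (t, x)"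
proof -
  define q where "q = (1 / 4 - \<mu>\<^sup>2) / x\<^sup>2"
  have i: "integrable (lebesgue_on {c..d}) (\<lambda>y. k t x y * g y)" if "kernel_continuous k" for k
    by (intro integrable_continuous_mult kernel_section_cont[OF that assms c] g_integrable)
  have "initial_int (kernel_t \<mu>) t x = (\<integral>y. kernel_xx \<mu> t x y * g y + q * (W t x y * g y) \<partial>lebesgue_on {c..d})"
    unfolding initial_int_def kernel_xx_def q_def
    by (intro Bochner_Integration.integral_cong refl) (simp add: algebra_simps)
  also have "\<dots> = initial_int (kernel_xx \<mu>) t x + q * initial_int W t x"
    unfolding initial_int_def using i[OF kernel_continuous_kernels(1)] i[OF kernel_continuous_kernels(4)] by simp
  finally have "initial_int (kernel_t \<mu>) t x = initial_int (kernel_xx \<mu>) t x + q * initial_int W t x" .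
  moreover have "outer_int (kernel_t \<mu>) F t x = outer_int (kernel_xx \<mu>) F t x + q * outer_int W F t x"
    unfolding q_def by (rule outer_int_kernel_t[OF assms(2)])
  ultimately show ?thesis
    unfolding bessel_operator_def deriv_u[OF assms] u_t_eq[OF assms] u_xx_def cauchy_solution_eq[OF assms] q_def[symmetric]
    by (simp add: distrib_left)
qed

lemma u_initial: "attains_initial_value u g"
proof -
  \<comment> \<open>For t < a the source has not started to act and the Duhamel term is exactly
    zero, so only the initial integral matters in the limit.\<close>
  have ev: "eventually (\<lambda>t. (LINT y:{0<..}|lebesgue. W t x y * g y) = u t x) (at_right 0)" if x: "x > 0" for x
    using eventually_at_right_real[OF a]
  proof eventually_elim
    case (elim t)
    then have t: "t > 0" "t < a" by auto
    have "outer_int W F t x = 0"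
      using outer_int_restrict[OF admissible_F, of t 0 "W" x] t by (simp add: set_lebesgue_integral_def)
    then show ?case
      using cauchy_solution_eq[OF t(1) x] set_integral_initial[OF kernel_continuous_kernels(1) t(1) x, of "W t x" \<mu>]
      by simp
  qed
  have "AE x in lebesgue_on {0<..}. ((\<lambda>t. u t x) \<longlongrightarrow> g x) (at_right 0)"
    using bessel_kernel_tendsto_AE[OF \<mu> c g_meas g_bound] AE_space
  proof eventually_elim
    case (elim x)
    then have "x > 0" by simp
    then show ?case using elim(1) ev by (blast intro: Lim_transform_eventually)
  qed
  moreover have "((\<lambda>t. u t x) \<longlongrightarrow> g x) (at_right 0)" if x: "x > 0" and cont: "isCont g x" for x
  proof -
    have "((\<lambda>t. LINT y:{0<..}|lebesgue. W t x y * g y) \<longlongrightarrow> g x) (at_right 0)"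
    proof (rule bessel_kernel_tendsto_of_continuity[OF \<mu> x c g_meas g_bound])
      fix \<epsilon> :: real assume "\<epsilon> > 0"
      then obtain \<delta> where "\<delta> > 0" "\<And>y. \<bar>y - x\<bar> < \<delta> \<Longrightarrow> \<bar>g y - g x\<bar> < \<epsilon>"
        using cont unfolding continuous_at_eps_delta dist_real_def by blast
      then show "\<exists>\<delta>>0. \<forall>t y. 0 < t \<and> t < \<delta> \<and> \<bar>y - x\<bar> < \<delta> \<longrightarrow> \<bar>g y - g x\<bar> \<le> \<epsilon>"
        by (intro exI[of _ \<delta>]) (auto intro: less_imp_le)
    qed
    then show ?thesis using ev[OF x] by (rule Lim_transform_eventually)
  qed
  ultimately show ?thesis unfolding attains_initial_value_def by blast
qed

lemma classical_solution_u: "classical_solution \<mu> f g u"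
  unfolding classical_solution_def using C12_u u_equation u_initial by blast

end

text \<open>The formula for the time derivative carries the summand \<open>f (t, x)\<close>, which
  the English display does not show. It is the boundary value at \<tau> = 0 from
  \<open>outer_int_Ft\<close>, and it makes the formula agree with the differential equation and
  with the formula for the second x-derivative. Quantifying over L makes convergence of the
  truncated integrals part of the claim.\<close>

theorem theorem4:
  fixes \<mu> :: real and f :: "real \<times> real \<Rightarrow> real" and g :: "real \<Rightarrow> real"
  assumes "\<mu> > -1"
    and "Linfty_on quadrant f" and "compactly_supported_in quadrant f"
    and "Linfty_on {0<..} g" and "compactly_supported_in {0<..} g"
  shows "(\<forall>t>0. \<forall>x>0.
            set_integrable lebesgue ({0<..<t} \<times> {0<..})
              (\<lambda>(\<tau>, y). bessel_kernel \<mu> \<tau> x y * f (t - \<tau>, y)) \<and>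
            set_integrable lebesgue {0<..} (\<lambda>y. bessel_kernel \<mu> t x y * g y)) \<and>
         (C2_on quadrant f \<longrightarrow>
            classical_solution \<mu> f g (cauchy_solution \<mu> f g) \<and>
            (\<forall>t>0. \<forall>x>0.
               (\<forall>\<epsilon>. 0 < \<epsilon> \<and> \<epsilon> < t \<longrightarrow>
                  iterated_integrable_on {0<..<t - \<epsilon>} {0<..}
                    (\<lambda>\<tau> y. deriv (\<lambda>s. bessel_kernel \<mu> s x y) \<tau> * f (t - \<tau>, y))) \<and>
               set_integrable lebesgue {0<..} (\<lambda>y. deriv (\<lambda>s. bessel_kernel \<mu> s x y) t * g y) \<and>
               (\<exists>L. ((\<lambda>\<epsilon>. LINT \<tau>:{0<..<t - \<epsilon>}|lebesgue. LINT y:{0<..}|lebesgue.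
                         deriv (\<lambda>s. bessel_kernel \<mu> s x y) \<tau> * f (t - \<tau>, y)) \<longlongrightarrow> L) (at_right 0) \<and>
                    deriv (\<lambda>s. cauchy_solution \<mu> f g s x) t =
                      L + (LINT y:{0<..}|lebesgue. deriv (\<lambda>s. bessel_kernel \<mu> s x y) t * g y)
                        + f (t, x))) \<and>
            (\<forall>t>0. \<forall>x>0.
               (\<forall>\<epsilon>. 0 < \<epsilon> \<and> \<epsilon> < t \<longrightarrow>
                  iterated_integrable_on {0<..<t - \<epsilon>} {0<..}
                    (\<lambda>\<tau> y. deriv (deriv (\<lambda>z. bessel_kernel \<mu> \<tau> z y)) x * f (t - \<tau>, y))) \<and>
               set_integrable lebesgue {0<..}
                 (\<lambda>y. deriv (deriv (\<lambda>z. bessel_kernel \<mu> t z y)) x * g y) \<and>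
               (\<exists>L. ((\<lambda>\<epsilon>. LINT \<tau>:{0<..<t - \<epsilon>}|lebesgue. LINT y:{0<..}|lebesgue.
                         deriv (deriv (\<lambda>z. bessel_kernel \<mu> \<tau> z y)) x * f (t - \<tau>, y)) \<longlongrightarrow> L) (at_right 0) \<and>
                    deriv (deriv (cauchy_solution \<mu> f g t)) x =
                      L + (LINT y:{0<..}|lebesgue.
                             deriv (deriv (\<lambda>z. bessel_kernel \<mu> t z y)) x * g y))))"
proof (intro conjI impI allI)
  obtain c d C where g: "0 < c" "g \<in> borel_measurable (lebesgue_on {0<..})"
    "AE y in lebesgue_on {0<..}. \<bar>g y\<bar> \<le> C \<and> (y \<notin> {c..d} \<longrightarrow> g y = 0)"
    using Linfty_compact_support_interval[OF assms(4,5)] by blast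
  show "set_integrable lebesgue ({0<..<t} \<times> {0<..}) (\<lambda>(\<tau>, y). bessel_kernel \<mu> \<tau> x y * f (t - \<tau>, y))"
    if "t > 0" "x > 0" for t x
    using set_integrable_bessel_kernel_product[OF assms(1-3) that] .
  show "set_integrable lebesgue {0<..} (\<lambda>y. bessel_kernel \<mu> t x y * g y)" if "t > 0" "x > 0" for t x
    using set_integrable_Linfty_support[OF g kernel_section_cont[OF kernel_continuous_kernels(1) that g(1)]] .
  assume "C2_on quadrant f"
  then obtain a b F Ft Fy Fyy where src: "bessel_source \<mu> a b F Ft Fy Fyy"
    and fF: "\<And>s y. s > 0 \<Longrightarrow> y > 0 \<Longrightarrow> f (s, y) = F s y"
    using bessel_source_of_C2[OF assms(1) _ assms(3)] by blast
  interpret bessel_source \<mu> a b F Ft Fy Fyy by (rule src)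
  interpret bessel_cauchy \<mu> a b F Ft Fy Fyy f g c d C
    by unfold_locales (use fF g in auto)
  show "classical_solution \<mu> f g (cauchy_solution \<mu> f g)" by (rule classical_solution_u)
  fix t x :: real assume t: "0 < t" and x: "0 < x"
  note kt = deriv_bessel_kernel_t[of _ _ _ \<mu>] and kxx = deriv_deriv_bessel_kernel_x[of _ _ _ \<mu>]
  note k = kernel_continuous_kernels(2,4)[of \<mu>] and lb = locally_bounded_kernel_t locally_bounded_kernel_xx
  show "iterated_integrable_on {0<..<t - \<epsilon>} {0<..} (\<lambda>\<tau> y. deriv (\<lambda>s. bessel_kernel \<mu> s x y) \<tau> * f (t - \<tau>, y))"
    if "0 < \<epsilon> \<and> \<epsilon> < t" for \<epsilon>
    using that by (intro iterated_integrable_source[OF k(1) lb(1) x] kt x) auto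
  show "iterated_integrable_on {0<..<t - \<epsilon>} {0<..} (\<lambda>\<tau> y. deriv (deriv (\<lambda>z. bessel_kernel \<mu> \<tau> z y)) x * f (t - \<tau>, y))"
    if "0 < \<epsilon> \<and> \<epsilon> < t" for \<epsilon>
    using that by (intro iterated_integrable_source[OF k(2) lb(2) x] kxx x) auto
  show "set_integrable lebesgue {0<..} (\<lambda>y. deriv (\<lambda>s. bessel_kernel \<mu> s x y) t * g y)"
    by (intro set_integrable_initial[OF k(1) t x] kt t x)
  show "set_integrable lebesgue {0<..} (\<lambda>y. deriv (deriv (\<lambda>z. bessel_kernel \<mu> t z y)) x * g y)"
    by (intro set_integrable_initial[OF k(2) t x] kxx t x)
  show "\<exists>L. ((\<lambda>\<epsilon>. LINT \<tau>:{0<..<t - \<epsilon>}|lebesgue. LINT y:{0<..}|lebesgue.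
           deriv (\<lambda>s. bessel_kernel \<mu> s x y) \<tau> * f (t - \<tau>, y)) \<longlongrightarrow> L) (at_right 0) \<and>
      deriv (\<lambda>s. cauchy_solution \<mu> f g s x) t =
        L + (LINT y:{0<..}|lebesgue. deriv (\<lambda>s. bessel_kernel \<mu> s x y) t * g y) + f (t, x)"
    unfolding deriv_u[OF t x] u_t_eq[OF t x]
    by (intro exI[of _ "outer_int (kernel_t \<mu>) F t x"] conjI
        iterated_integral_source_tendsto[OF k(1) lb(1) x] kt x)
      (simp_all add: set_integral_initial[OF k(1) t x kt[OF t x]])
  show "\<exists>L. ((\<lambda>\<epsilon>. LINT \<tau>:{0<..<t - \<epsilon>}|lebesgue. LINT y:{0<..}|lebesgue.
           deriv (deriv (\<lambda>z. bessel_kernel \<mu> \<tau> z y)) x * f (t - \<tau>, y)) \<longlongrightarrow> L) (at_right 0) \<and>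
      deriv (deriv (cauchy_solution \<mu> f g t)) x =
        L + (LINT y:{0<..}|lebesgue. deriv (deriv (\<lambda>z. bessel_kernel \<mu> t z y)) x * g y)"
    unfolding deriv_u[OF t x] u_xx_def
    by (intro exI[of _ "outer_int (kernel_xx \<mu>) F t x"] conjI
        iterated_integral_source_tendsto[OF k(2) lb(2) x] kxx x)
      (simp_all add: set_integral_initial[OF k(2) t x kxx[OF t x]])
qed

end
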